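(* Let $\beta\in\mathfrak p$ and let $Q=G^{\beta+}$ be the corresponding parabolic subgroup of $G$. Let $W(Q)\subset V$ be the unique nonzero complex subspace preserved by $Q$ on which $Q$ acts irreducibly, and let $\mathcal O(Q)$ be the unique closed orbit of $Q$ contained in $\mathcal O$. Then: (1) $\mu_{\mathfrak p}(\mathcal O(Q))=\mathrm{ext}\,F_\beta(\mathcal E)$; (2) $\mu_{\mathfrak p}^{-1}(F_\beta(\mathcal E))=\mathbb P(W(Q))$; (3) $\mathbb P(W(Q))\cap\mathcal O=\mathcal O(Q)$; (4) $\hat\pi_{W(Q)}(\mathcal O)=\mathcal O(Q)$, i.e. the image under $\hat\pi_{W(Q)}$ of $\mathcal O\setminus\mathbb P(W(Q)^\perp)$ is $\mathcal O(Q)$.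
   Context: Setting: $G$ is a connected noncompact real semisimple Lie group with finite center, $K\subset G$ a maximal compact subgroup, $\mathfrak g=\mathfrak k\oplus\mathfrak p$ the corresponding Cartan decomposition, and $\tau:G\to \mathrm{SL}(V)$ an irreducible representation on a finite-dimensional complex vector space $V$. $h$ is a Hermitian scalar product on $V$ such that $\tau(G)$ is compatible with $\mathrm{SU}(V,h)^{\mathbb C}$, i.e. $\tau(K)\subset \mathrm{SU}(V,h)$, $\tau(\mathfrak p)\subset i\,\mathfrak{su}(V,h)$ and $\tau(G)=\tau(K)\exp(\tau(\mathfrak p))$. $G$ is identified with $\tau(G)$; elements of $\mathfrak p$ are thus Hermitian endomorphisms of $V$, and $G$ acts on $\mathbb P(V)$. Gradient map: fix an $\mathrm{Ad}(K)$-invariant scalar product $\langle\cdot,\cdot\rangle$ on $\mathfrak p$. The $G$-gradient map $\mu_{\mathfrak p}:\mathbb P(V)\to\mathfrak p$ is determined by $\langle\mu_{\mathfrak p}([v]),\beta\rangle=h(\beta v,v)/h(v,v)$ for all $\beta\in\mathfrak p$. The orbit $\mathcal O$: let $U^{\mathbb C}$ be the Zariski closure of $\tau(G)$ in $\mathrm{SL}(V)$; it is complex semisimple, acts irreducibly on $V$, and has a unique closed orbit $\mathcal O'$ in $\mathbb P(V)$. $\mathcal O$ is the unique closed $G$-orbit contained in $\mathcal O'$; it is a $K$-orbit. $\mathcal E=\mathrm{conv}(\mu_{\mathfrak p}(\mathcal O))$; it equals $\mathrm{conv}(\mu_{\mathfrak p}(\mathbb P(V)))$. $G^{\beta+}=\{g\in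 G:\lim_{t\to-\infty}\exp(t\beta)g\exp(-t\beta)\text{ exists}\}$; every parabolic subgroup of $G$ is of this form. $F_\beta(\mathcal E)=\{x\in\mathcal E:\langle x,\beta\rangle=\max_{y\in\mathcal E}\langle y,\beta\rangle\}$ and $\mathrm{ext}$ denotes the set of extreme points. For a complex subspace $W\subset V$, $\pi_W:V\to W$ is the $h$-orthogonal projection and $\hat\pi_W:\mathbb P(V)\setminus\mathbb P(W^\perp)\to\mathbb P(V)$, $\hat\pi_W([v])=[\pi_W(v)]$. Existence and uniqueness of $W(Q)$ and $\mathcal O(Q)$ are known: $W(Q)$ is the eigenspace of the maximum eigenvalue of $\beta$. *)

theory Defs
  imports "HOL-Analysis.Analysis"
begin

text \<open>
  The vector space V is complex^'n with an arbitrary Hermitian scalar product h on it.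
  The group G is identified with its image in SL(V), so G, its subgroups and its Lie algebra are
  sets of complex matrices. Complex linear notions on V carry the prefix vec; notions without it
  (subspace, span, ...) are over the reals and are applied to sets of matrices.
\<close>

type_synonym 'n cvec = "complex^'n"
type_synonym 'n cmat = "complex^'n^'n"


section \<open>Hermitian scalar products\<close>

definition hermitian_product :: "('n::finite cvec \<Rightarrow> 'n cvec \<Rightarrow> complex) \<Rightarrow> bool" where
  "hermitian_product h \<longleftrightarrow>
     (\<forall>a x y z. h (a *s x + y) z = a * h x z + h y z) \<and>
     (\<forall>x y. h y x = cnj (h x y)) \<and>
     (\<forall>x. x \<noteq> 0 \<longrightarrow> Re (h x x) > 0)"

definition SU :: "('n::finite cvec \<Rightarrow> 'n cvec \<Rightarrow> complex) \<Rightarrow> 'n cmat set" where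
  "SU h = {A. (\<forall>x y. h (A *v x) (A *v y) = h x y) \<and> det A = 1}"

definition su :: "('n::finite cvec \<Rightarrow> 'n cvec \<Rightarrow> complex) \<Rightarrow> 'n cmat set" where
  "su h = {A. (\<forall>x y. h (A *v x) y = - h x (A *v y)) \<and> trace A = 0}"

definition orth_compl ::
  "('n::finite cvec \<Rightarrow> 'n cvec \<Rightarrow> complex) \<Rightarrow> 'n cvec set \<Rightarrow> 'n cvec set" where
  "orth_compl h W = {v. \<forall>w\<in>W. h v w = 0}"

definition orth_proj ::
  "('n::finite cvec \<Rightarrow> 'n cvec \<Rightarrow> complex) \<Rightarrow> 'n cvec set \<Rightarrow> 'n cvec \<Rightarrow> 'n cvec" where
  "orth_proj h W v = (THE w. w \<in> W \<and> v - w \<in> orth_compl h W)"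


section \<open>Linear Lie groups and their Lie algebras\<close>

primrec mat_pow :: "'n::finite cmat \<Rightarrow> nat \<Rightarrow> 'n cmat" where
  "mat_pow A 0 = mat 1"
| "mat_pow A (Suc k) = A ** mat_pow A k"

definition mat_exp :: "'n::finite cmat \<Rightarrow> 'n cmat" where
  "mat_exp A = (\<Sum>k. (1 / fact k) *\<^sub>R mat_pow A k)"

definition matrix_subgroup :: "'n::finite cmat set \<Rightarrow> bool" where
  "matrix_subgroup G \<longleftrightarrow>
     (\<forall>g\<in>G. invertible g) \<and> mat 1 \<in> G \<and>
     (\<forall>g\<in>G. \<forall>g'\<in>G. g ** g' \<in> G) \<and> (\<forall>g\<in>G. matrix_inv g \<in> G)"

text \<open>
  A closed subgroup of SL(V) is a real Lie group with the subspace topology. Closedness loses no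
  generality here: a compatible group K exp(p) with K compact is always closed.
\<close>

definition lie_subgroup_SL :: "'n::finite cmat set \<Rightarrow> bool" where
  "lie_subgroup_SL G \<longleftrightarrow> matrix_subgroup G \<and> closed G \<and> (\<forall>g\<in>G. det g = 1)"

definition maximal_compact_subgroup :: "'n::finite cmat set \<Rightarrow> 'n cmat set \<Rightarrow> bool" where
  "maximal_compact_subgroup G K \<longleftrightarrow>
     matrix_subgroup K \<and> compact K \<and> K \<subseteq> G \<and>
     (\<forall>K'. matrix_subgroup K' \<and> compact K' \<and> K' \<subseteq> G \<and> K \<subseteq> K' \<longrightarrow> K' = K)"

definition group_center :: "'n::finite cmat set \<Rightarrow> 'n cmat set" where
  "group_center G = {z\<in>G. \<forall>g\<in>G. z ** g = g ** z}"

definition lie_algebra :: "'n::finite cmat set \<Rightarrow> 'n cmat set" where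
  "lie_algebra G = {X. \<forall>t::real. mat_exp (t *\<^sub>R X) \<in> G}"

definition lie_bracket :: "'n::finite cmat \<Rightarrow> 'n cmat \<Rightarrow> 'n cmat" where
  "lie_bracket X Y = X ** Y - Y ** X"

definition bracket_span :: "'n::finite cmat set \<Rightarrow> 'n cmat set \<Rightarrow> 'n cmat set" where
  "bracket_span S T = span {lie_bracket X Y |X Y. X \<in> S \<and> Y \<in> T}"

primrec derived_series :: "'n::finite cmat set \<Rightarrow> nat \<Rightarrow> 'n cmat set" where
  "derived_series \<aa> 0 = \<aa>"
| "derived_series \<aa> (Suc k) = bracket_span (derived_series \<aa> k) (derived_series \<aa> k)"

definition solvable_lie_algebra :: "'n::finite cmat set \<Rightarrow> bool" where
  "solvable_lie_algebra \<aa> \<longleftrightarrow> (\<exists>k. derived_series \<aa> k = {0})"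

definition lie_ideal :: "'n::finite cmat set \<Rightarrow> 'n cmat set \<Rightarrow> bool" where
  "lie_ideal \<gg> \<aa> \<longleftrightarrow>
     subspace \<aa> \<and> \<aa> \<subseteq> \<gg> \<and> (\<forall>X\<in>\<gg>. \<forall>Y\<in>\<aa>. lie_bracket X Y \<in> \<aa>)"

definition semisimple_lie_algebra :: "'n::finite cmat set \<Rightarrow> bool" where
  "semisimple_lie_algebra \<gg> \<longleftrightarrow>
     (\<forall>\<aa>. lie_ideal \<gg> \<aa> \<and> solvable_lie_algebra \<aa> \<longrightarrow> \<aa> = {0})"

text \<open>
  The trace of ad X o ad Y on a real subspace of matrices, computed in a basis of that subspace
  (it does not depend on the basis).
\<close>

definition killing_form :: "'n::finite cmat set \<Rightarrow> 'n cmat \<Rightarrow> 'n cmat \<Rightarrow> real" where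
  "killing_form \<gg> X Y =
     (let B = (SOME B. independent B \<and> span B = \<gg>)
      in \<Sum>b\<in>B. representation B (lie_bracket X (lie_bracket Y b)) b)"

definition cartan_decomposition ::
  "'n::finite cmat set \<Rightarrow> 'n cmat set \<Rightarrow> 'n cmat set \<Rightarrow> bool" where
  "cartan_decomposition \<gg> \<kk> \<pp> \<longleftrightarrow>
     subspace \<kk> \<and> subspace \<pp> \<and> \<kk> \<inter> \<pp> = {0} \<and> \<gg> = {X + Y |X Y. X \<in> \<kk> \<and> Y \<in> \<pp>} \<and>
     (\<forall>X\<in>\<kk>. \<forall>Y\<in>\<kk>. lie_bracket X Y \<in> \<kk>) \<and>
     (\<forall>X\<in>\<kk>. \<forall>Y\<in>\<pp>. lie_bracket X Y \<in> \<pp>) \<and>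
     (\<forall>X\<in>\<pp>. \<forall>Y\<in>\<pp>. lie_bracket X Y \<in> \<kk>) \<and>
     (\<forall>X\<in>\<kk>. X \<noteq> 0 \<longrightarrow> killing_form \<gg> X X < 0) \<and>
     (\<forall>X\<in>\<pp>. X \<noteq> 0 \<longrightarrow> killing_form \<gg> X X > 0)"

text \<open>The matrix mat \<i> ** X is the scalar multiple of X by the imaginary unit.\<close>

definition compatible ::
  "('n::finite cvec \<Rightarrow> 'n cvec \<Rightarrow> complex) \<Rightarrow>
     'n cmat set \<Rightarrow> 'n cmat set \<Rightarrow> 'n cmat set \<Rightarrow> bool" where
  "compatible h G K \<pp> \<longleftrightarrow>
     K \<subseteq> SU h \<and> \<pp> \<subseteq> {mat \<i> ** X |X. X \<in> su h} \<and>
     G = {k ** mat_exp X |k X. k \<in> K \<and> X \<in> \<pp>}"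

definition Ad_invariant_scalar_product ::
  "'n::finite cmat set \<Rightarrow> 'n cmat set \<Rightarrow> ('n cmat \<Rightarrow> 'n cmat \<Rightarrow> real) \<Rightarrow> bool" where
  "Ad_invariant_scalar_product K \<pp> ip \<longleftrightarrow>
     (\<forall>X\<in>\<pp>. \<forall>Y\<in>\<pp>. \<forall>Z\<in>\<pp>. \<forall>a. ip (a *\<^sub>R X + Y) Z = a * ip X Z + ip Y Z) \<and>
     (\<forall>X\<in>\<pp>. \<forall>Y\<in>\<pp>. ip X Y = ip Y X) \<and>
     (\<forall>X\<in>\<pp>. X \<noteq> 0 \<longrightarrow> ip X X > 0) \<and>
     (\<forall>k\<in>K. \<forall>X\<in>\<pp>. \<forall>Y\<in>\<pp>.
        ip (k ** X ** matrix_inv k) (k ** Y ** matrix_inv k) = ip X Y)"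


section \<open>Irreducibility and Zariski closure\<close>

definition irreducible_subrep :: "'n::finite cmat set \<Rightarrow> 'n cvec set \<Rightarrow> bool" where
  "irreducible_subrep H W \<longleftrightarrow>
     vec.subspace W \<and> W \<noteq> {0} \<and> (\<forall>g\<in>H. \<forall>w\<in>W. g *v w \<in> W) \<and>
     (\<forall>U. vec.subspace U \<and> U \<subseteq> W \<and> (\<forall>g\<in>H. \<forall>u\<in>U. g *v u \<in> U) \<longrightarrow> U = {0} \<or> U = W)"

definition unique_irreducible_subrep :: "'n::finite cmat set \<Rightarrow> 'n cvec set \<Rightarrow> bool" where
  "unique_irreducible_subrep H W \<longleftrightarrow>
     irreducible_subrep H W \<and> (\<forall>W'. irreducible_subrep H W' \<longrightarrow> W' = W)"

text \<open>Complex polynomials in the matrix entries.\<close>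

inductive entry_polynomial :: "('n::finite cmat \<Rightarrow> complex) \<Rightarrow> bool" where
  const: "entry_polynomial (\<lambda>A. c)"
| entry: "entry_polynomial (\<lambda>A. A $ i $ j)"
| add: "entry_polynomial f \<Longrightarrow> entry_polynomial g \<Longrightarrow> entry_polynomial (\<lambda>A. f A + g A)"
| mult: "entry_polynomial f \<Longrightarrow> entry_polynomial g \<Longrightarrow> entry_polynomial (\<lambda>A. f A * g A)"

definition zariski_closure_SL :: "'n::finite cmat set \<Rightarrow> 'n cmat set" where
  "zariski_closure_SL G =
     {A. det A = 1 \<and> (\<forall>f. entry_polynomial f \<and> (\<forall>g\<in>G. f g = 0) \<longrightarrow> f A = 0)}"


section \<open>Projective space\<close>

text \<open>
  Points of projective space are the complex lines through the origin; line v is the point [v].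
  A linear map acts on points by taking images.
\<close>

abbreviation line :: "'n::finite cvec \<Rightarrow> 'n cvec set" where
  "line v \<equiv> vec.span {v}"

definition proj :: "'n::finite cvec set \<Rightarrow> 'n cvec set set" where
  "proj W = {line v |v. v \<in> W \<and> v \<noteq> 0}"

definition act :: "'n::finite cmat \<Rightarrow> 'n cvec set \<Rightarrow> 'n cvec set" where
  "act g L = (\<lambda>v. g *v v) ` L"

lemma act_line: "act g (line v) = line (g *v v)"
  using vec.span_image[of g "{v}"] by (simp add: act_def)

text \<open>The quotient topology along v to [v], from the nonzero vectors.\<close>

definition proj_topology :: "'n::finite cvec set topology" where
  "proj_topology = topology (\<lambda>U. U \<subseteq> proj UNIV \<and> open {v. v \<noteq> 0 \<and> line v \<in> U})"

lemma openin_proj_topology: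
  "openin proj_topology U \<longleftrightarrow> U \<subseteq> proj UNIV \<and> open {v. v \<noteq> 0 \<and> line v \<in> U}"
proof -
  let ?P = "\<lambda>U :: 'a cvec set set. U \<subseteq> proj UNIV \<and> open {v. v \<noteq> 0 \<and> line v \<in> U}"
  have "?P (S \<inter> T)" if "?P S" "?P T" for S T
  proof -
    have "{v. v \<noteq> 0 \<and> line v \<in> S \<inter> T} = {v. v \<noteq> 0 \<and> line v \<in> S} \<inter> {v. v \<noteq> 0 \<and> line v \<in> T}"
      by auto
    then show ?thesis using that by auto
  qed
  moreover have "?P (\<Union>\<K>)" if "\<forall>S\<in>\<K>. ?P S" for \<K>
  proof -
    have "{v. v \<noteq> 0 \<and> line v \<in> \<Union>\<K>} = (\<Union>S\<in>\<K>. {v. v \<noteq> 0 \<and> line v \<in> S})"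
      by auto
    then show ?thesis using that by auto
  qed
  ultimately have "istopology ?P"
    unfolding istopology_def by blast
  then show ?thesis
    by (simp add: proj_topology_def topology_inverse')
qed

lemma topspace_proj_topology: "topspace proj_topology = proj UNIV"
proof -
  have "{v :: 'a cvec. v \<noteq> 0 \<and> line v \<in> proj UNIV} = - {0}"
    by (auto simp: proj_def)
  moreover have "open (- {0 :: 'a cvec})"
    by (simp add: open_Compl)
  ultimately have "openin proj_topology (proj UNIV :: 'a cvec set set)"
    by (simp only: openin_proj_topology) simp
  then show ?thesis
    by (auto simp: topspace_def openin_proj_topology)
qed

definition orbit :: "'n::finite cmat set \<Rightarrow> 'n cvec set \<Rightarrow> 'n cvec set set" where
  "orbit H L = {act g L |g. g \<in> H}"

definition closed_orbit_in ::
  "'n::finite cmat set \<Rightarrow> 'n cvec set set \<Rightarrow> 'n cvec set set \<Rightarrow> bool" where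
  "closed_orbit_in H S C \<longleftrightarrow>
     C \<subseteq> S \<and> (\<exists>L\<in>proj UNIV. C = orbit H L) \<and> closedin proj_topology C"

definition unique_closed_orbit_in ::
  "'n::finite cmat set \<Rightarrow> 'n cvec set set \<Rightarrow> 'n cvec set set \<Rightarrow> bool" where
  "unique_closed_orbit_in H S C \<longleftrightarrow>
     closed_orbit_in H S C \<and> (\<forall>C'. closed_orbit_in H S C' \<longrightarrow> C' = C)"

text \<open>
  For v not orthogonal to W the image of the line [v] under the projection is [pi_W v]; on lines
  contained in the orthogonal complement of W the value {0} is not a point of projective space.
\<close>

definition proj_onto ::
  "('n::finite cvec \<Rightarrow> 'n cvec \<Rightarrow> complex) \<Rightarrow> 'n cvec set \<Rightarrow> 'n cvec set \<Rightarrow> 'n cvec set" where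
  "proj_onto h W L = orth_proj h W ` L"


section \<open>Gradient map, parabolic subgroups and faces\<close>

definition gradient_map ::
  "('n::finite cvec \<Rightarrow> 'n cvec \<Rightarrow> complex) \<Rightarrow> 'n cmat set \<Rightarrow> ('n cmat \<Rightarrow> 'n cmat \<Rightarrow> real) \<Rightarrow>
     ('n cvec set \<Rightarrow> 'n cmat) \<Rightarrow> bool" where
  "gradient_map h \<pp> ip \<mu> \<longleftrightarrow>
     (\<forall>v. v \<noteq> 0 \<longrightarrow> \<mu> (line v) \<in> \<pp> \<and>
        (\<forall>\<beta>\<in>\<pp>. complex_of_real (ip (\<mu> (line v)) \<beta>) = h (\<beta> *v v) v / h v v))"

definition parabolic :: "'n::finite cmat set \<Rightarrow> 'n cmat \<Rightarrow> 'n cmat set" where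
  "parabolic G \<beta> =
     {g\<in>G. \<exists>l\<in>G. ((\<lambda>t::real. mat_exp (t *\<^sub>R \<beta>) ** g ** mat_exp ((- t) *\<^sub>R \<beta>)) \<longlongrightarrow> l) at_bot}"

definition exposed_face ::
  "('n::finite cmat \<Rightarrow> 'n cmat \<Rightarrow> real) \<Rightarrow> 'n cmat \<Rightarrow> 'n cmat set \<Rightarrow> 'n cmat set" where
  "exposed_face ip \<beta> E = {x\<in>E. \<forall>y\<in>E. ip y \<beta> \<le> ip x \<beta>}"

end

theory Submission
  imports Defs
begin

text \<open>
  For \<open>\<gamma>\<close> in \<open>\<pp>\<close> the number \<open>\<langle>\<mu>[v], \<gamma>\<rangle> = h (\<gamma> v) v / h v v\<close> is a Rayleigh quotient: its maximum
  over the whole projective space is the top eigenvalue of \<open>\<gamma>\<close>, attained exactly on the top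
  eigenspace. The orbit \<open>Orb\<close> spans \<open>V\<close> because \<open>G\<close> acts irreducibly, so some \<open>[v]\<close> in it has a
  nonzero component in the top eigenspace; \<open>exp (t \<gamma>) [v]\<close> tends to this component as \<open>t\<close> grows,
  and \<open>Orb\<close> is closed. Hence \<open>Orb\<close> meets the top eigenspace of every \<open>\<gamma>\<close>, and a separation
  argument shows that \<open>E\<close> contains the image of all of projective space. This
  identifies the preimage of the face with the top eigenspace of \<open>\<beta>\<close>. The same limit shows that the
  orthogonal projection of \<open>Orb\<close> is \<open>Orb\<close> cut with the top eigenspace. The top eigenspace is \<open>W\<close>:
  \<open>Q\<close> acts on it through the centralizer of \<open>\<beta>\<close>, which is stable under adjoints, so an invariant
  subspace has an invariant complement there.

  The other two claims rest on \<open>local_product_decomposition\<close>: if the Lie algebra of a closed linear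
  group is a sum of two subspaces, then near the identity every element is a product of an
  exponential from the first and one from the second.

  Taking \<open>\<kk>\<close> and a complementary part of the parabolic algebra, \<open>K_orbit_of_maximizer\<close> proves that
  \<open>Orb\<close> is a \<open>K\<close>-orbit. The base point \<open>x\<close> is chosen with \<open>\<mu> x = \<alpha>\<close> of maximal norm; then \<open>\<mu>\<close> is
  constantly \<open>\<alpha>\<close> on the part of \<open>Orb\<close> in the top eigenspace of \<open>\<alpha>\<close>, which forces the noncompact
  directions of the centralizer of \<open>\<alpha>\<close> to fix \<open>x\<close>. As \<open>\<mu>\<close> is \<open>K\<close>-equivariant, \<open>\<mu> ` Orb\<close> lies on a
  sphere, so all its points are extreme in \<open>E\<close>, and the extreme points of the face are those that
  lie in it.

  Taking the opposite nilradical and the parabolic algebra of \<open>\<beta>\<close>, \<open>parabolic_orbit_neighbourhood\<close>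
  proves that the \<open>Q\<close>-orbits in the part of \<open>Orb\<close> in the top eigenspace are open there. Hence they
  are also closed, and by uniqueness of the closed \<open>Q\<close>-orbit there is only one.
\<close>

section \<open>The matrix exponential\<close>

text \<open>
  A copy of the bounded endomorphisms on which composition is the multiplication. It is a Banach
  algebra, so the exponential series of Banach algebras can be transported to matrices. The type of
  matrices itself is no such algebra: its multiplication is componentwise.
\<close>
typedef 'n endo = "UNIV :: ('n::finite cvec \<Rightarrow>\<^sub>L 'n cvec) set"
  morphisms endo_map Endo by simp

setup_lifting type_definition_endo

instantiation endo :: (finite) real_normed_algebra_1
begin

lift_definition zero_endo :: "'a endo" is 0 .
lift_definition one_endo :: "'a endo" is id_blinfun .
lift_definition plus_endo :: "'a endo \<Rightarrow> 'a endo \<Rightarrow> 'a endo" is "(+)" .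
lift_definition minus_endo :: "'a endo \<Rightarrow> 'a endo \<Rightarrow> 'a endo" is "(-)" .
lift_definition uminus_endo :: "'a endo \<Rightarrow> 'a endo" is uminus .
lift_definition times_endo :: "'a endo \<Rightarrow> 'a endo \<Rightarrow> 'a endo" is "(o\<^sub>L)" .
lift_definition scaleR_endo :: "real \<Rightarrow> 'a endo \<Rightarrow> 'a endo" is scaleR .
lift_definition norm_endo :: "'a endo \<Rightarrow> real" is norm .
definition dist_endo :: "'a endo \<Rightarrow> 'a endo \<Rightarrow> real" where
  "dist_endo S T = norm (S - T)"
definition sgn_endo :: "'a endo \<Rightarrow> 'a endo" where
  "sgn_endo T = inverse (norm T) *\<^sub>R T"
definition uniformity_endo :: "('a endo \<times> 'a endo) filter" where
  "uniformity_endo = (INF e\<in>{0 <..}. principal {(x, y). dist x y < e})"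
definition open_endo :: "'a endo set \<Rightarrow> bool" where
  "open_endo U \<longleftrightarrow> (\<forall>x\<in>U. eventually (\<lambda>(x', y). x' = x \<longrightarrow> y \<in> U) uniformity)"

instance
proof
  fix S T R :: "'a endo" and a b :: real and U :: "'a endo set"
  show "dist S T = norm (S - T)" by (rule dist_endo_def)
  show "sgn T = inverse (norm T) *\<^sub>R T" by (rule sgn_endo_def)
  show "(uniformity :: ('a endo \<times> 'a endo) filter) =
      (INF e\<in>{0 <..}. principal {(x, y). dist x y < e})"
    by (rule uniformity_endo_def)
  show "open U \<longleftrightarrow> (\<forall>x\<in>U. eventually (\<lambda>(x', y). x' = x \<longrightarrow> y \<in> U) uniformity)"
    by (rule open_endo_def)
  show "S * T * R = S * (T * R)"
    by transfer (auto intro!: blinfun_eqI)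
  show "(S + T) * R = S * R + T * R" "S * (T + R) = S * T + S * R"
    "a *\<^sub>R S * T = a *\<^sub>R (S * T)" "S * a *\<^sub>R T = a *\<^sub>R (S * T)"
    by (transfer, auto intro!: blinfun_eqI simp: blinfun.bilinear_simps)+
  show "1 * S = S" "S * 1 = S"
    by (transfer, auto intro!: blinfun_eqI)+
  show "norm (S * T) \<le> norm S * norm T"
    by transfer (rule norm_blinfun_compose)
  show "norm (1 :: 'a endo) = 1"
    by transfer (rule norm_blinfun_id)
  show "(0 :: 'a endo) \<noteq> 1"
    by transfer (metis norm_blinfun_id norm_zero zero_neq_one)
  show "norm (S + T) \<le> norm S + norm T"
    by transfer (rule norm_triangle_ineq)
qed (transfer; simp add: algebra_simps)+

end

instance endo :: (finite) banach
proof
  fix X :: "nat \<Rightarrow> 'a endo"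
  assume "Cauchy X"
  have iso: "dist S T = dist (endo_map S) (endo_map T)" for S T :: "'a endo"
    unfolding dist_norm by transfer simp
  have "Cauchy (\<lambda>n. endo_map (X n))"
    using \<open>Cauchy X\<close> unfolding Cauchy_def iso .
  then obtain T where T: "(\<lambda>n. endo_map (X n)) \<longlonglongrightarrow> T"
    using Cauchy_convergent convergent_def by blast
  then have "X \<longlonglongrightarrow> Endo T"
    unfolding lim_sequentially iso by (simp add: Endo_inverse)
  then show "convergent X" by (auto simp: convergent_def)
qed

definition endo_of_mat :: "'n::finite cmat \<Rightarrow> 'n endo" where
  "endo_of_mat A = Endo (Blinfun (\<lambda>v. A *v v))"

definition mat_of_endo :: "'n::finite endo \<Rightarrow> 'n cmat" where
  "mat_of_endo T = (\<chi> i j. blinfun_apply (endo_map T) (axis j 1) $ i)"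

lemma cmatrix_vector_scaleR: "A *v (r *\<^sub>R v) = r *\<^sub>R (A *v v)" for A :: "'n::finite cmat"
  by (simp add: matrix_vector_mult_def vec_eq_iff scaleR_sum_right mult_scaleR_right)

lemma scaleR_matrix_vector_mult: "(r *\<^sub>R A) *v v = r *\<^sub>R (A *v v)" for A :: "'n::finite cmat"
  by (simp add: matrix_vector_mult_def vec_eq_iff scaleR_sum_right)

lemma blinfun_apply_endo_of_mat: "blinfun_apply (endo_map (endo_of_mat A)) v = A *v v"
proof -
  have "bounded_linear (\<lambda>v. A *v v)"
    by (rule matrix_vector_mul_bounded_linear)
  then show ?thesis
    by (simp add: endo_of_mat_def Endo_inverse bounded_linear_Blinfun_apply)
qed

lemma endo_eqI: "(\<And>v. blinfun_apply (endo_map S) v = blinfun_apply (endo_map T) v) \<Longrightarrow> S = T"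
  by (metis blinfun_eqI endo_map_inject)

lemma endo_of_mat_mult: "endo_of_mat (A ** B) = endo_of_mat A * endo_of_mat B"
  by (rule endo_eqI)
    (simp add: blinfun_apply_endo_of_mat times_endo.rep_eq matrix_vector_mul_assoc)

lemma endo_of_mat_1: "endo_of_mat (mat 1) = 1"
  by (rule endo_eqI) (simp add: blinfun_apply_endo_of_mat one_endo.rep_eq)

lemma bounded_linear_endo_of_mat: "bounded_linear (endo_of_mat :: 'n::finite cmat \<Rightarrow> _)"
  unfolding linear_conv_bounded_linear[symmetric]
  by (rule linearI; rule endo_eqI)
    (simp_all add: blinfun_apply_endo_of_mat plus_endo.rep_eq scaleR_endo.rep_eq
      blinfun.bilinear_simps matrix_vector_mult_add_rdistrib scaleR_matrix_vector_mult)

lemma mat_of_endo_of_mat: "mat_of_endo (endo_of_mat A) = A"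
  unfolding mat_of_endo_def blinfun_apply_endo_of_mat
  by (simp add: vec_eq_iff matrix_vector_mult_def axis_def if_distrib[where f="\<lambda>c. a * c" for a]
      cong: if_cong)

lemma bounded_linear_mat_of_endo: "bounded_linear (mat_of_endo :: 'n::finite endo \<Rightarrow> _)"
proof (rule bounded_linear_intro)
  fix S T :: "'n endo" and r :: real
  show "mat_of_endo (S + T) = mat_of_endo S + mat_of_endo T"
    by (simp add: mat_of_endo_def vec_eq_iff plus_endo.rep_eq blinfun.bilinear_simps)
  show "mat_of_endo (r *\<^sub>R T) = r *\<^sub>R mat_of_endo T"
    by (simp add: mat_of_endo_def vec_eq_iff scaleR_endo.rep_eq blinfun.bilinear_simps)
  have entry: "norm (mat_of_endo T $ i $ j) \<le> norm T" for i j
  proof -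
    have "norm (mat_of_endo T $ i $ j) \<le> norm (blinfun_apply (endo_map T) (axis j 1))"
      by (simp add: mat_of_endo_def component_le_norm_cart Finite_Cartesian_Product.norm_nth_le)
    also have "\<dots> \<le> norm (endo_map T) * norm (axis j (1 :: complex))"
      by (rule norm_blinfun)
    finally show ?thesis by (simp add: norm_endo.rep_eq norm_axis_1)
  qed
  have "norm (mat_of_endo T) \<le> (\<Sum>i\<in>UNIV. norm (mat_of_endo T $ i))"
    unfolding norm_vec_def[of "mat_of_endo T"] by (rule L2_set_le_sum) simp
  also have "\<dots> \<le> (\<Sum>i\<in>UNIV. \<Sum>j\<in>UNIV. norm (mat_of_endo T $ i $ j))"
    by (intro sum_mono) (simp add: norm_vec_def L2_set_le_sum)
  also have "\<dots> \<le> (\<Sum>i\<in>(UNIV :: 'n set). \<Sum>j\<in>(UNIV :: 'n set). norm T)"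
    by (intro sum_mono entry)
  finally show "norm (mat_of_endo T) \<le> norm T * (real CARD('n) * real CARD('n))"
    by (simp add: mult_ac)
qed

lemma endo_of_mat_pow: "endo_of_mat (mat_pow A k) = endo_of_mat A ^ k"
  by (induction k) (simp_all add: endo_of_mat_1 endo_of_mat_mult)

lemma mat_exp_sums: "(\<lambda>k. (1 / fact k) *\<^sub>R mat_pow A k) sums mat_exp A"
  and endo_of_mat_exp: "endo_of_mat (mat_exp A) = exp (endo_of_mat A)"
proof -
  let ?f = "\<lambda>k. (1 / fact k) *\<^sub>R mat_pow A k"
  have "(\<lambda>k. endo_of_mat A ^ k /\<^sub>R fact k) sums exp (endo_of_mat A)"
    unfolding exp_def by (rule summable_sums) (rule summable_exp_generic)
  moreover have eq: "endo_of_mat A ^ k /\<^sub>R fact k = endo_of_mat (?f k)" for k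
    by (simp add: endo_of_mat_pow divide_inverse
        linear_scale[OF bounded_linear.linear[OF bounded_linear_endo_of_mat]])
  ultimately have s: "(\<lambda>k. endo_of_mat (?f k)) sums exp (endo_of_mat A)" by simp
  from bounded_linear.sums[OF bounded_linear_mat_of_endo this]
  show 1: "?f sums mat_exp A"
    unfolding mat_of_endo_of_mat mat_exp_def by (rule summable_sums[OF sums_summable])
  from bounded_linear.sums[OF bounded_linear_endo_of_mat this]
  show "endo_of_mat (mat_exp A) = exp (endo_of_mat A)"
    using s sums_unique2 by blast
qed

lemma mat_exp_conv_exp: "mat_exp A = mat_of_endo (exp (endo_of_mat A))"
  by (metis endo_of_mat_exp mat_of_endo_of_mat)

lemma mat_exp_0 [simp]: "mat_exp 0 = mat 1"
proof -
  have "endo_of_mat (mat_exp (0 :: 'a cmat)) = endo_of_mat (mat 1)"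
    by (simp add: endo_of_mat_exp endo_of_mat_1
        linear_0[OF bounded_linear.linear[OF bounded_linear_endo_of_mat]])
  then show ?thesis by (metis mat_of_endo_of_mat)
qed

lemma mat_exp_add_commuting:
  assumes "A ** B = B ** A"
  shows "mat_exp (A + B) = mat_exp A ** mat_exp B"
proof -
  have "endo_of_mat A * endo_of_mat B = endo_of_mat B * endo_of_mat A"
    using assms by (metis endo_of_mat_mult)
  then have "endo_of_mat (mat_exp (A + B)) = endo_of_mat (mat_exp A ** mat_exp B)"
    unfolding endo_of_mat_exp endo_of_mat_mult
      linear_add[OF bounded_linear.linear[OF bounded_linear_endo_of_mat]]
    by (rule exp_add_commuting)
  then show ?thesis by (metis mat_of_endo_of_mat)
qed

text \<open>On each ball the series converges uniformly, by comparison with the real series.\<close>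
lemma continuous_exp_banach_algebra:
  "continuous_on UNIV (exp :: 'a::{real_normed_algebra_1,banach} \<Rightarrow> 'a)"
proof -
  have "continuous_on (ball 0 r) (exp :: 'a \<Rightarrow> 'a)" for r
  proof (rule uniform_limit_theorem)
    let ?f = "\<lambda>n (x :: 'a). x ^ n /\<^sub>R fact n"
    have "norm (?f n x) \<le> r ^ n /\<^sub>R fact n" if "x \<in> ball 0 r" for n and x :: 'a
    proof -
      have "norm (x ^ n) \<le> norm x ^ n" by (rule norm_power_ineq)
      also have "\<dots> \<le> r ^ n" using that by (intro power_mono) auto
      finally show ?thesis by (simp add: mult_left_mono)
    qed
    then show "uniform_limit (ball 0 r) (\<lambda>n x. \<Sum>i<n. ?f i x) exp sequentially"
      unfolding exp_def by (rule Weierstrass_m_test[OF _ summable_exp_generic])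
  qed (auto intro!: always_eventually continuous_intros)
  then have "isCont exp x" for x :: 'a
    using continuous_on_eq_continuous_at[of "ball 0 (norm x + 1)" exp] by auto
  then show ?thesis by (simp add: continuous_on_eq_continuous_at)
qed

lemma continuous_mat_exp: "continuous_on UNIV (mat_exp :: 'n::finite cmat \<Rightarrow> _)"
proof -
  have "continuous_on UNIV (\<lambda>X :: 'n cmat. endo_of_mat X)"
    by (rule bounded_linear.continuous_on[OF bounded_linear_endo_of_mat continuous_on_id])
  from continuous_on_compose2[OF continuous_exp_banach_algebra this]
  have "continuous_on UNIV (\<lambda>X :: 'n cmat. exp (endo_of_mat X))" by simp
  from bounded_linear.continuous_on[OF bounded_linear_mat_of_endo this]
  show ?thesis by (simp add: mat_exp_conv_exp)
qed

lemma tendsto_mat_exp [tendsto_intros]: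
  "(f \<longlongrightarrow> A) F \<Longrightarrow> ((\<lambda>x. mat_exp (f x)) \<longlongrightarrow> mat_exp A) F"
  using continuous_mat_exp by (auto simp: continuous_on_eq_continuous_at
      intro: isCont_tendsto_compose)

text \<open>
  The norm of the remainder \<open>exp x - 1 - x\<close> is at most the same remainder of the real exponential
  at \<open>norm x\<close>.
\<close>
lemma has_derivative_exp_0: "(exp has_derivative (\<lambda>x. x)) (at (0 :: 'a::{real_normed_algebra_1,banach}))"
proof -
  have bound: "norm (exp x - 1 - x) \<le> exp (norm x) - 1 - norm x" for x :: 'a
  proof -
    have tail: "(\<lambda>n. y ^ (n + 2) /\<^sub>R fact (n + 2)) sums (exp y - 1 - y)"
      for y :: "'b::{real_normed_algebra_1,banach}"
    proof -
      have "(\<lambda>n. y ^ n /\<^sub>R fact n) sums exp y"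
        unfolding exp_def by (rule summable_sums[OF summable_exp_generic])
      from sums_split_initial_segment[OF this, of 2]
      show ?thesis by (simp add: numeral_2_eq_2 algebra_simps)
    qed
    have s: "summable (\<lambda>n. norm x ^ (n + 2) /\<^sub>R fact (n + 2))"
      using tail[of "norm x"] by (rule sums_summable)
    have le: "norm (x ^ n /\<^sub>R fact n) \<le> norm x ^ n /\<^sub>R fact n" for n
      by (simp add: norm_power_ineq mult_left_mono)
    have ns: "summable (\<lambda>n. norm (x ^ (n + 2) /\<^sub>R fact (n + 2)))"
      by (rule summable_comparison_test'[OF s]) (use le[of "_ + 2"] in \<open>simp only: real_norm_def abs_norm_cancel\<close>)
    have "norm (\<Sum>n. x ^ (n + 2) /\<^sub>R fact (n + 2)) \<le> (\<Sum>n. norm (x ^ (n + 2) /\<^sub>R fact (n + 2)))"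
      by (rule summable_norm[OF ns])
    also have "\<dots> \<le> (\<Sum>n. norm x ^ (n + 2) /\<^sub>R fact (n + 2))"
      by (intro suminf_le ns s le)
    finally have "norm (\<Sum>n. x ^ (n + 2) /\<^sub>R fact (n + 2)) \<le> (\<Sum>n. norm x ^ (n + 2) /\<^sub>R fact (n + 2))" .
    then show ?thesis
      using tail[of x] tail[of "norm x"] by (simp add: sums_iff)
  qed
  have "((\<lambda>r. (exp r - 1 - r) / r) \<longlongrightarrow> 0) (at (0 :: real))"
  proof -
    have "((\<lambda>r. (exp r - 1) / r) \<longlongrightarrow> 1) (at (0 :: real))"
      using DERIV_exp[of "0::real"] by (simp add: DERIV_def)
    then have "((\<lambda>r. (exp r - 1) / r - 1) \<longlongrightarrow> 1 - 1) (at (0 :: real))"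
      by (intro tendsto_diff tendsto_const)
    moreover have "\<forall>\<^sub>F r in at (0 :: real). (exp r - 1) / r - 1 = (exp r - 1 - r) / r"
      unfolding eventually_at_filter by (rule always_eventually) (simp add: field_simps)
    ultimately show ?thesis
      using Lim_transform_eventually by fastforce
  qed
  moreover have "filterlim norm (at 0) (at (0 :: 'a))"
    by (auto simp: filterlim_at eventually_at_filter intro!: tendsto_eq_intros)
  ultimately have lim: "((\<lambda>x :: 'a. (exp (norm x) - 1 - norm x) / norm x) \<longlongrightarrow> 0) (at 0)"
    by (rule filterlim_compose)
  show ?thesis
    unfolding has_derivative_at
    by (auto simp: intro!: Lim_null_comparison[OF _ lim] always_eventually divide_right_mono bound)
qed

lemma has_derivative_mat_exp_0: "(mat_exp has_derivative (\<lambda>X. X)) (at (0 :: 'n::finite cmat))"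
proof -
  have 0: "endo_of_mat (0 :: 'n cmat) = 0"
    using bounded_linear.linear[OF bounded_linear_endo_of_mat] by (rule linear_0)
  have "(endo_of_mat has_derivative endo_of_mat) (at (0 :: 'n cmat))"
    by (rule bounded_linear_imp_has_derivative[OF bounded_linear_endo_of_mat])
  moreover have "(exp has_derivative (\<lambda>x. x)) (at (endo_of_mat (0 :: 'n cmat)))"
    unfolding 0 by (rule has_derivative_exp_0)
  ultimately have "((\<lambda>X :: 'n cmat. exp (endo_of_mat X)) has_derivative endo_of_mat) (at 0)"
    by (rule has_derivative_compose)
  from bounded_linear.has_derivative[OF bounded_linear_mat_of_endo this]
  show ?thesis unfolding mat_exp_conv_exp[symmetric] mat_of_endo_of_mat .
qed


subsection \<open>Conjugation, eigenvectors and velocity\<close>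

lemma bounded_bilinear_matrix_mult: "bounded_bilinear ((**) :: 'n::finite cmat \<Rightarrow> 'n cmat \<Rightarrow> 'n cmat)"
  unfolding bilinear_conv_bounded_bilinear[symmetric] bilinear_def
  by (auto simp: linear_iff matrix_matrix_mult_def vec_eq_iff scaleR_sum_right sum.distrib
      algebra_simps)

interpretation matrix_mult: bounded_bilinear "(**) :: 'n::finite cmat \<Rightarrow> 'n cmat \<Rightarrow> 'n cmat"
  by (rule bounded_bilinear_matrix_mult)

lemma bounded_bilinear_matrix_vector_mult:
  "bounded_bilinear ((*v) :: 'n::finite cmat \<Rightarrow> 'n cvec \<Rightarrow> 'n cvec)"
  unfolding bilinear_conv_bounded_bilinear[symmetric] bilinear_def
  by (auto intro!: linearI simp: matrix_vector_right_distrib matrix_vector_mult_add_rdistrib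
      cmatrix_vector_scaleR scaleR_matrix_vector_mult)

interpretation matrix_vector: bounded_bilinear "(*v) :: 'n::finite cmat \<Rightarrow> 'n cvec \<Rightarrow> 'n cvec"
  by (rule bounded_bilinear_matrix_vector_mult)

lemma scaleR_conv_scale: "r *\<^sub>R v = complex_of_real r *s v" for v :: "'n::finite cvec"
  unfolding vec_eq_iff vector_scaleR_component vector_smult_component
  by (simp add: scaleR_conv_of_real)

lemma mat_exp_minus: "mat_exp X ** mat_exp (- X) = mat 1" "mat_exp (- X) ** mat_exp X = mat 1"
  using mat_exp_add_commuting[of X "- X"] mat_exp_add_commuting[of "- X" X]
  by (simp_all add: matrix_mult.minus_left matrix_mult.minus_right)

lemma mat_exp_add_scaleR: "mat_exp ((s + t) *\<^sub>R X) = mat_exp (s *\<^sub>R X) ** mat_exp (t *\<^sub>R X)"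
  unfolding scaleR_add_left
  by (rule mat_exp_add_commuting) (simp add: matrix_mult.scaleR_left matrix_mult.scaleR_right)

lemma mat_exp_conj:
  fixes A B X :: "'n::finite cmat"
  assumes "A ** B = mat 1" "B ** A = mat 1"
  shows "mat_exp (A ** X ** B) = A ** mat_exp X ** B"
proof -
  have pow: "mat_pow (A ** X ** B) k = A ** mat_pow X k ** B" for k
  proof (induction k)
    case (Suc k)
    have "A ** X ** B ** (A ** mat_pow X k ** B) = A ** X ** (B ** A) ** mat_pow X k ** B"
      by (simp only: matrix_mul_assoc)
    with Suc show ?case by (simp add: assms matrix_mul_assoc)
  qed (simp add: assms)
  have "bounded_linear (\<lambda>M. A ** M ** B)"
    using bounded_linear_compose[OF matrix_mult.bounded_linear_left matrix_mult.bounded_linear_right] .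
  from bounded_linear.sums[OF this mat_exp_sums[of X]]
  have "(\<lambda>k. (1 / fact k) *\<^sub>R mat_pow (A ** X ** B) k) sums (A ** mat_exp X ** B)"
    by (simp add: pow matrix_mult.scaleR_left matrix_mult.scaleR_right)
  then show ?thesis using mat_exp_sums[of "A ** X ** B"] sums_unique2 by blast
qed

lemma mat_exp_eigenvector:
  assumes "X *v v = c *\<^sub>R v"
  shows "mat_exp X *v v = exp c *\<^sub>R v"
proof -
  have pow: "mat_pow X k *v v = c ^ k *\<^sub>R v" for k
    by (induction k) (simp_all add: assms cmatrix_vector_scaleR flip: matrix_vector_mul_assoc)
  from bounded_linear.sums[OF matrix_vector.bounded_linear_left[of v] mat_exp_sums[of X]]
  have "(\<lambda>k. (c ^ k /\<^sub>R fact k) *\<^sub>R v) sums (mat_exp X *v v)"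
    by (simp add: pow scaleR_matrix_vector_mult divide_inverse mult.commute)
  moreover have "(\<lambda>k. (c ^ k /\<^sub>R fact k) *\<^sub>R v) sums (exp c *\<^sub>R v)"
    unfolding exp_def
    by (rule bounded_linear.sums[OF bounded_linear_scaleR_left])
      (rule summable_sums[OF summable_exp_generic])
  ultimately show ?thesis by (rule sums_unique2)
qed

lemma has_vector_derivative_mat_exp:
  "((\<lambda>t. mat_exp (t *\<^sub>R X)) has_vector_derivative X) (at 0)"
proof -
  have "((\<lambda>t. mat_exp (t *\<^sub>R X)) has_derivative (\<lambda>t. t *\<^sub>R X)) (at 0)"
    using has_derivative_compose[of "\<lambda>t::real. t *\<^sub>R X" "\<lambda>t. t *\<^sub>R X" 0 UNIV mat_exp "\<lambda>X. X"]
      has_derivative_mat_exp_0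
    by (simp add: bounded_linear_imp_has_derivative bounded_linear_scaleR_left)
  then show ?thesis by (simp add: has_vector_derivative_def)
qed



section \<open>Hermitian forms and the spectral theorem\<close>

locale hermitian_space =
  fixes h :: "'n::finite cvec \<Rightarrow> 'n cvec \<Rightarrow> complex"
  assumes hermitian: "hermitian_product h"
begin

lemma add_scale_left: "h (a *s x + y) z = a * h x z + h y z"
  and conj_sym: "h y x = cnj (h x y)"
  and self_pos: "x \<noteq> 0 \<Longrightarrow> Re (h x x) > 0"
  using hermitian unfolding hermitian_product_def by blast+

lemma zero_left [simp]: "h 0 z = 0"
  using add_scale_left[of 1 0 0 z] by simp

lemma zero_right [simp]: "h z 0 = 0"
  using conj_sym[of 0 z] by simp

lemma scale_left: "h (a *s x) z = a * h x z"
  using add_scale_left[of a x 0 z] by simp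

lemma scale_right: "h z (a *s x) = cnj a * h z x"
  by (metis scale_left conj_sym complex_cnj_mult)

sublocale form: bounded_bilinear h
proof -
  have "bilinear h"
    unfolding bilinear_def
  proof (intro conjI allI linearI)
    fix x y z :: "'n cvec" and r :: real
    show add: "h (x + y) z = h x z + h y z" for x y z
      using add_scale_left[of 1 x y z] by simp
    show "h z (x + y) = h z x + h z y"
      by (metis add conj_sym complex_cnj_add)
    show "h (r *\<^sub>R x) z = r *\<^sub>R h x z"
      by (simp add: scaleR_conv_scale scale_left scaleR_conv_of_real)
    show "h z (r *\<^sub>R x) = r *\<^sub>R h z x"
      by (simp add: scaleR_conv_scale scale_right scaleR_conv_of_real)
  qed
  then show "bounded_bilinear h"
    by (simp add: bilinear_conv_bounded_bilinear)
qed

lemma self_real: "h x x = complex_of_real (Re (h x x))"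
  using arg_cong[OF conj_sym[of x x], of Im] by (simp add: complex_eq_iff)

lemma self_nonneg: "0 \<le> Re (h x x)"
  using self_pos[of x] by (cases "x = 0") auto

lemma self_eq_0_iff: "h x x = 0 \<longleftrightarrow> x = 0"
  using self_pos[of x] by (cases "x = 0") auto

lemma self_Re_eq_0_iff: "Re (h x x) = 0 \<longleftrightarrow> x = 0"
  using self_pos[of x] by (cases "x = 0") auto

lemma eq_if_same_products:
  assumes "\<And>z. h x z = h y z" shows "x = y"
proof -
  have "h (x - y) (x - y) = 0" using assms by (simp add: form.diff_left)
  then show ?thesis by (simp add: self_eq_0_iff)
qed

text \<open>
  Adjointness as a relation: the adjoints that occur are all constructed explicitly, and membership
  of such a partner in a group or Lie algebra is what matters.
\<close>
definition adjoint_pair :: "'n cmat \<Rightarrow> 'n cmat \<Rightarrow> bool" where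
  "adjoint_pair A B \<longleftrightarrow> (\<forall>x y. h (A *v x) y = h x (B *v y))"

lemma adjoint_pair_sym: "adjoint_pair A B \<Longrightarrow> adjoint_pair B A"
  unfolding adjoint_pair_def by (metis conj_sym)

lemma adjoint_pair_unique: "adjoint_pair A B \<Longrightarrow> adjoint_pair A C \<Longrightarrow> B = C"
  unfolding adjoint_pair_def matrix_eq by (metis conj_sym eq_if_same_products)

lemma adjoint_pair_mult: "adjoint_pair A B \<Longrightarrow> adjoint_pair C D \<Longrightarrow> adjoint_pair (A ** C) (D ** B)"
  by (simp add: adjoint_pair_def flip: matrix_vector_mul_assoc)

lemma adjoint_pair_add: "adjoint_pair A B \<Longrightarrow> adjoint_pair C D \<Longrightarrow> adjoint_pair (A + C) (B + D)"
  by (simp add: adjoint_pair_def matrix_vector.add_left form.add_left form.add_right)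

lemma adjoint_pair_diff: "adjoint_pair A B \<Longrightarrow> adjoint_pair C D \<Longrightarrow> adjoint_pair (A - C) (B - D)"
  by (simp add: adjoint_pair_def matrix_vector.diff_left form.diff_left form.diff_right)

lemma adjoint_pair_scaleR: "adjoint_pair A B \<Longrightarrow> adjoint_pair (r *\<^sub>R A) (r *\<^sub>R B)"
  by (simp add: adjoint_pair_def matrix_vector.scaleR_left form.scaleR_left form.scaleR_right)

lemma adjoint_pair_0: "adjoint_pair 0 0"
  by (simp add: adjoint_pair_def)

lemma adjoint_pair_1: "adjoint_pair (mat 1) (mat 1)"
  by (simp add: adjoint_pair_def)

lemma adjoint_pair_sum:
  "(\<And>i. i \<in> I \<Longrightarrow> adjoint_pair (f i) (g i)) \<Longrightarrow> adjoint_pair (sum f I) (sum g I)"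
  by (induction I rule: infinite_finite_induct) (auto intro: adjoint_pair_add adjoint_pair_0)

abbreviation self_adjoint :: "'n cmat \<Rightarrow> bool" where
  "self_adjoint A \<equiv> adjoint_pair A A"

lemma adjoint_pair_limit: 
  assumes "(f \<longlongrightarrow> A) F" "(g \<longlongrightarrow> B) F" "F \<noteq> bot" "\<And>i. adjoint_pair (f i) (g i)"
  shows "adjoint_pair A B"
  unfolding adjoint_pair_def
proof (intro allI)
  fix x y
  have "((\<lambda>i. h (f i *v x) y) \<longlongrightarrow> h (A *v x) y) F"
    by (intro form.tendsto matrix_vector.tendsto assms tendsto_const)
  moreover have "((\<lambda>i. h x (g i *v y)) \<longlongrightarrow> h x (B *v y)) F"
    by (intro form.tendsto matrix_vector.tendsto assms tendsto_const)
  ultimately show "h (A *v x) y = h x (B *v y)"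
    using assms(3,4) tendsto_unique unfolding adjoint_pair_def by force
qed

lemma adjoint_pair_mat_pow: "adjoint_pair A B \<Longrightarrow> adjoint_pair (mat_pow A k) (mat_pow B k)"
proof (induction k)
  case (Suc k)
  have "mat_pow B (Suc k) = mat_pow B k ** B"
    by (induction k) (simp_all add: matrix_mul_assoc)
  with Suc show ?case by (simp add: adjoint_pair_mult del: mat_pow.simps(2)) (simp add: adjoint_pair_mult)
qed (simp add: adjoint_pair_1)

lemma adjoint_pair_mat_exp:
  assumes "adjoint_pair A B" shows "adjoint_pair (mat_exp A) (mat_exp B)"
  by (rule adjoint_pair_limit[OF mat_exp_sums[of A, unfolded sums_def] mat_exp_sums[of B, unfolded sums_def]])
    (auto intro!: adjoint_pair_sum adjoint_pair_scaleR adjoint_pair_mat_pow assms)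

text \<open>
  A maximizer of the Rayleigh quotient on an invariant subspace is an eigenvector, because the
  positive semidefinite form of \<open>r - A\<close> vanishes there.
\<close>
lemma eigenvector_exists:
  assumes A: "self_adjoint A" and U: "vec.subspace U" "U \<noteq> {0}"
    and inv: "\<And>u. u \<in> U \<Longrightarrow> A *v u \<in> U"
  shows "\<exists>v\<in>U. \<exists>r::real. h v v = 1 \<and> A *v v = r *\<^sub>R v"
proof -
  have sub: "subspace U"
    using U(1) unfolding subspace_def vec.subspace_def by (simp add: scaleR_conv_scale)
  obtain u0 where u0: "u0 \<in> U" "u0 \<noteq> 0"
    using U vec.subspace_0 by blast
  define C where "C = U \<inter> sphere 0 1"
  define q where "q = (\<lambda>v. Re (h (A *v v) v) / Re (h v v))"
  have "compact C"
    unfolding C_def using closed_subspace[OF sub] by (intro closed_Int_compact compact_sphere)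
  moreover have "u0 /\<^sub>R norm u0 \<in> C"
    using u0 sub by (simp add: C_def subspace_scale)
  then have "C \<noteq> {}" by blast
  moreover have "continuous_on C q"
    unfolding q_def
    by (intro continuous_intros form.continuous_on matrix_vector.continuous_on)
      (auto simp: C_def self_Re_eq_0_iff)
  ultimately obtain v where v: "v \<in> C" "\<And>w. w \<in> C \<Longrightarrow> q w \<le> q v"
    by (meson continuous_attains_sup)
  define r where "r = q v"
  define B where "B = (\<lambda>w. r *\<^sub>R w - A *v w)"
  have v0: "v \<noteq> 0" "v \<in> U" using v(1) by (auto simp: C_def)
  have nonneg: "0 \<le> Re (h (B w) w)" if "w \<in> U" for w
  proof (cases "w = 0")
    case False
    have "q (w /\<^sub>R norm w) \<le> r"
      unfolding r_def using False that sub by (intro v) (simp add: C_def subspace_scale)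
    moreover have "q (w /\<^sub>R norm w) = q w"
      using False by (simp add: q_def form.scaleR_left form.scaleR_right matrix_vector.scaleR_right)
    ultimately have "Re (h (A *v w) w) / Re (h w w) \<le> r" by (simp add: q_def)
    then show ?thesis
      using self_pos[OF False]
      by (simp add: B_def form.diff_left form.scaleR_left divide_le_eq)
  qed (simp add: B_def)
  have "Re (h (B v) v) = 0"
    using self_pos[OF v0(1)]
    by (simp add: r_def q_def B_def form.diff_left form.scaleR_left field_simps)
  have Bsym: "Re (h (B x) y) = Re (h (B y) x)" for x y
  proof -
    have "h (B x) y = h x (B y)"
      using A by (simp add: B_def form.diff_left form.diff_right form.scaleR_left form.scaleR_right
          adjoint_pair_def)
    also have "\<dots> = cnj (h (B y) x)" by (rule conj_sym)
    finally show ?thesis by simp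
  qed
  have "Re (h (B v) w) = 0" if w: "w \<in> U" for w
  proof -
    define b c where "b = Re (h (B v) w)" and "c = Re (h (B w) w)"
    have c0: "0 \<le> c" unfolding c_def by (rule nonneg[OF w])
    have *: "0 \<le> 2 * t * b + t * t * c" for t
    proof -
      have "v + t *\<^sub>R w \<in> U" using sub v0(2) w by (simp add: subspace_add subspace_scale)
      from nonneg[OF this] have "0 \<le> Re (h (B (v + t *\<^sub>R w)) (v + t *\<^sub>R w))" .
      also have "B (v + t *\<^sub>R w) = B v + t *\<^sub>R B w"
        by (simp add: B_def matrix_vector.add_right matrix_vector.scaleR_right algebra_simps)
      also have "Re (h (B v + t *\<^sub>R B w) (v + t *\<^sub>R w)) = 2 * t * b + t * t * c"
        using \<open>Re (h (B v) v) = 0\<close> Bsym[of w v]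
        by (simp add: form.add_left form.add_right form.scaleR_left form.scaleR_right b_def c_def
            algebra_simps)
      finally show ?thesis .
    qed
    \<comment> \<open>A nonnegative quadratic polynomial without constant term has no linear term: it would be
      negative at \<open>- b / (c + 1)\<close>.\<close>
    show ?thesis
    proof (rule ccontr)
      assume "Re (h (B v) w) \<noteq> 0"
      then have "b \<noteq> 0" by (simp add: b_def)
      have "2 * (- b / (c + 1)) * b + (- b / (c + 1)) * (- b / (c + 1)) * c
          = - (b\<^sup>2 * (c + 2)) / (c + 1)\<^sup>2"
        using c0 by (simp add: field_simps power2_eq_square add_nonneg_eq_0_iff)
      moreover have "b\<^sup>2 * (c + 2) / (c + 1)\<^sup>2 > 0"
        using c0 \<open>b \<noteq> 0\<close> by (intro divide_pos_pos mult_pos_pos) auto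
      ultimately show False using *[of "- b / (c + 1)"] by simp
    qed
  qed
  moreover have "B v \<in> U"
    unfolding B_def using sub v0(2) inv by (simp add: subspace_diff subspace_scale)
  ultimately have "Re (h (B v) (B v)) = 0" by blast
  then have eig: "A *v v = r *\<^sub>R v" by (simp add: self_Re_eq_0_iff B_def)
  define s where "s = 1 / sqrt (Re (h v v))"
  have "h (s *\<^sub>R v) (s *\<^sub>R v) = 1"
    using self_pos[OF v0(1)] self_real[of v]
    by (simp add: form.scaleR_left form.scaleR_right s_def complex_eq_iff)
  moreover have "A *v (s *\<^sub>R v) = r *\<^sub>R s *\<^sub>R v"
    by (simp add: matrix_vector.scaleR_right eig mult.commute)
  ultimately show ?thesis using sub v0(2) subspace_scale by blast
qed

text \<open>
  Induction on the dimension: the orthogonal complement of a unit eigenvector in the subspace is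
  again invariant.
\<close>
lemma eigenvector_expansion_exists:
  assumes A: "self_adjoint A" and "vec.subspace U" "\<And>u. u \<in> U \<Longrightarrow> A *v u \<in> U"
  shows "\<exists>B ev. finite B \<and> B \<subseteq> U \<and> (\<forall>b\<in>B. b \<noteq> 0 \<and> A *v b = (ev b :: real) *\<^sub>R b) \<and>
    (\<forall>x\<in>U. x = (\<Sum>b\<in>B. h x b *s b))"
  using assms(2,3)
proof (induction "vec.dim U" arbitrary: U rule: less_induct)
  case less
  show ?case
  proof (cases "U = {0}")
    case True
    then show ?thesis by (intro exI[of _ "{}"]) auto
  next
    case False
    then obtain v r where v: "v \<in> U" "h v v = 1" "A *v v = r *\<^sub>R v"
      using eigenvector_exists[OF A less.prems(1)] less.prems(2) by blast
    define U' where "U' = {u \<in> U. h u v = 0}"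
    have sub': "vec.subspace U'"
      using less.prems(1) unfolding vec.subspace_def U'_def
      by (auto simp: form.add_left scale_left)
    have inv': "A *v u \<in> U'" if "u \<in> U'" for u
      using that less.prems(2) A v(3)
      by (auto simp: U'_def adjoint_pair_def form.scaleR_right)
    have "v \<notin> U'" using v by (simp add: U'_def)
    then have "U' \<subset> U" using v(1) by (auto simp: U'_def)
    then have "vec.dim U' < vec.dim U"
      using less.prems(1) sub' by (metis vec.dim_psubset vec.span_eq_iff)
    from less.hyps[OF this sub' inv'] obtain B ev where
      B: "finite B" "B \<subseteq> U'" "\<And>b. b \<in> B \<Longrightarrow> b \<noteq> 0 \<and> A *v b = (ev b :: real) *\<^sub>R b"
        "\<And>x. x \<in> U' \<Longrightarrow> x = (\<Sum>b\<in>B. h x b *s b)" by blast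
    have "v \<notin> B" using B(2) \<open>v \<notin> U'\<close> by blast
    have "x = (\<Sum>b\<in>insert v B. h x b *s b)" if x: "x \<in> U" for x
    proof -
      let ?y = "x - h x v *s v"
      have "?y \<in> U'"
        using x v less.prems(1)
        by (simp add: U'_def vec.subspace_diff vec.subspace_scale form.diff_left scale_left)
      from B(4)[OF this] have "?y = (\<Sum>b\<in>B. h ?y b *s b)" .
      also have "\<dots> = (\<Sum>b\<in>B. h x b *s b)"
      proof (rule sum.cong)
        fix b assume "b \<in> B"
        then have "h b v = 0" using B(2) by (auto simp: U'_def)
        then have "h v b = 0" using conj_sym[of b v] by simp
        then show "h ?y b *s b = h x b *s b" by (simp add: form.diff_left scale_left)
      qed simp
      finally show ?thesis using B(1) \<open>v \<notin> B\<close> by (simp add: algebra_simps)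
    qed
    moreover have "b \<noteq> 0 \<and> A *v b = ((ev(v := r)) b) *\<^sub>R b" if "b \<in> insert v B" for b
      using that B(3) v \<open>v \<notin> B\<close> by auto
    ultimately show ?thesis
      using B(1,2) v(1) by (intro exI[of _ "insert v B"] exI[of _ "ev(v := r)"]) (auto simp: U'_def)
  qed
qed

text \<open>
  \<open>S\<close> is the spectrum and \<open>P l\<close> the orthogonal projection onto the eigenspace of \<open>l\<close>. That the \<open>P l\<close>
  are idempotent and annihilate each other is a consequence, see \<open>P_mult_P_if\<close>.
\<close>
definition spectral_resolution :: "'n cmat \<Rightarrow> real set \<Rightarrow> (real \<Rightarrow> 'n cmat) \<Rightarrow> bool" where
  "spectral_resolution A S P \<longleftrightarrow> finite S \<and> sum P S = mat 1 \<and>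
     (\<forall>l\<in>S. self_adjoint (P l) \<and> A ** P l = l *\<^sub>R P l \<and> P l \<noteq> 0)"

theorem spectral_theorem:
  assumes "self_adjoint A" shows "\<exists>S P. spectral_resolution A S P"
proof -
  obtain B ev where B: "finite B" "\<And>b. b \<in> B \<Longrightarrow> b \<noteq> 0 \<and> A *v b = (ev b :: real) *\<^sub>R b"
    "\<And>x. x = (\<Sum>b\<in>B. h x b *s b)"
    using eigenvector_expansion_exists[OF assms, of UNIV] by auto
  define p where "p = (\<lambda>l x. \<Sum>b\<in>{b\<in>B. ev b = l}. h x b *s b)"
  define P where "P = (\<lambda>l. matrix (p l))"
  have "Vector_Spaces.linear (*s) (*s) (p l)" for l
    unfolding p_def
    by unfold_locales
      (simp_all add: form.add_left scale_left sum.distrib vec.scale_sum_right algebra_simps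
        vec.scale_left_distrib)
  then have P: "P l *v x = p l x" for l x
    unfolding P_def by (rule matrix_works)
  have "p l b \<noteq> 0" if "b \<in> B" "ev b = l" for b l
  proof
    assume 0: "p l b = 0"
    have orth: "h b b' = 0" if "b' \<in> B" "ev b' \<noteq> l" for b'
    proof -
      have "ev b *\<^sub>R h b b' = ev b' *\<^sub>R h b b'"
        using assms B(2)[OF \<open>b \<in> B\<close>] B(2)[OF \<open>b' \<in> B\<close>]
        unfolding adjoint_pair_def by (metis form.scaleR_left form.scaleR_right)
      then show ?thesis using that \<open>ev b = l\<close> by simp
    qed
    have "b = (\<Sum>b'\<in>B. h b b' *s b')" by (rule B(3))
    also have "\<dots> = p l b"
      unfolding p_def by (rule sum.mono_neutral_right) (use B(1) orth in auto)
    finally show False using 0 B(2) that by simp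
  qed
  then have "P l \<noteq> 0" if "l \<in> ev ` B" for l
    using that P by (metis (no_types, lifting) imageE matrix_vector_mult_0)
  moreover have "self_adjoint (P l)" for l
    unfolding adjoint_pair_def P p_def form.sum_left form.sum_right scale_left scale_right
  proof (intro allI sum.cong refl)
    fix x y b
    show "h x b * h b y = cnj (h y b) * h x b" using conj_sym[of b y] by simp
  qed
  moreover have "A ** P l = l *\<^sub>R P l" for l
    unfolding matrix_eq P matrix_vector.scaleR_left matrix_vector_mul_assoc[symmetric] p_def
      matrix_vector.sum_right scaleR_sum_right
  proof (intro allI sum.cong refl)
    fix x b assume "b \<in> {b \<in> B. ev b = l}"
    then have "A *v b = l *\<^sub>R b" using B(2) by auto
    then show "A *v (h x b *s b) = l *\<^sub>R (h x b *s b)"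
      by (simp add: vec.scale scaleR_conv_scale mult.commute)
  qed
  moreover have "sum P (ev ` B) = mat 1"
  proof -
    have "sum P (ev ` B) *v x = x" for x
    proof -
      have "sum P (ev ` B) *v x = (\<Sum>l\<in>ev ` B. p l x)"
        by (simp add: matrix_vector.sum_left P)
      also have "\<dots> = (\<Sum>b\<in>B. h x b *s b)"
        unfolding p_def by (rule sum.image_gen[OF B(1), symmetric])
      finally show ?thesis using B(3)[of x] by simp
    qed
    then show ?thesis by (simp add: matrix_eq)
  qed
  ultimately show ?thesis
    using B(1) unfolding spectral_resolution_def by blast
qed

end



section \<open>Weight components with respect to a self-adjoint operator\<close>

lemma exp_mult_tendsto_0_at_bot: "0 < a \<Longrightarrow> ((\<lambda>t::real. exp (t * a)) \<longlongrightarrow> 0) at_bot"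
  by (rule filterlim_compose[OF exp_at_bot], subst mult.commute)
    (rule filterlim_tendsto_pos_mult_at_bot[OF tendsto_const _ filterlim_ident])

lemma exp_mult_tendsto_0_at_top: "a < 0 \<Longrightarrow> ((\<lambda>t::real. exp (t * a)) \<longlongrightarrow> 0) at_top"
  by (rule filterlim_compose[OF exp_at_bot], subst mult.commute)
    (rule filterlim_tendsto_neg_mult_at_bot[OF tendsto_const _ filterlim_ident])

locale resolved_operator = hermitian_space h
  for h :: "'n::finite cvec \<Rightarrow> 'n cvec \<Rightarrow> complex" +
  fixes A :: "'n cmat" and S :: "real set" and P :: "real \<Rightarrow> 'n cmat"
  assumes resolution: "spectral_resolution A S P"
begin

lemma finite_S: "finite S" and sum_P: "sum P S = mat 1"
  and P_self_adjoint: "l \<in> S \<Longrightarrow> self_adjoint (P l)"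
  and A_P: "l \<in> S \<Longrightarrow> A ** P l = l *\<^sub>R P l"
  and P_nonzero: "l \<in> S \<Longrightarrow> P l \<noteq> 0"
  using resolution by (auto simp: spectral_resolution_def)

lemma S_nonempty: "S \<noteq> {}"
proof
  assume "S = {}"
  then have "(0 :: 'n cmat) = mat 1" using sum_P by simp
  then have "(0 :: 'n cmat) $ i $ i = mat 1 $ i $ i" for i by simp
  then show False by (simp add: mat_def)
qed

lemma A_eq_sum: "A = (\<Sum>l\<in>S. l *\<^sub>R P l)"
proof -
  have "A = A ** sum P S" by (simp add: sum_P)
  also have "\<dots> = (\<Sum>l\<in>S. l *\<^sub>R P l)" by (simp add: matrix_mult.sum_right A_P)
  finally show ?thesis .
qed

lemma A_self_adjoint: "self_adjoint A"
  by (subst (1 2) A_eq_sum) (auto intro!: adjoint_pair_sum adjoint_pair_scaleR P_self_adjoint)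

lemma P_A: assumes "l \<in> S" shows "P l ** A = l *\<^sub>R P l"
proof -
  have "adjoint_pair (A ** P l) (P l ** A)"
    by (intro adjoint_pair_mult A_self_adjoint P_self_adjoint assms)
  moreover have "adjoint_pair (A ** P l) (l *\<^sub>R P l)"
    unfolding A_P[OF assms] by (intro adjoint_pair_scaleR P_self_adjoint assms)
  ultimately show ?thesis by (rule adjoint_pair_unique)
qed

lemma P_mult_P: assumes "l \<in> S" "m \<in> S" "l \<noteq> m" shows "P l ** P m = 0"
proof -
  have "l *\<^sub>R (P l ** P m) = m *\<^sub>R (P l ** P m)"
    using matrix_mul_assoc[of "P l" A "P m"] assms
    by (simp add: P_A A_P matrix_mult.scaleR_left matrix_mult.scaleR_right)
  then show ?thesis using assms(3) by simp
qed

lemma P_idem: assumes "l \<in> S" shows "P l ** P l = P l"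
proof -
  have "P l = P l ** sum P S" by (simp add: sum_P)
  also have "\<dots> = (\<Sum>m\<in>S. P l ** P m)" by (simp add: matrix_mult.sum_right)
  also have "\<dots> = (\<Sum>m\<in>S. if m = l then P l ** P l else 0)"
    by (intro sum.cong) (auto simp: P_mult_P assms)
  finally show ?thesis by (simp add: finite_S assms)
qed

lemma P_mult_P_if: "l \<in> S \<Longrightarrow> m \<in> S \<Longrightarrow> P l ** P m = (if l = m then P l else 0)"
  by (simp add: P_idem P_mult_P)

lemma mat_exp_P: assumes "l \<in> S" shows "mat_exp (t *\<^sub>R A) ** P l = exp (t * l) *\<^sub>R P l"
proof -
  have "(t *\<^sub>R A) *v (P l *v v) = (t * l) *\<^sub>R (P l *v v)" for v
    by (simp add: matrix_vector_mul_assoc matrix_mult.scaleR_left A_P assms matrix_vector.scaleR_left)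
  from mat_exp_eigenvector[OF this] show ?thesis
    by (simp add: matrix_eq matrix_vector.scaleR_left flip: matrix_vector_mul_assoc)
qed

lemma P_mat_exp: assumes "l \<in> S" shows "P l ** mat_exp (t *\<^sub>R A) = exp (t * l) *\<^sub>R P l"
proof -
  have "adjoint_pair (mat_exp (t *\<^sub>R A) ** P l) (P l ** mat_exp (t *\<^sub>R A))"
    by (intro adjoint_pair_mult adjoint_pair_mat_exp adjoint_pair_scaleR A_self_adjoint
        P_self_adjoint assms)
  moreover have "adjoint_pair (mat_exp (t *\<^sub>R A) ** P l) (exp (t * l) *\<^sub>R P l)"
    unfolding mat_exp_P[OF assms] by (intro adjoint_pair_scaleR P_self_adjoint assms)
  ultimately show ?thesis by (rule adjoint_pair_unique)
qed

lemma sum_P_vec: "(\<Sum>l\<in>S. P l *v v) = v"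
  by (simp add: sum_P flip: matrix_vector.sum_left)

lemma eq_by_blocks:
  assumes "\<And>l m. l \<in> S \<Longrightarrow> m \<in> S \<Longrightarrow> P l ** M ** P m = P l ** N ** P m"
  shows "M = N"
proof -
  have blocks: "X = (\<Sum>l\<in>S. \<Sum>m\<in>S. P l ** X ** P m)" for X
    by (simp add: sum_P flip: matrix_mult.sum_left matrix_mult.sum_right)
  show ?thesis by (subst (1 2) blocks) (intro sum.cong refl assms)
qed

text \<open>
  The differences of eigenvalues of \<open>A\<close> are the eigenvalues of the bracket with \<open>A\<close>, and
  \<open>component \<nu>\<close> is the projection onto the eigenspace of \<open>\<nu>\<close>.
\<close>
definition weights :: "real set" where
  "weights = (\<lambda>(l, m). l - m) ` (S \<times> S)"

definition component :: "real \<Rightarrow> 'n cmat \<Rightarrow> 'n cmat" where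
  "component \<nu> M = (\<Sum>(l, m)\<in>{(l, m)\<in>S \<times> S. l - m = \<nu>}. P l ** M ** P m)"

lemma finite_weights: "finite weights"
  by (simp add: weights_def finite_S)

lemma weightsI: "l \<in> S \<Longrightarrow> m \<in> S \<Longrightarrow> l - m \<in> weights"
  by (auto simp: weights_def)

lemma zero_weight: "0 \<in> weights"
  using S_nonempty weightsI by fastforce

lemma block_component:
  assumes "l \<in> S" "m \<in> S"
  shows "P l ** component \<nu> M ** P m = (if l - m = \<nu> then P l ** M ** P m else 0)"
proof -
  let ?I = "{(l', m')\<in>S \<times> S. l' - m' = \<nu>}"
  have fin: "finite ?I" by (rule finite_subset[of _ "S \<times> S"]) (auto simp: finite_S)
  have "P l ** component \<nu> M ** P m = (\<Sum>x\<in>?I. P l ** (case x of (l', m') \<Rightarrow> P l' ** M ** P m') ** P m)"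
    by (simp add: component_def matrix_mult.sum_left matrix_mult.sum_right)
  also have "\<dots> = (\<Sum>x\<in>?I. if x = (l, m) then P l ** M ** P m else 0)"
  proof (rule sum.cong)
    fix x assume "x \<in> ?I"
    then obtain l' m' where x: "x = (l', m')" "l' \<in> S" "m' \<in> S" by auto
    have "P l ** (P l' ** M ** P m') ** P m = (P l ** P l') ** M ** (P m' ** P m)"
      by (simp only: matrix_mul_assoc)
    then show "P l ** (case x of (l', m') \<Rightarrow> P l' ** M ** P m') ** P m =
        (if x = (l, m) then P l ** M ** P m else 0)"
      using x assms by (auto simp: P_mult_P_if)
  qed simp
  also have "\<dots> = (if l - m = \<nu> then P l ** M ** P m else 0)"
    using fin assms by (simp add: sum.delta)
  finally show ?thesis .
qed

lemma linear_component: "linear (component \<nu>)"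
  unfolding component_def
  by (rule linearI) (simp_all add: matrix_mult.add_left matrix_mult.add_right sum.distrib
      matrix_mult.scaleR_left matrix_mult.scaleR_right scaleR_sum_right split_def)

lemma sum_components: "(\<Sum>\<nu>\<in>weights. component \<nu> M) = M"
proof (rule eq_by_blocks)
  fix l m assume lm: "l \<in> S" "m \<in> S"
  have "P l ** (\<Sum>\<nu>\<in>weights. component \<nu> M) ** P m = (\<Sum>\<nu>\<in>weights. P l ** component \<nu> M ** P m)"
    by (simp add: matrix_mult.sum_left matrix_mult.sum_right)
  then show "P l ** (\<Sum>\<nu>\<in>weights. component \<nu> M) ** P m = P l ** M ** P m"
    by (simp add: block_component lm finite_weights weightsI)
qed

lemma component_component: "component \<nu> (component \<nu>' M) = (if \<nu> = \<nu>' then component \<nu> M else 0)"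
  by (rule eq_by_blocks) (auto simp: block_component)

lemma bracket_component: "lie_bracket A (component \<nu> M) = \<nu> *\<^sub>R component \<nu> M"
proof (rule eq_by_blocks)
  fix l m assume lm: "l \<in> S" "m \<in> S"
  have "P l ** lie_bracket A N ** P m = (l - m) *\<^sub>R (P l ** N ** P m)" for N
  proof -
    have "P l ** lie_bracket A N ** P m = (P l ** A) ** N ** P m - P l ** N ** (A ** P m)"
      by (simp add: lie_bracket_def matrix_mult.diff_left matrix_mult.diff_right matrix_mul_assoc)
    then show ?thesis
      by (simp add: P_A A_P lm matrix_mult.scaleR_left matrix_mult.scaleR_right algebra_simps)
  qed
  then show "P l ** lie_bracket A (component \<nu> M) ** P m = P l ** (\<nu> *\<^sub>R component \<nu> M) ** P m"
    by (simp add: block_component lm matrix_mult.scaleR_left matrix_mult.scaleR_right)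
qed

lemma adjoint_component:
  assumes "adjoint_pair M N" shows "adjoint_pair (component \<nu> M) (component (- \<nu>) N)"
proof -
  let ?I = "{(l, m)\<in>S \<times> S. l - m = \<nu>}"
  have "component (- \<nu>) N = (\<Sum>(l, m)\<in>?I. P m ** N ** P l)"
    unfolding component_def
    by (rule sum.reindex_bij_witness[of _ prod.swap prod.swap]) auto
  moreover have "adjoint_pair (component \<nu> M) (\<Sum>(l, m)\<in>?I. P m ** N ** P l)"
    unfolding component_def
  proof (rule adjoint_pair_sum)
    fix x assume "x \<in> ?I"
    then obtain l m where x: "x = (l, m)" "l \<in> S" "m \<in> S" by auto
    have "adjoint_pair (P l ** M ** P m) (P m ** (N ** P l))"
      by (intro adjoint_pair_mult P_self_adjoint assms x)
    then show "adjoint_pair (case x of (l, m) \<Rightarrow> P l ** M ** P m) (case x of (l, m) \<Rightarrow> P m ** N ** P l)"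
      by (simp add: x matrix_mul_assoc)
  qed
  ultimately show ?thesis by simp
qed

text \<open>
  Subtracting \<open>\<nu>\<^sub>0\<close> times the element from its bracket with \<open>A\<close> kills one component and rescales
  the others by nonzero factors, so the components can be extracted one after the other.
\<close>
lemma component_mem:
  assumes F: "subspace F" "\<And>Y. Y \<in> F \<Longrightarrow> lie_bracket A Y \<in> F" and M: "M \<in> F"
  shows "component \<nu> M \<in> F"
proof -
  have *: "\<forall>c. (\<Sum>\<nu>\<in>I. c \<nu> *\<^sub>R component \<nu> M) \<in> F \<longrightarrow> (\<forall>\<nu>\<in>I. c \<nu> *\<^sub>R component \<nu> M \<in> F)"
    if "finite I" for I
    using that
  proof (induction I rule: finite_induct)
    case (insert a I)
    show ?case
    proof (intro allI impI)
      fix c assume sum: "(\<Sum>\<nu>\<in>insert a I. c \<nu> *\<^sub>R component \<nu> M) \<in> F"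
      let ?X = "\<Sum>\<nu>\<in>insert a I. c \<nu> *\<^sub>R component \<nu> M"
      have "linear (lie_bracket A)"
        by (rule linearI) (simp_all add: lie_bracket_def matrix_mult.add_left matrix_mult.add_right
            matrix_mult.scaleR_left matrix_mult.scaleR_right algebra_simps)
      then have "lie_bracket A ?X = (\<Sum>\<nu>\<in>insert a I. (c \<nu> * \<nu>) *\<^sub>R component \<nu> M)"
        by (simp add: linear_sum linear_scale bracket_component)
      then have "lie_bracket A ?X - a *\<^sub>R ?X = (\<Sum>\<nu>\<in>insert a I. (c \<nu> * (\<nu> - a)) *\<^sub>R component \<nu> M)"
        by (simp only: scaleR_sum_right sum_subtractf[symmetric]) (simp add: algebra_simps)
      also have "\<dots> = (\<Sum>\<nu>\<in>I. (c \<nu> * (\<nu> - a)) *\<^sub>R component \<nu> M)"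
        using insert.hyps by simp
      finally have "(\<Sum>\<nu>\<in>I. (c \<nu> * (\<nu> - a)) *\<^sub>R component \<nu> M) = lie_bracket A ?X - a *\<^sub>R ?X"
        by (rule sym)
      also have "\<dots> \<in> F"
        by (rule subspace_diff[OF F(1) F(2)[OF sum] subspace_scale[OF F(1) sum]])
      finally have "(\<Sum>\<nu>\<in>I. (c \<nu> * (\<nu> - a)) *\<^sub>R component \<nu> M) \<in> F" .
      with insert.IH have step: "(c \<nu> * (\<nu> - a)) *\<^sub>R component \<nu> M \<in> F" if "\<nu> \<in> I" for \<nu>
        using that by (elim allE[of _ "\<lambda>\<nu>. c \<nu> * (\<nu> - a)"]) auto
      have I: "c \<nu> *\<^sub>R component \<nu> M \<in> F" if "\<nu> \<in> I" for \<nu>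
      proof -
        have "(1 / (\<nu> - a)) *\<^sub>R (c \<nu> * (\<nu> - a)) *\<^sub>R component \<nu> M \<in> F"
          using step[OF that] F(1) by (simp only: subspace_scale)
        moreover have "\<nu> - a \<noteq> 0" using that insert.hyps by auto
        ultimately show ?thesis by simp
      qed
      have "c a *\<^sub>R component a M = ?X - (\<Sum>\<nu>\<in>I. c \<nu> *\<^sub>R component \<nu> M)"
        using insert.hyps by simp
      also have "\<dots> \<in> F" by (rule subspace_diff[OF F(1) sum subspace_sum[OF F(1) I]])
      finally show "\<forall>\<nu>\<in>insert a I. c \<nu> *\<^sub>R component \<nu> M \<in> F" using I by auto
    qed
  qed simp
  show ?thesis
  proof (cases "\<nu> \<in> weights")
    case True
    have "(\<Sum>\<nu>\<in>weights. 1 *\<^sub>R component \<nu> M) \<in> F"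
      using M by (simp only: scaleR_one sum_components)
    then have "\<forall>\<nu>\<in>weights. 1 *\<^sub>R component \<nu> M \<in> F"
      by (rule *[OF finite_weights, THEN spec[where x="\<lambda>_. 1"], THEN mp])
    with True show ?thesis by simp
  next
    case False
    then have "component \<nu> M = 0"
      by - (rule eq_by_blocks, auto simp: block_component dest: weightsI)
    then show ?thesis using F(1) by (simp add: subspace_0)
  qed
qed

definition flow :: "real \<Rightarrow> 'n cmat \<Rightarrow> 'n cmat" where
  "flow t M = mat_exp (t *\<^sub>R A) ** M ** mat_exp ((- t) *\<^sub>R A)"

lemma block_flow:
  assumes "l \<in> S" "m \<in> S"
  shows "P l ** flow t M ** P m = exp (t * (l - m)) *\<^sub>R (P l ** M ** P m)"
proof -
  have "P l ** flow t M ** P m = (P l ** mat_exp (t *\<^sub>R A)) ** M ** (mat_exp ((- t) *\<^sub>R A) ** P m)"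
    by (simp only: flow_def matrix_mul_assoc)
  then show ?thesis
    by (simp only: P_mat_exp mat_exp_P assms matrix_mult.scaleR_left matrix_mult.scaleR_right)
      (simp add: right_diff_distrib exp_diff exp_minus divide_inverse mult.commute)
qed

lemma flow_eq_sum: "flow t M = (\<Sum>\<nu>\<in>weights. exp (t * \<nu>) *\<^sub>R component \<nu> M)"
proof (rule eq_by_blocks)
  fix l m assume lm: "l \<in> S" "m \<in> S"
  have "P l ** (\<Sum>\<nu>\<in>weights. exp (t * \<nu>) *\<^sub>R component \<nu> M) ** P m
      = (\<Sum>\<nu>\<in>weights. exp (t * \<nu>) *\<^sub>R (P l ** component \<nu> M ** P m))"
    by (simp add: matrix_mult.sum_left matrix_mult.sum_right matrix_mult.scaleR_left
        matrix_mult.scaleR_right)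
  also have "\<dots> = (\<Sum>\<nu>\<in>weights. if \<nu> = l - m then exp (t * (l - m)) *\<^sub>R (P l ** M ** P m) else 0)"
    by (intro sum.cong) (auto simp: block_component lm)
  finally show "P l ** flow t M ** P m = P l ** (\<Sum>\<nu>\<in>weights. exp (t * \<nu>) *\<^sub>R component \<nu> M) ** P m"
    by (simp add: block_flow lm finite_weights weightsI)
qed

lemma component_flow: "component \<nu> (flow t M) = exp (t * \<nu>) *\<^sub>R component \<nu> M"
  by (rule eq_by_blocks)
    (auto simp: block_component block_flow matrix_mult.scaleR_left matrix_mult.scaleR_right)

lemma flow_mult: "flow t (M ** N) = flow t M ** flow t N"
proof -
  have "flow t M ** flow t N =
      mat_exp (t *\<^sub>R A) ** M ** (mat_exp (- (t *\<^sub>R A)) ** mat_exp (t *\<^sub>R A)) ** N ** mat_exp ((- t) *\<^sub>R A)"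
    by (simp add: flow_def matrix_mul_assoc)
  then show ?thesis by (simp add: mat_exp_minus flow_def matrix_mul_assoc)
qed

lemma flow_mat_exp: "flow t (mat_exp X) = mat_exp (flow t X)"
  unfolding flow_def using mat_exp_minus[of "t *\<^sub>R A"] by (subst mat_exp_conj) simp_all

text \<open>
  This is the condition for \<open>flow t M\<close> to converge as \<open>t\<close> tends to minus infinity; the limit is
  then the component of weight 0.
\<close>
definition nonneg_weights :: "'n cmat \<Rightarrow> bool" where
  "nonneg_weights M \<longleftrightarrow> (\<forall>\<nu><0. component \<nu> M = 0)"

lemma tendsto_flow_at_bot:
  assumes "nonneg_weights M" shows "((\<lambda>t. flow t M) \<longlongrightarrow> component 0 M) at_bot"
proof -
  have "((\<lambda>t. exp (t * \<nu>) *\<^sub>R component \<nu> M) \<longlongrightarrow> (if \<nu> = 0 then component 0 M else 0)) at_bot" for \<nu>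
  proof (cases "\<nu> > 0")
    case True
    then have "((\<lambda>t. exp (t * \<nu>)) \<longlongrightarrow> 0) at_bot"
      by (rule exp_mult_tendsto_0_at_bot)
    then have "((\<lambda>t. exp (t * \<nu>) *\<^sub>R component \<nu> M) \<longlongrightarrow> 0 *\<^sub>R component \<nu> M) at_bot"
      by (intro tendsto_scaleR tendsto_const)
    then show ?thesis using True by simp
  qed (use assms in \<open>auto simp: nonneg_weights_def not_less order.order_iff_strict\<close>)
  then have "((\<lambda>t. flow t M) \<longlongrightarrow> (\<Sum>\<nu>\<in>weights. if \<nu> = 0 then component 0 M else 0)) at_bot"
    unfolding flow_eq_sum by (intro tendsto_sum)
  then show ?thesis by (simp add: finite_weights zero_weight)
qed

lemma tendsto_flow_at_top_0:
  assumes "\<forall>\<nu>\<ge>0. component \<nu> M = 0" shows "((\<lambda>t. flow t M) \<longlongrightarrow> 0) at_top"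
proof -
  have "((\<lambda>t. exp (t * \<nu>) *\<^sub>R component \<nu> M) \<longlongrightarrow> 0) at_top" for \<nu>
  proof (cases "\<nu> < 0")
    case True
    then have "((\<lambda>t. exp (t * \<nu>)) \<longlongrightarrow> 0) at_top"
      by (rule exp_mult_tendsto_0_at_top)
    then have "((\<lambda>t. exp (t * \<nu>) *\<^sub>R component \<nu> M) \<longlongrightarrow> 0 *\<^sub>R component \<nu> M) at_top"
      by (intro tendsto_scaleR tendsto_const)
    then show ?thesis by simp
  qed (use assms in auto)
  then have "((\<lambda>t. flow t M) \<longlongrightarrow> (\<Sum>\<nu>\<in>weights. 0)) at_top"
    unfolding flow_eq_sum by (intro tendsto_sum)
  then show ?thesis by simp
qed

lemma nonneg_weights_if_convergent:
  assumes lim: "((\<lambda>t. flow t M) \<longlongrightarrow> N) at_bot"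
  shows "nonneg_weights M"
  unfolding nonneg_weights_def
proof (intro allI impI)
  fix \<nu> :: real assume "\<nu> < 0"
  have "bounded_linear (component \<nu>)"
    using linear_component linear_conv_bounded_linear by blast
  from bounded_linear.tendsto[OF this lim]
  have 1: "((\<lambda>t. exp (t * \<nu>) *\<^sub>R component \<nu> M) \<longlongrightarrow> component \<nu> N) at_bot"
    by (simp add: component_flow)
  have "((\<lambda>t. exp (t * - \<nu>)) \<longlongrightarrow> 0) at_bot"
    using \<open>\<nu> < 0\<close> by (intro exp_mult_tendsto_0_at_bot) simp
  from tendsto_scaleR[OF this 1]
  have "((\<lambda>t :: real. component \<nu> M) \<longlongrightarrow> 0) at_bot"
    by (simp add: exp_minus)
  then show "component \<nu> M = 0" using tendsto_const_iff trivial_limit_at_bot_linorder by blast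
qed

subsection \<open>The top eigenspace\<close>

definition top_eigenvalue :: real where "top_eigenvalue = Max S"

definition top_eigenspace :: "'n cvec set" where
  "top_eigenspace = {v. A *v v = top_eigenvalue *\<^sub>R v}"

lemma top_in_S: "top_eigenvalue \<in> S" and le_top: "l \<in> S \<Longrightarrow> l \<le> top_eigenvalue"
  using finite_S S_nonempty by (auto simp: top_eigenvalue_def)

lemma P_eigenvector:
  assumes "A *v v = c *\<^sub>R v" "l \<in> S" shows "P l *v v = (if l = c then v else 0)"
proof -
  have ortho: "P m *v v = 0" if "m \<in> S" "m \<noteq> c" for m
  proof -
    have "m *\<^sub>R (P m *v v) = c *\<^sub>R (P m *v v)"
      using P_A[OF that(1)] assms(1)
      by (metis matrix_vector_mul_assoc matrix_vector.scaleR_left matrix_vector.scaleR_right)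
    then show ?thesis using that by simp
  qed
  show ?thesis
  proof (cases "l = c")
    case True
    have "v = (\<Sum>m\<in>S. if m = c then P c *v v else 0)"
      by (subst sum_P_vec[symmetric]) (auto intro!: sum.cong simp: ortho)
    then show ?thesis using True assms(2) by (simp add: finite_S split: if_splits)
  qed (simp add: ortho assms)
qed

lemma mem_top_eigenspace: "v \<in> top_eigenspace \<longleftrightarrow> P top_eigenvalue *v v = v"
proof
  assume "v \<in> top_eigenspace"
  then show "P top_eigenvalue *v v = v"
    using P_eigenvector[of v top_eigenvalue] top_in_S by (simp add: top_eigenspace_def)
next
  assume v: "P top_eigenvalue *v v = v"
  have "A *v (P top_eigenvalue *v v) = top_eigenvalue *\<^sub>R (P top_eigenvalue *v v)"
    by (simp add: matrix_vector_mul_assoc A_P top_in_S matrix_vector.scaleR_left)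
  then show "v \<in> top_eigenspace" by (simp add: v top_eigenspace_def)
qed

lemma P_top_mem: "P top_eigenvalue *v v \<in> top_eigenspace"
  by (simp add: mem_top_eigenspace matrix_vector_mul_assoc P_idem top_in_S)

lemma subspace_top_eigenspace: "vec.subspace top_eigenspace"
proof -
  have "top_eigenspace = {v. P top_eigenvalue *v v = v}"
    using mem_top_eigenspace by blast
  then show ?thesis
    by (auto simp: vec.subspace_def matrix_vector.add_right vec.scale)
qed

lemma top_eigenspace_nonzero: "\<exists>v\<in>top_eigenspace. v \<noteq> 0"
  using P_nonzero[OF top_in_S] P_top_mem by (metis matrix_eq matrix_vector_mult_0)

text \<open>
  The blocks of \<open>g\<close> that lead from the top eigenspace to a lower one have negative weight and
  vanish; the block from the top eigenspace to itself has weight 0.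
\<close>
lemma component_0_on_top:
  assumes "nonneg_weights g" "v \<in> top_eigenspace"
  shows "g *v v = component 0 g *v v" and "g *v v \<in> top_eigenspace"
proof -
  let ?m = "top_eigenvalue"
  have v: "v = P ?m *v v" using assms(2) by (simp add: mem_top_eigenspace)
  have *: "M *v v = (\<Sum>l\<in>S. (P l ** M ** P ?m) *v v)" for M
    by (subst sum_P_vec[of "M *v v", symmetric], subst (1) v)
      (simp add: matrix_vector_mul_assoc matrix_mul_assoc)
  have low: "P l ** g ** P ?m = 0" if "l \<in> S" "l \<noteq> ?m" for l
  proof -
    have "P l ** component (l - ?m) g ** P ?m = P l ** g ** P ?m"
      by (simp add: block_component that top_in_S)
    moreover have "component (l - ?m) g = 0"
      using assms(1) that le_top[OF that(1)] by (simp add: nonneg_weights_def)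
    ultimately show ?thesis by simp
  qed
  have "g *v v = (\<Sum>l\<in>S. if l = ?m then (P ?m ** g ** P ?m) *v v else 0)"
    unfolding *[of g] by (intro sum.cong) (auto simp: low)
  then have g: "g *v v = (P ?m ** g ** P ?m) *v v" by (simp add: finite_S top_in_S)
  have "component 0 g *v v = (\<Sum>l\<in>S. if l = ?m then (P ?m ** g ** P ?m) *v v else 0)"
    unfolding *[of "component 0 g"] by (intro sum.cong) (auto simp: block_component top_in_S)
  then have "component 0 g *v v = (P ?m ** g ** P ?m) *v v" by (simp add: finite_S top_in_S)
  with g show "g *v v = component 0 g *v v" by simp
  have "g *v v = P ?m *v ((g ** P ?m) *v v)"
    unfolding g by (simp add: matrix_vector_mul_assoc matrix_mul_assoc)
  then show "g *v v \<in> top_eigenspace" using P_top_mem by simp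
qed

lemma norm_expansion: "Re (h v v) = (\<Sum>l\<in>S. Re (h (P l *v v) (P l *v v)))"
  and rayleigh_expansion: "Re (h (A *v v) v) = (\<Sum>l\<in>S. l * Re (h (P l *v v) (P l *v v)))"
proof -
  have sq: "h (P l *v v) v = h (P l *v v) (P l *v v)" if "l \<in> S" for l
    using P_self_adjoint[OF that] unfolding adjoint_pair_def
    by (metis P_idem[OF that] matrix_vector_mul_assoc)
  have "h v v = (\<Sum>l\<in>S. h (P l *v v) v)"
    by (subst (1) sum_P_vec[symmetric]) (simp add: form.sum_left)
  then show "Re (h v v) = (\<Sum>l\<in>S. Re (h (P l *v v) (P l *v v)))"
    by (simp add: sq)
  have "h (A *v v) v = (\<Sum>l\<in>S. l *\<^sub>R h (P l *v v) v)"
    by (subst A_eq_sum) (simp add: matrix_vector.sum_left form.sum_left form.scaleR_left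
        matrix_vector.scaleR_left)
  then show "Re (h (A *v v) v) = (\<Sum>l\<in>S. l * Re (h (P l *v v) (P l *v v)))"
    by (simp add: sq)
qed

lemma rayleigh_le: "Re (h (A *v v) v) \<le> top_eigenvalue * Re (h v v)"
  unfolding norm_expansion[of v] rayleigh_expansion[of v] sum_distrib_left
  by (intro sum_mono mult_right_mono le_top self_nonneg)

lemma rayleigh_eq_iff: "Re (h (A *v v) v) = top_eigenvalue * Re (h v v) \<longleftrightarrow> v \<in> top_eigenspace"
proof
  assume "Re (h (A *v v) v) = top_eigenvalue * Re (h v v)"
  then have "(\<Sum>l\<in>S. (top_eigenvalue - l) * Re (h (P l *v v) (P l *v v))) = 0"
    unfolding norm_expansion[of v] rayleigh_expansion[of v] sum_distrib_left
    by (simp add: left_diff_distrib sum_subtractf)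
  then have "\<forall>l\<in>S. (top_eigenvalue - l) * Re (h (P l *v v) (P l *v v)) = 0"
    by (subst (asm) sum_nonneg_eq_0_iff) (auto simp: finite_S le_top self_nonneg)
  then have "P l *v v = 0" if "l \<in> S" "l \<noteq> top_eigenvalue" for l
    using that by (auto simp: self_Re_eq_0_iff)
  then have "v = (\<Sum>l\<in>S. if l = top_eigenvalue then P top_eigenvalue *v v else 0)"
    by (subst sum_P_vec[symmetric]) (auto intro!: sum.cong)
  then show "v \<in> top_eigenspace" by (simp add: finite_S top_in_S mem_top_eigenspace)
next
  assume "v \<in> top_eigenspace"
  then show "Re (h (A *v v) v) = top_eigenvalue * Re (h v v)"
    by (simp add: top_eigenspace_def form.scaleR_left)
qed

text \<open>
  The equations at times 0 and 1 suffice: rescaled and subtracted, they make a combination of the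
  terms \<open>(l - c) (exp (2 (l - c)) - 1)\<close> vanish, with the squared norms of the \<open>P l v\<close> as weights.
  The terms are nonnegative and vanish only for \<open>l = c\<close>.
\<close>
lemma eigenvector_if_constant_rayleigh:
  assumes c: "\<And>t. Re (h (A *v (mat_exp (t *\<^sub>R A) *v v)) (mat_exp (t *\<^sub>R A) *v v)) =
      c * Re (h (mat_exp (t *\<^sub>R A) *v v) (mat_exp (t *\<^sub>R A) *v v))"
  shows "A *v v = c *\<^sub>R v"
proof -
  define w where "w = (\<lambda>l. Re (h (P l *v v) (P l *v v)))"
  have w: "Re (h (P l *v (mat_exp (t *\<^sub>R A) *v v)) (P l *v (mat_exp (t *\<^sub>R A) *v v)))
      = exp (2 * t * l) * w l" if "l \<in> S" for t l
    by (simp add: matrix_vector_mul_assoc P_mat_exp that matrix_vector.scaleR_left form.scaleR_left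
        form.scaleR_right w_def flip: exp_add)
  have "(\<Sum>l\<in>S. (l - c) * (exp (2 * t * l) * w l)) = 0" for t
    using c[of t] unfolding norm_expansion[of "_ *v v"] rayleigh_expansion[of "_ *v v"]
    by (simp add: w left_diff_distrib sum_subtractf sum_distrib_left)
  from this[of 0] this[of 1]
  have 0: "(\<Sum>l\<in>S. (l - c) * w l) = 0" and 1: "(\<Sum>l\<in>S. (l - c) * (exp (2 * l) * w l)) = 0"
    by simp_all
  have "(\<Sum>l\<in>S. (l - c) * (exp (2 * (l - c)) - 1) * w l) =
      exp (- 2 * c) * (\<Sum>l\<in>S. (l - c) * (exp (2 * l) * w l)) - (\<Sum>l\<in>S. (l - c) * w l)"
    unfolding sum_distrib_left sum_subtractf[symmetric]
    by (intro sum.cong) (simp_all add: algebra_simps exp_diff exp_minus divide_inverse)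
  then have sum0: "(\<Sum>l\<in>S. (l - c) * (exp (2 * (l - c)) - 1) * w l) = 0"
    using 0 1 by simp
  have pos: "(l - c) * (exp (2 * (l - c)) - 1) \<ge> 0" for l
    by (cases "l \<ge> c") (auto intro: mult_nonneg_nonneg mult_nonpos_nonpos)
  have "(l - c) * (exp (2 * (l - c)) - 1) * w l \<ge> 0" for l
    unfolding w_def by (rule mult_nonneg_nonneg[OF pos self_nonneg])
  then have "\<forall>l\<in>S. (l - c) * (exp (2 * (l - c)) - 1) * w l = 0"
    using sum0 sum_nonneg_eq_0_iff[OF finite_S, of "\<lambda>l. (l - c) * (exp (2 * (l - c)) - 1) * w l"]
    by blast
  then have "l = c \<or> P l *v v = 0" if "l \<in> S" for l
    using that by (auto simp: w_def self_Re_eq_0_iff)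
  then have "l *\<^sub>R (P l *v v) = c *\<^sub>R (P l *v v)" if "l \<in> S" for l
    using that by auto
  then have "(\<Sum>l\<in>S. l *\<^sub>R (P l *v v)) = (\<Sum>l\<in>S. c *\<^sub>R (P l *v v))"
    by (rule sum.cong[OF refl])
  then show ?thesis
    by (subst A_eq_sum) (simp add: matrix_vector.sum_left matrix_vector.scaleR_left sum_P_vec
        flip: scaleR_sum_right)
qed

lemma tendsto_exp_top:
  "((\<lambda>t. exp (- t * top_eigenvalue) *\<^sub>R (mat_exp (t *\<^sub>R A) *v v)) \<longlongrightarrow> P top_eigenvalue *v v) at_top"
proof -
  let ?m = top_eigenvalue
  have "exp (- t * ?m) *\<^sub>R (mat_exp (t *\<^sub>R A) *v v) = (\<Sum>l\<in>S. exp (t * (l - ?m)) *\<^sub>R (P l *v v))" for t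
  proof -
    have "mat_exp (t *\<^sub>R A) *v v = (\<Sum>l\<in>S. (mat_exp (t *\<^sub>R A) ** P l) *v v)"
      by (subst (1) sum_P_vec[of v, symmetric])
        (simp add: matrix_vector.sum_right matrix_vector_mul_assoc)
    then show ?thesis
      by (simp add: mat_exp_P matrix_vector.scaleR_left scaleR_sum_right right_diff_distrib
          exp_diff exp_minus divide_inverse mult.commute)
  qed
  moreover have "((\<lambda>t. exp (t * (l - ?m)) *\<^sub>R (P l *v v)) \<longlongrightarrow> (if l = ?m then P ?m *v v else 0)) at_top"
    if "l \<in> S" for l
  proof (cases "l = ?m")
    case False
    then have neg: "l - ?m < 0" using le_top[OF that] by simp
    have "((\<lambda>t. exp (t * (l - ?m))) \<longlongrightarrow> 0) at_top"
      by (rule exp_mult_tendsto_0_at_top[OF neg])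
    then have "((\<lambda>t. exp (t * (l - ?m)) *\<^sub>R (P l *v v)) \<longlongrightarrow> 0 *\<^sub>R (P l *v v)) at_top"
      by (intro tendsto_scaleR tendsto_const)
    then show ?thesis using False by simp
  qed simp
  then have "((\<lambda>t. \<Sum>l\<in>S. exp (t * (l - ?m)) *\<^sub>R (P l *v v)) \<longlongrightarrow>
      (\<Sum>l\<in>S. if l = ?m then P ?m *v v else 0)) at_top"
    by (rule tendsto_sum)
  ultimately show ?thesis by (simp add: finite_S top_in_S)
qed

end



section \<open>Closed linear groups\<close>

lemma
  fixes A :: "'n::finite cmat"
  assumes "invertible A"
  shows matrix_inv_right: "A ** matrix_inv A = mat 1" and matrix_inv_left: "matrix_inv A ** A = mat 1"
  using someI_ex[OF assms[unfolded invertible_def]] unfolding matrix_inv_def by auto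

lemma matrix_inv_eqI:
  fixes A B :: "'n::finite cmat"
  assumes "A ** B = mat 1" "B ** A = mat 1" shows "matrix_inv A = B"
proof -
  have "invertible A" using assms by (auto simp: invertible_def)
  then have "matrix_inv A ** A ** B = B" by (simp add: matrix_inv_left)
  then show ?thesis by (simp add: assms(1) flip: matrix_mul_assoc)
qed

lemma matrix_inv_mat_exp: "matrix_inv (mat_exp X) = mat_exp (- X)"
  by (intro matrix_inv_eqI mat_exp_minus)

lemma mat_exp_mem: "X \<in> lie_algebra G \<Longrightarrow> mat_exp (t *\<^sub>R X) \<in> G"
  by (simp add: lie_algebra_def)

lemma mat_exp_mem_1: "X \<in> lie_algebra G \<Longrightarrow> mat_exp X \<in> G"
  using mat_exp_mem[of X G 1] by simp

lemma mat_exp_int_multiple_mem: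
  assumes G: "matrix_subgroup G" and X: "mat_exp X \<in> G"
  shows "mat_exp (of_int k *\<^sub>R X) \<in> G"
proof -
  have nat: "mat_exp (real n *\<^sub>R X) \<in> G" for n
  proof (induction n)
    case 0
    then show ?case using G by (simp add: matrix_subgroup_def)
  next
    case (Suc n)
    then show ?case
      using G X mat_exp_add_scaleR[of 1 "real n" X] by (simp add: matrix_subgroup_def)
  qed
  show ?thesis
  proof (cases "k \<ge> 0")
    case True
    then show ?thesis using nat[of "nat k"] by simp
  next
    case False
    have "matrix_inv (mat_exp (real (nat (- k)) *\<^sub>R X)) \<in> G"
      using nat G by (simp add: matrix_subgroup_def)
    then show ?thesis using False by (simp add: matrix_inv_mat_exp)
  qed
qed

text \<open>
  The multiple of \<open>Z n\<close> by the integer part of \<open>t / norm (Z n)\<close> tends to \<open>t L\<close>, and the exponentials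
  of integer multiples stay in the closed group.
\<close>
lemma limit_direction_in_lie_algebra:
  assumes G: "matrix_subgroup G" "closed G"
    and Z: "Z \<longlonglongrightarrow> 0" "\<And>n. Z n \<noteq> 0" "\<And>n. mat_exp (Z n) \<in> G"
    and lim: "(\<lambda>n. Z n /\<^sub>R norm (Z n)) \<longlonglongrightarrow> L"
  shows "L \<in> lie_algebra G"
  unfolding lie_algebra_def
proof (intro CollectI allI)
  fix t :: real
  define m where "m = (\<lambda>n. \<lfloor>t / norm (Z n)\<rfloor>)"
  have "(\<lambda>n. of_int (m n) * norm (Z n) - t) \<longlonglongrightarrow> 0"
  proof (rule Lim_null_comparison[OF always_eventually])
    show "\<forall>n. norm (of_int (m n) * norm (Z n) - t) \<le> norm (Z n)"
    proof
      fix n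
      have pos: "norm (Z n) > 0" using Z(2) by simp
      have "of_int (m n) \<le> t / norm (Z n)" "t / norm (Z n) \<le> of_int (m n) + 1"
        unfolding m_def by linarith+
      then have "of_int (m n) * norm (Z n) \<le> t" "t \<le> (of_int (m n) + 1) * norm (Z n)"
        using pos by (simp_all add: field_simps)
      then show "norm (of_int (m n) * norm (Z n) - t) \<le> norm (Z n)"
        by (simp add: algebra_simps abs_le_iff)
    qed
    show "(\<lambda>n. norm (Z n)) \<longlonglongrightarrow> 0" using Z(1) by (rule tendsto_norm_zero)
  qed
  then have "(\<lambda>n. of_int (m n) * norm (Z n)) \<longlonglongrightarrow> t"
    by (simp add: LIM_zero_iff)
  from tendsto_scaleR[OF this lim]
  moreover have "(of_int (m n) * norm (Z n)) *\<^sub>R (Z n /\<^sub>R norm (Z n)) = of_int (m n) *\<^sub>R Z n" for n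
    using Z(2)[of n] by simp
  ultimately have "(\<lambda>n. of_int (m n) *\<^sub>R Z n) \<longlonglongrightarrow> t *\<^sub>R L"
    by (simp only:)
  then have "(\<lambda>n. mat_exp (of_int (m n) *\<^sub>R Z n)) \<longlonglongrightarrow> mat_exp (t *\<^sub>R L)"
    by (rule tendsto_mat_exp)
  then show "mat_exp (t *\<^sub>R L) \<in> G"
    by (rule closed_sequentially[OF G(2) mat_exp_int_multiple_mem[OF G(1) Z(3)]])
qed

text \<open>
  Let \<open>\<cc>\<close> be the orthogonal complement of the Lie algebra among all matrices. A map of the form
  \<open>X \<mapsto> exp (pa X) exp (pb X) exp (pc X)\<close>, with \<open>X = pa X + pb X + pc X\<close> the decomposition along
  \<open>\<aa>\<close>, \<open>\<bb>\<close>, \<open>\<cc>\<close>, is continuous with the identity as derivative at 0, so the images of small balls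
  are neighbourhoods of the identity matrix. If group elements arbitrarily close to the identity
  had a nontrivial third factor, then these factors, which are in the group, would accumulate in
  a direction that belongs both to \<open>\<cc>\<close> and to the Lie algebra.
\<close>
theorem local_product_decomposition:
  fixes G :: "'n::finite cmat set"
  assumes G: "matrix_subgroup G" "closed G" and ab: "subspace \<aa>" "subspace \<bb>"
    and sum: "lie_algebra G = {X + Y |X Y. X \<in> \<aa> \<and> Y \<in> \<bb>}"
  shows "\<exists>U. open U \<and> mat 1 \<in> U \<and> (\<forall>g\<in>G \<inter> U. \<exists>X\<in>\<aa>. \<exists>Y\<in>\<bb>. g = mat_exp X ** mat_exp Y)"
proof (rule ccontr)
  assume contra: "\<not> ?thesis"
  have "subspace (lie_algebra G)"
    unfolding sum by (rule subspace_sums[OF ab])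
  then obtain B where B: "B \<subseteq> lie_algebra G" "pairwise orthogonal B" "\<And>x. x \<in> B \<Longrightarrow> norm x = 1"
    "independent B" "card B = dim (lie_algebra G)" "span B = lie_algebra G"
    by (rule orthonormal_basis_subspace) blast
  have finB: "finite B" using B(4) by (rule independent_imp_finite)
  have "\<forall>e\<in>B. \<exists>x y. x \<in> \<aa> \<and> y \<in> \<bb> \<and> e = x + y" using B(1) sum by blast
  then obtain f s where fs: "\<And>e. e \<in> B \<Longrightarrow> f e \<in> \<aa>" "\<And>e. e \<in> B \<Longrightarrow> s e \<in> \<bb>"
    "\<And>e. e \<in> B \<Longrightarrow> e = f e + s e" by metis
  define pa where "pa = (\<lambda>X. \<Sum>e\<in>B. (X \<bullet> e) *\<^sub>R f e)"
  define pb where "pb = (\<lambda>X. \<Sum>e\<in>B. (X \<bullet> e) *\<^sub>R s e)"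
  define pc where "pc = (\<lambda>X. X - (pa X + pb X))"
  have pa: "pa X \<in> \<aa>" and pb: "pb X \<in> \<bb>" for X
    unfolding pa_def pb_def using fs ab by (auto intro!: subspace_sum subspace_scale)
  have linpa: "bounded_linear pa" and linpb: "bounded_linear pb"
    unfolding pa_def pb_def
    by (intro bounded_linear_sum bounded_linear_compose[OF bounded_linear_scaleR_left]
        bounded_linear_inner_left)+
  then have linpc: "bounded_linear pc"
    unfolding pc_def by (intro bounded_linear_sub bounded_linear_add bounded_linear_ident)
  note zero = linear_0[OF bounded_linear.linear[OF linpa]] linear_0[OF bounded_linear.linear[OF linpb]]
    linear_0[OF bounded_linear.linear[OF linpc]]
  have ortho: "pc X \<bullet> e = 0" if e: "e \<in> B" for X e
  proof -
    have "(pa X + pb X) \<bullet> e = (\<Sum>e'\<in>B. (X \<bullet> e') *\<^sub>R e') \<bullet> e"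
      unfolding pa_def pb_def sum.distrib[symmetric] scaleR_add_right[symmetric]
      using fs(3) by (metis (no_types, lifting) sum.cong)
    also have "\<dots> = (\<Sum>e'\<in>B. if e' = e then X \<bullet> e else 0)"
      unfolding inner_sum_left
    proof (rule sum.cong)
      fix e' assume "e' \<in> B"
      then show "((X \<bullet> e') *\<^sub>R e') \<bullet> e = (if e' = e then X \<bullet> e else 0)"
        using B(2) B(3)[OF e] e by (auto simp: pairwise_def orthogonal_def dot_square_norm)
    qed simp
    also have "\<dots> = X \<bullet> e" using finB e by simp
    finally show ?thesis by (simp add: pc_def inner_diff_left)
  qed
  define \<Phi> where "\<Phi> = (\<lambda>X. mat_exp (pa X) ** mat_exp (pb X) ** mat_exp (pc X))"
  have der: "((\<lambda>X. mat_exp (p X)) has_derivative p) (at 0)" if "bounded_linear p" for p :: "'n cmat \<Rightarrow> 'n cmat"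
  proof -
    have "(p has_derivative p) (at 0)" by (rule bounded_linear_imp_has_derivative[OF that])
    moreover have "(mat_exp has_derivative (\<lambda>X. X)) (at (p 0))"
      using has_derivative_mat_exp_0 linear_0[OF bounded_linear.linear[OF that]] by simp
    ultimately show ?thesis by (rule has_derivative_compose)
  qed
  have "(\<Phi> has_derivative (\<lambda>X. X)) (at 0)"
    using matrix_mult.FDERIV[OF matrix_mult.FDERIV[OF der[OF linpa] der[OF linpb]] der[OF linpc]]
    unfolding \<Phi>_def[symmetric] by (simp add: zero) (simp add: pc_def algebra_simps)
  moreover have "continuous_on UNIV \<Phi>"
    unfolding \<Phi>_def
    by (intro matrix_mult.continuous_on continuous_on_compose2[OF continuous_mat_exp]
        linear_continuous_on linpa linpb linpc) auto
  ultimately have "\<Phi> 0 \<in> interior (\<Phi> ` ball 0 \<epsilon>)" if "\<epsilon> > 0" for \<epsilon>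
    using that by (intro sussmann_open_mapping[where S=UNIV and f'="\<lambda>X. X" and g'="\<lambda>X. X"])
      (auto simp: bounded_linear_ident)
  moreover have "\<Phi> 0 = mat 1" by (simp add: \<Phi>_def zero)
  ultimately have int: "mat 1 \<in> interior (\<Phi> ` ball 0 \<epsilon>)" if "\<epsilon> > 0" for \<epsilon> using that by simp
  have "\<exists>X. norm X < \<epsilon> \<and> pc X \<noteq> 0 \<and> mat_exp (pc X) \<in> G" if \<epsilon>: "\<epsilon> > 0" for \<epsilon>
  proof -
    obtain g where g: "g \<in> G" "g \<in> interior (\<Phi> ` ball 0 \<epsilon>)"
      "\<not> (\<exists>X\<in>\<aa>. \<exists>Y\<in>\<bb>. g = mat_exp X ** mat_exp Y)"
      using contra int[OF \<epsilon>] by (metis IntE open_interior)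
    then obtain X where X: "norm X < \<epsilon>" "g = \<Phi> X"
      using interior_subset by (force simp: dist_norm)
    have ne: "pc X \<noteq> 0"
    proof
      assume "pc X = 0"
      then have "g = mat_exp (pa X) ** mat_exp (pb X)" by (simp add: X \<Phi>_def)
      then show False using g(3) pa pb by blast
    qed
    have alg: "pa X \<in> lie_algebra G" "pb X \<in> lie_algebra G"
      using pa[of X] pb[of X] subspace_0[OF ab(1)] subspace_0[OF ab(2)] unfolding sum
      by force+
    have "mat_exp (- pa X) \<in> G" "mat_exp (- pb X) \<in> G"
      using mat_exp_mem[OF alg(1), of "- 1"] mat_exp_mem[OF alg(2), of "- 1"] by simp_all
    then have "mat_exp (- pb X) ** (mat_exp (- pa X) ** g) \<in> G"
      using G(1) g(1) by (simp add: matrix_subgroup_def)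
    also have "mat_exp (- pb X) ** (mat_exp (- pa X) ** g) =
        mat_exp (- pb X) ** (mat_exp (- pa X) ** mat_exp (pa X)) ** mat_exp (pb X) ** mat_exp (pc X)"
      by (simp only: X(2) \<Phi>_def matrix_mul_assoc)
    also have "\<dots> = mat_exp (pc X)" by (simp add: mat_exp_minus)
    finally show ?thesis using X(1) ne by blast
  qed
  then have "\<forall>n. \<exists>X. norm X < inverse (real (Suc n)) \<and> pc X \<noteq> 0 \<and> mat_exp (pc X) \<in> G"
    by simp
  then obtain X where X: "\<And>n. norm (X n) < inverse (real (Suc n))" "\<And>n. pc (X n) \<noteq> 0"
    "\<And>n. mat_exp (pc (X n)) \<in> G" by metis
  have "X \<longlonglongrightarrow> 0"
    by (rule Lim_null_comparison[OF _ LIMSEQ_inverse_real_of_nat])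
      (use X(1) in \<open>auto intro!: always_eventually less_imp_le simp del: of_nat_Suc\<close>)
  from bounded_linear.tendsto[OF linpc this]
  have Z0: "(\<lambda>n. pc (X n)) \<longlonglongrightarrow> 0" by (simp add: zero)
  define Y where "Y = (\<lambda>n. pc (X n) /\<^sub>R norm (pc (X n)))"
  have "\<forall>n. Y n \<in> sphere 0 1" using X(2) by (simp add: Y_def)
  then obtain L r where L: "L \<in> sphere 0 1" "strict_mono (r :: nat \<Rightarrow> nat)" "(Y \<circ> r) \<longlonglongrightarrow> L"
    using compact_sphere[of "0 :: 'n cmat" 1] unfolding compact_def by metis
  have "L \<in> lie_algebra G"
  proof (rule limit_direction_in_lie_algebra[OF G, of "\<lambda>n. pc (X (r n))"])
    show "(\<lambda>n. pc (X (r n))) \<longlonglongrightarrow> 0"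
      using LIMSEQ_subseq_LIMSEQ[OF Z0 L(2)] by (simp add: o_def)
    show "(\<lambda>n. pc (X (r n)) /\<^sub>R norm (pc (X (r n)))) \<longlonglongrightarrow> L"
      using L(3) by (simp add: o_def Y_def)
  qed (use X in auto)
  moreover have "L \<bullet> e = 0" if "e \<in> B" for e
  proof -
    have "(\<lambda>n. (Y \<circ> r) n \<bullet> e) \<longlonglongrightarrow> L \<bullet> e" by (intro tendsto_inner L tendsto_const)
    then show ?thesis by (simp add: Y_def ortho[OF that] LIMSEQ_const_iff)
  qed
  ultimately have "orthogonal L L"
    using orthogonal_to_span[of L B L] B(6) by (simp add: orthogonal_def)
  then show False using L(1) by (auto simp: orthogonal_def)
qed

section \<open>Compatible groups\<close>

locale compatible_group = hermitian_space h
  for h :: "'n::finite cvec \<Rightarrow> 'n cvec \<Rightarrow> complex" +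
  fixes G K \<pp> :: "'n cmat set"
  assumes G_lie: "lie_subgroup_SL G" and G_connected: "connected G"
    and K_maximal: "maximal_compact_subgroup G K"
    and cartan: "cartan_decomposition (lie_algebra G) (lie_algebra K) \<pp>"
    and compat: "compatible h G K \<pp>"
begin

lemma G_group: "matrix_subgroup G" and G_closed: "closed G"
  using G_lie by (auto simp: lie_subgroup_SL_def)

lemma K_group: "matrix_subgroup K" and K_compact: "compact K" and K_subset: "K \<subseteq> G"
  using K_maximal by (auto simp: maximal_compact_subgroup_def)

lemma G_mult: "g \<in> G \<Longrightarrow> g' \<in> G \<Longrightarrow> g ** g' \<in> G" and G_inv: "g \<in> G \<Longrightarrow> matrix_inv g \<in> G"
  and G_1: "mat 1 \<in> G" and G_invertible: "g \<in> G \<Longrightarrow> invertible g"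
  using G_group by (auto simp: matrix_subgroup_def)

lemma K_mult: "k \<in> K \<Longrightarrow> k' \<in> K \<Longrightarrow> k ** k' \<in> K" and K_inv: "k \<in> K \<Longrightarrow> matrix_inv k \<in> K"
  and K_1: "mat 1 \<in> K" and K_invertible: "k \<in> K \<Longrightarrow> invertible k"
  using K_group by (auto simp: matrix_subgroup_def)

lemma K_isometry: "k \<in> K \<Longrightarrow> h (k *v x) (k *v y) = h x y"
  using compat by (auto simp: compatible_def SU_def)

lemma K_adjoint: assumes "k \<in> K" shows "adjoint_pair k (matrix_inv k)"
  unfolding adjoint_pair_def
proof (intro allI)
  fix x y
  have "h (k *v x) y = h (k *v x) (k *v (matrix_inv k *v y))"
    using K_invertible[OF assms] by (simp add: matrix_vector_mul_assoc matrix_inv_right)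
  then show "h (k *v x) y = h x (matrix_inv k *v y)" by (simp add: K_isometry assms)
qed

lemma p_self_adjoint: assumes "X \<in> \<pp>" shows "self_adjoint X"
proof -
  obtain Y where Y: "X = mat \<i> ** Y" "Y \<in> su h"
    using assms compat by (auto simp: compatible_def)
  have "mat \<i> *v v = \<i> *s v" for v :: "'n cvec"
    by (simp add: vec_eq_iff matrix_vector_mult_def mat_def if_distrib[where f="\<lambda>c. c * a" for a]
        cong: if_cong)
  then show ?thesis
    using Y(2) by (simp add: Y(1) adjoint_pair_def su_def scale_left scale_right
        flip: matrix_vector_mul_assoc)
qed

text \<open>Differentiate the invariance of \<open>h\<close> under \<open>exp (t X)\<close> at 0.\<close>
lemma lie_K_skew: assumes "X \<in> lie_algebra K" shows "adjoint_pair X (- X)"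
  unfolding adjoint_pair_def
proof (intro allI)
  fix x y
  let ?e = "\<lambda>t::real. mat_exp (t *\<^sub>R X)"
  have d: "((\<lambda>t. ?e t *v v) has_vector_derivative X *v v) (at 0)" for v
    using bounded_linear.has_vector_derivative[OF matrix_vector.bounded_linear_left
        has_vector_derivative_mat_exp] .
  have "((\<lambda>t. h (?e t *v x) (?e t *v y)) has_vector_derivative
      h (?e 0 *v x) (X *v y) + h (X *v x) (?e 0 *v y)) (at 0)"
    by (rule form.has_vector_derivative[OF d d])
  moreover have "(\<lambda>t. h (?e t *v x) (?e t *v y)) = (\<lambda>t. h x y)"
    using K_isometry[OF mat_exp_mem[OF assms]] by auto
  ultimately have "h x (X *v y) + h (X *v x) y = 0"
    using vector_derivative_unique_at[OF _ has_vector_derivative_const] by fastforce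
  then show "h (X *v x) y = h x (- X *v y)"
    by (simp add: matrix_vector.minus_left form.minus_right add_eq_0_iff)
qed

lemma subspace_k: "subspace (lie_algebra K)" and subspace_p: "subspace \<pp>"
  and lie_G: "lie_algebra G = {X + Y |X Y. X \<in> lie_algebra K \<and> Y \<in> \<pp>}"
  and kp: "X \<in> lie_algebra K \<Longrightarrow> Y \<in> \<pp> \<Longrightarrow> lie_bracket X Y \<in> \<pp>"
  and pp: "X \<in> \<pp> \<Longrightarrow> Y \<in> \<pp> \<Longrightarrow> lie_bracket X Y \<in> lie_algebra K"
  using cartan by (auto simp: cartan_decomposition_def)

lemma subspace_lie_G: "subspace (lie_algebra G)"
  unfolding lie_G by (rule subspace_sums[OF subspace_k subspace_p])

lemma k_subset: "lie_algebra K \<subseteq> lie_algebra G" and p_subset: "\<pp> \<subseteq> lie_algebra G"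
  unfolding lie_G using subspace_0[OF subspace_k] subspace_0[OF subspace_p] by force+

lemma bracket_p_mem: assumes "A \<in> \<pp>" "Y \<in> lie_algebra G" shows "lie_bracket A Y \<in> lie_algebra G"
proof -
  obtain X Z where Y: "Y = X + Z" "X \<in> lie_algebra K" "Z \<in> \<pp>" using assms(2) by (auto simp: lie_G)
  have "lie_bracket A Y = lie_bracket A Z - lie_bracket X A"
    by (simp add: Y(1) lie_bracket_def matrix_mult.add_left matrix_mult.add_right)
  then show ?thesis
    using pp[OF assms(1) Y(3)] kp[OF Y(2) assms(1)] k_subset p_subset subspace_lie_G
    by (simp add: subspace_diff subset_iff)
qed

lemma lie_G_adjoint: assumes "X \<in> lie_algebra G" obtains X' where "X' \<in> lie_algebra G" "adjoint_pair X X'"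
proof -
  obtain Y Z where X: "X = Y + Z" "Y \<in> lie_algebra K" "Z \<in> \<pp>" using assms by (auto simp: lie_G)
  show ?thesis
  proof (rule that)
    show "- Y + Z \<in> lie_algebra G"
      using X k_subset p_subset subspace_lie_G by (meson subsetD subspace_add subspace_neg)
    show "adjoint_pair X (- Y + Z)"
      unfolding X by (intro adjoint_pair_add lie_K_skew p_self_adjoint X)
  qed
qed

text \<open>
  The Cartan decomposition of \<open>lie_algebra G\<close> is the decomposition into skew and self-adjoint
  parts, by uniqueness of the latter.
\<close>
lemma skew_in_k: assumes "X \<in> lie_algebra G" "adjoint_pair X (- X)" shows "X \<in> lie_algebra K"
proof -
  obtain Y Z where X: "X = Y + Z" "Y \<in> lie_algebra K" "Z \<in> \<pp>" using assms by (auto simp: lie_G)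
  have "adjoint_pair X (- Y + Z)"
    unfolding X by (intro adjoint_pair_add lie_K_skew p_self_adjoint X)
  with assms(2) have "- X = - Y + Z" by (rule adjoint_pair_unique)
  then have "2 *\<^sub>R Z = 0" by (simp add: X(1) scaleR_2)
  then show ?thesis using X by simp
qed

lemma self_adjoint_in_p: assumes "X \<in> lie_algebra G" "self_adjoint X" shows "X \<in> \<pp>"
proof -
  obtain Y Z where X: "X = Y + Z" "Y \<in> lie_algebra K" "Z \<in> \<pp>" using assms by (auto simp: lie_G)
  have "adjoint_pair X (- Y + Z)"
    unfolding X by (intro adjoint_pair_add lie_K_skew p_self_adjoint X)
  with assms(2) have "X = - Y + Z" by (rule adjoint_pair_unique)
  then have "2 *\<^sub>R Y = 0" by (simp add: X(1) scaleR_2)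
  then show ?thesis using X by simp
qed

lemma Ad_K_p: assumes "k \<in> K" "X \<in> \<pp>" shows "k ** X ** matrix_inv k \<in> \<pp>"
proof (rule self_adjoint_in_p)
  have inv: "k ** matrix_inv k = mat 1" "matrix_inv k ** k = mat 1"
    using K_invertible[OF assms(1)] by (simp_all add: matrix_inv_left matrix_inv_right)
  have "mat_exp (t *\<^sub>R (k ** X ** matrix_inv k)) = k ** mat_exp (t *\<^sub>R X) ** matrix_inv k" for t
    using mat_exp_conj[OF inv, of "t *\<^sub>R X"] by (simp add: matrix_mult.scaleR_left matrix_mult.scaleR_right)
  moreover have "k ** mat_exp (t *\<^sub>R X) ** matrix_inv k \<in> G" for t
    using assms K_subset K_inv p_subset by (intro G_mult mat_exp_mem) auto
  ultimately show "k ** X ** matrix_inv k \<in> lie_algebra G" by (simp add: lie_algebra_def)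
  have "adjoint_pair (k ** X ** matrix_inv k) (k ** (X ** matrix_inv k))"
    by (intro adjoint_pair_mult K_adjoint adjoint_pair_sym[OF K_adjoint] p_self_adjoint assms)
  then show "self_adjoint (k ** X ** matrix_inv k)" by (simp add: matrix_mul_assoc)
qed

text \<open>The adjoint of \<open>k exp X\<close> is \<open>exp X\<close> times the inverse of \<open>k\<close>.\<close>
lemma G_adjoint: assumes "g \<in> G" obtains g' where "g' \<in> G" "adjoint_pair g g'"
proof -
  obtain k X where g: "g = k ** mat_exp X" "k \<in> K" "X \<in> \<pp>"
    using assms compat by (auto simp: compatible_def)
  have "mat_exp X ** matrix_inv k \<in> G"
    using g K_inv K_subset p_subset by (intro G_mult mat_exp_mem_1) auto
  moreover have "adjoint_pair g (mat_exp X ** matrix_inv k)"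
    unfolding g by (intro adjoint_pair_mult K_adjoint adjoint_pair_mat_exp p_self_adjoint g)
  ultimately show ?thesis using that by blast
qed

end

locale compatible_group_element = compatible_group h G K \<pp> + resolved_operator h A S P
  for h :: "'n::finite cvec \<Rightarrow> 'n cvec \<Rightarrow> complex" and G K \<pp> A S P +
  assumes A_mem: "A \<in> \<pp>"
begin

lemma exp_A_mem: "mat_exp (t *\<^sub>R A) \<in> G"
  using A_mem p_subset mat_exp_mem by blast

lemma component_lie: "X \<in> lie_algebra G \<Longrightarrow> component \<nu> X \<in> lie_algebra G"
  by (rule component_mem[OF subspace_lie_G bracket_p_mem[OF A_mem]])

lemma flow_mem: "g \<in> G \<Longrightarrow> flow t g \<in> G"
  unfolding flow_def by (intro G_mult exp_A_mem)

lemma component_0_mem: assumes "g \<in> G" "nonneg_weights g" shows "component 0 g \<in> G"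
proof (rule Lim_in_closed_set[OF G_closed])
  show "\<forall>\<^sub>F t in at_bot. flow t g \<in> G" by (simp add: flow_mem assms)
qed (auto intro: tendsto_flow_at_bot assms)

lemma parabolic_iff: "g \<in> parabolic G A \<longleftrightarrow> g \<in> G \<and> nonneg_weights g"
proof
  assume "g \<in> parabolic G A"
  then show "g \<in> G \<and> nonneg_weights g"
    unfolding parabolic_def flow_def[symmetric] using nonneg_weights_if_convergent by blast
next
  assume "g \<in> G \<and> nonneg_weights g"
  then show "g \<in> parabolic G A"
    unfolding parabolic_def flow_def[symmetric] using component_0_mem tendsto_flow_at_bot by blast
qed

lemma parabolic_mult:
  assumes "g \<in> parabolic G A" "g' \<in> parabolic G A" shows "g ** g' \<in> parabolic G A"
proof -
  have "((\<lambda>t. flow t (g ** g')) \<longlongrightarrow> component 0 g ** component 0 g') at_bot"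
    unfolding flow_mult using assms
    by (intro matrix_mult.tendsto tendsto_flow_at_bot) (auto simp: parabolic_iff)
  then show ?thesis
    using assms nonneg_weights_if_convergent by (auto simp: parabolic_iff intro: G_mult)
qed

definition lie_parabolic :: "'n cmat set" where
  "lie_parabolic = {X \<in> lie_algebra G. nonneg_weights X}"

definition lie_opposite_nilradical :: "'n cmat set" where
  "lie_opposite_nilradical = {X \<in> lie_algebra G. \<forall>\<nu>\<ge>0. component \<nu> X = 0}"

lemma component_linear: "component \<nu> 0 = 0" "component \<nu> (X + Y) = component \<nu> X + component \<nu> Y"
  "component \<nu> (X - Y) = component \<nu> X - component \<nu> Y"
  "component \<nu> (r *\<^sub>R X) = r *\<^sub>R component \<nu> X"
  "component \<nu> (sum f I) = (\<Sum>i\<in>I. component \<nu> (f i))"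
  using linear_component[of \<nu>] by (simp_all add: linear_0 linear_add linear_diff linear_scale linear_sum)

lemma subspace_lie_parabolic: "subspace lie_parabolic"
  using subspace_lie_G unfolding subspace_def lie_parabolic_def nonneg_weights_def
  by (simp add: component_linear)

lemma subspace_lie_opposite_nilradical: "subspace lie_opposite_nilradical"
  using subspace_lie_G unfolding subspace_def lie_opposite_nilradical_def
  by (simp add: component_linear)

lemma split_lie_G:
  assumes "X \<in> lie_algebra G"
  obtains X1 X2 where "X = X1 + X2" "X1 \<in> lie_opposite_nilradical" "X2 \<in> lie_parabolic"
proof -
  let ?N = "{\<nu>\<in>weights. \<nu> < 0}" and ?Q = "{\<nu>\<in>weights. \<not> \<nu> < 0}"
  let ?X1 = "\<Sum>\<nu>\<in>?N. component \<nu> X" and ?X2 = "\<Sum>\<nu>\<in>?Q. component \<nu> X"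
  have "X = ?X1 + ?X2"
    by (subst (1) sum_components[of X, symmetric])
      (subst sum.union_disjoint[symmetric], auto simp: finite_weights intro!: sum.cong)
  moreover have "?X1 \<in> lie_opposite_nilradical"
    unfolding lie_opposite_nilradical_def using assms
    by (auto simp: component_linear component_component intro!: subspace_sum subspace_lie_G
        component_lie sum.neutral)
  moreover have "?X2 \<in> lie_parabolic"
    unfolding lie_parabolic_def nonneg_weights_def using assms
    by (auto simp: component_linear component_component intro!: subspace_sum subspace_lie_G
        component_lie sum.neutral)
  ultimately show ?thesis by (rule that)
qed

lemma lie_G_opposite_parabolic:
  "lie_algebra G = {X + Y |X Y. X \<in> lie_opposite_nilradical \<and> Y \<in> lie_parabolic}"
proof
  show "lie_algebra G \<subseteq> {X + Y |X Y. X \<in> lie_opposite_nilradical \<and> Y \<in> lie_parabolic}"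
    using split_lie_G by blast
  show "{X + Y |X Y. X \<in> lie_opposite_nilradical \<and> Y \<in> lie_parabolic} \<subseteq> lie_algebra G"
    using subspace_lie_G
    by (auto simp: lie_opposite_nilradical_def lie_parabolic_def subspace_add)
qed

text \<open>
  The Levi component is required to be self-adjoint because skew elements of the Levi algebra
  already lie in the Lie algebra of \<open>K\<close>.
\<close>
definition lie_parabolic_self_adjoint :: "'n cmat set" where
  "lie_parabolic_self_adjoint = {X \<in> lie_parabolic. self_adjoint (component 0 X)}"

lemma subspace_lie_parabolic_self_adjoint: "subspace lie_parabolic_self_adjoint"
  using subspace_lie_parabolic unfolding subspace_def lie_parabolic_self_adjoint_def
  by (simp add: component_linear adjoint_pair_0 adjoint_pair_add adjoint_pair_scaleR)

text \<open>
  An element of the opposite nilradical differs from a skew element by its adjoint, which is in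
  the parabolic algebra; likewise the Levi component is the sum of its skew and self-adjoint
  halves.
\<close>
lemma lie_G_iwasawa:
  "lie_algebra G = {X + Y |X Y. X \<in> lie_algebra K \<and> Y \<in> lie_parabolic_self_adjoint}"
proof
  show "{X + Y |X Y. X \<in> lie_algebra K \<and> Y \<in> lie_parabolic_self_adjoint} \<subseteq> lie_algebra G"
    using subspace_lie_G k_subset
    by (auto simp: lie_parabolic_self_adjoint_def lie_parabolic_def intro!: subspace_add)
  show "lie_algebra G \<subseteq> {X + Y |X Y. X \<in> lie_algebra K \<and> Y \<in> lie_parabolic_self_adjoint}"
  proof
    fix X assume "X \<in> lie_algebra G"
    then obtain X1 X2 where X: "X = X1 + X2" "X1 \<in> lie_opposite_nilradical" "X2 \<in> lie_parabolic"
      by (rule split_lie_G)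
    have X1: "X1 \<in> lie_algebra G" "\<And>\<nu>. \<nu> \<ge> 0 \<Longrightarrow> component \<nu> X1 = 0"
      using X(2) by (auto simp: lie_opposite_nilradical_def)
    have X2: "X2 \<in> lie_algebra G" "\<And>\<nu>. \<nu> < 0 \<Longrightarrow> component \<nu> X2 = 0"
      using X(3) by (auto simp: lie_parabolic_def nonneg_weights_def)
    obtain Y where Y: "Y \<in> lie_algebra G" "adjoint_pair X1 Y" using lie_G_adjoint[OF X1(1)] .
    have compY: "component \<nu> Y = 0" if "\<nu> \<le> 0" for \<nu>
    proof -
      have "adjoint_pair 0 (component \<nu> Y)"
        using adjoint_component[OF Y(2), of "- \<nu>"] X1(2)[of "- \<nu>"] that by simp
      then show ?thesis using adjoint_pair_unique[OF adjoint_pair_0] by metis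
    qed
    define L where "L = component 0 X2"
    have L: "L \<in> lie_algebra G" unfolding L_def by (rule component_lie[OF X2(1)])
    obtain M where M: "M \<in> lie_algebra G" "adjoint_pair L M" using lie_G_adjoint[OF L] .
    have compL: "component \<nu> L = (if \<nu> = 0 then L else 0)" for \<nu>
      by (simp add: L_def component_component)
    have compM: "component \<nu> M = (if \<nu> = 0 then M else 0)" for \<nu>
    proof (cases "\<nu> = 0")
      case True
      have "adjoint_pair L (component 0 M)"
        using adjoint_component[OF M(2), of 0] by (simp add: compL)
      from adjoint_pair_unique[OF this M(2)] show ?thesis using True by simp
    next
      case False
      then have "adjoint_pair 0 (component \<nu> M)"
        using adjoint_component[OF M(2), of "- \<nu>"] by (simp add: compL)
      from adjoint_pair_unique[OF adjoint_pair_0 this] show ?thesis using False by simp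
    qed
    \<comment> \<open>\<open>U\<close> is the skew half of the Levi component \<open>L\<close>.\<close>
    define U where "U = (1/2) *\<^sub>R (L - M)"
    have U: "adjoint_pair U (- U)"
      using adjoint_pair_scaleR[OF adjoint_pair_diff[OF M(2) adjoint_pair_sym[OF M(2)]], of "1/2"]
      by (simp add: U_def algebra_simps)
    let ?k = "(X1 - Y) + U" and ?s = "X2 + Y - U"
    have "adjoint_pair (X1 - Y) (- (X1 - Y))"
      using adjoint_pair_diff[OF Y(2) adjoint_pair_sym[OF Y(2)]] by simp
    from adjoint_pair_add[OF this U] have "adjoint_pair ?k (- ?k)" by (simp add: algebra_simps)
    moreover have UG: "U \<in> lie_algebra G"
      unfolding U_def by (intro subspace_scale subspace_diff subspace_lie_G L M)
    then have "?k \<in> lie_algebra G"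
      by (intro subspace_add subspace_diff subspace_lie_G X1 Y)
    ultimately have k: "?k \<in> lie_algebra K" using skew_in_k by blast
    have "L - U = (1/2) *\<^sub>R (L + L) - (1/2) *\<^sub>R (L - M)"
      by (simp only: scaleR_half_double U_def)
    also have "\<dots> = (1/2) *\<^sub>R (L + M)"
      by (simp only: scaleR_diff_right[symmetric]) simp
    finally have "L - U = (1/2) *\<^sub>R (L + M)" .
    moreover have "component 0 ?s = L - U"
      by (simp add: component_linear compY compL compM U_def flip: L_def)
    ultimately have "component 0 ?s = (1/2) *\<^sub>R (L + M)" by simp
    moreover have "self_adjoint ((1/2) *\<^sub>R (L + M))"
      using adjoint_pair_scaleR[OF adjoint_pair_add[OF M(2) adjoint_pair_sym[OF M(2)]], of "1/2"]
      by (simp add: add.commute)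
    moreover have "?s \<in> lie_algebra G"
      by (intro subspace_add subspace_diff subspace_lie_G X2 Y UG)
    moreover have "nonneg_weights ?s"
      by (simp add: nonneg_weights_def component_linear compY compL compM U_def X2)
    ultimately have "?s \<in> lie_parabolic_self_adjoint"
      by (simp add: lie_parabolic_self_adjoint_def lie_parabolic_def)
    moreover have "X = ?k + ?s" by (simp add: X(1))
    ultimately show "X \<in> {X + Y |X Y. X \<in> lie_algebra K \<and> Y \<in> lie_parabolic_self_adjoint}"
      using k by blast
  qed
qed

text \<open>
  The flow commutes with the exponential, so its limit on \<open>exp X\<close> is the exponential of the Levi
  component of \<open>X\<close>.
\<close>
lemma exp_lie_parabolic:
  assumes "X \<in> lie_parabolic"
  shows "mat_exp X \<in> parabolic G A"
    and "v \<in> top_eigenspace \<Longrightarrow> mat_exp X *v v = mat_exp (component 0 X) *v v"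
proof -
  have X: "X \<in> lie_algebra G" "nonneg_weights X" using assms by (auto simp: lie_parabolic_def)
  have lim: "((\<lambda>t. flow t (mat_exp X)) \<longlongrightarrow> mat_exp (component 0 X)) at_bot"
    unfolding flow_mat_exp by (intro tendsto_mat_exp tendsto_flow_at_bot X)
  then have nn: "nonneg_weights (mat_exp X)" by (rule nonneg_weights_if_convergent)
  then show "mat_exp X \<in> parabolic G A" using X by (simp add: parabolic_iff mat_exp_mem_1)
  have "component 0 (mat_exp X) = mat_exp (component 0 X)"
    using tendsto_flow_at_bot[OF nn] lim tendsto_unique trivial_limit_at_bot_linorder by blast
  then show "v \<in> top_eigenspace \<Longrightarrow> mat_exp X *v v = mat_exp (component 0 X) *v v"
    using component_0_on_top(1)[OF nn] by simp
qed

end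



section \<open>Lines and orbits in projective space\<close>

lemma mem_line: "w \<in> line v \<longleftrightarrow> (\<exists>c. w = c *s v)"
  by (auto simp: vec.span_singleton)

lemma line_scale: "c \<noteq> 0 \<Longrightarrow> line (c *s v) = line v"
  by (rule vec.span_eq[THEN iffD2])
    (auto simp: mem_line intro: exI[of _ "inverse c"])

lemma line_scaleR: "r \<noteq> 0 \<Longrightarrow> line (r *\<^sub>R v) = line v"
  by (simp add: scaleR_conv_scale line_scale)

lemma line_eqD: assumes "line v = line w" "v \<noteq> 0" obtains c where "c \<noteq> 0" "v = c *s w"
proof -
  have "v \<in> line w" using assms(1) vec.span_base[of v "{v}"] by simp
  then obtain c where "v = c *s w" by (auto simp: mem_line)
  then show ?thesis using that assms(2) by auto
qed

lemma line_mult_cong: "line v = line w \<Longrightarrow> line (g *v v) = line (g *v w)"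
  for g :: "'n::finite cmat"
  unfolding act_line[symmetric] by simp

lemma line_mem_proj_UNIV: "v \<noteq> 0 \<Longrightarrow> line v \<in> proj UNIV"
  by (auto simp: proj_def)

lemma line_mem_proj_iff:
  assumes "vec.subspace W" "v \<noteq> 0" shows "line v \<in> proj W \<longleftrightarrow> v \<in> W"
proof
  assume "line v \<in> proj W"
  then obtain w where w: "line v = line w" "w \<in> W" by (auto simp: proj_def)
  obtain c where "v = c *s w" using line_eqD[OF w(1) assms(2)] .
  then show "v \<in> W" using vec.subspace_scale[OF assms(1) w(2)] by simp
qed (use assms in \<open>auto simp: proj_def\<close>)

lemma mem_subspace_line_cong:
  assumes "vec.subspace W" "line v = line w" "w \<in> W" shows "v \<in> W"
  using assms vec.span_base[of v "{v}"] vec.span_minimal[of "{w}" W] by auto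

lemma mult_eq_0_invertible: "invertible g \<Longrightarrow> g *v v = 0 \<longleftrightarrow> v = 0" for g :: "'n::finite cmat"
  by (metis matrix_inv_left matrix_vector_mul_assoc matrix_vector_mul_lid matrix_vector_mult_0_right)

lemma closedin_proj_limit:
  assumes C: "closedin proj_topology C" and lim: "(f \<longlongrightarrow> v) F" "F \<noteq> bot" "v \<noteq> 0"
    and mem: "\<forall>\<^sub>F x in F. line (f x) \<in> C"
  shows "line v \<in> C"
proof (rule ccontr)
  assume "line v \<notin> C"
  let ?O = "{w. w \<noteq> 0 \<and> line w \<in> proj UNIV - C}"
  have "open ?O"
    using C by (simp add: closedin_def openin_proj_topology topspace_proj_topology)
  moreover have "v \<in> ?O" using \<open>line v \<notin> C\<close> lim(3) line_mem_proj_UNIV by blast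
  ultimately have "\<forall>\<^sub>F x in F. f x \<in> ?O" using lim(1) topological_tendstoD by fastforce
  with mem have "\<forall>\<^sub>F x in F. False" by eventually_elim auto
  then show False using lim(2) by simp
qed

text \<open>The cone of all vectors on lines of \<open>C\<close> is closed once the origin is added.\<close>
lemma closedin_projI:
  assumes sub: "C \<subseteq> proj UNIV"
    and lim: "\<And>f v. f \<longlonglongrightarrow> v \<Longrightarrow> (\<And>n. f n \<noteq> 0 \<and> line (f n) \<in> C) \<Longrightarrow> v \<noteq> 0 \<Longrightarrow> line v \<in> C"
  shows "closedin proj_topology C"
proof -
  let ?O = "{w. w \<noteq> 0 \<and> line w \<in> proj UNIV - C}"
  have "closed (- ?O)"
    unfolding closed_sequential_limits
  proof (intro allI impI, elim conjE)
    fix f v assume f: "\<forall>n. f n \<in> - ?O" "f \<longlonglongrightarrow> v"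
    show "v \<in> - ?O"
    proof (cases "v = 0")
      case False
      from tendsto_imp_eventually_ne[OF f(2) False]
      obtain N where N: "\<And>n. n \<ge> N \<Longrightarrow> f n \<noteq> 0" by (auto simp: eventually_sequentially)
      have "line v \<in> C"
      proof (rule lim)
        show "(\<lambda>n. f (n + N)) \<longlonglongrightarrow> v" using f(2) by (rule LIMSEQ_ignore_initial_segment)
        show "f (n + N) \<noteq> 0 \<and> line (f (n + N)) \<in> C" for n
          using f(1) N[of "n + N"] line_mem_proj_UNIV[of "f (n + N)"] by auto
      qed fact
      then show ?thesis by simp
    qed simp
  qed
  then have "open ?O" by (simp add: open_closed)
  then show ?thesis
    using sub by (auto simp: closedin_def openin_proj_topology topspace_proj_topology)
qed

text \<open>
  Equality of lines is preserved in limits because, for \<open>b\<close> nonzero, \<open>a\<close> is on the line of \<open>b\<close> iff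
  \<open>h b b a = h a b b\<close>, which is a closed condition.
\<close>
lemma (in hermitian_space) line_limit:
  fixes f g :: "'b \<Rightarrow> 'n cvec"
  assumes lim: "(f \<longlongrightarrow> a) F" "(g \<longlongrightarrow> b) F" "F \<noteq> bot" and ne: "a \<noteq> 0" "b \<noteq> 0"
    and eq: "\<And>x. line (f x) = line (g x)"
  shows "line a = line b"
proof -
  have id: "h (g x) (g x) *s f x = h (f x) (g x) *s g x" for x
  proof -
    have "f x \<in> line (g x)" using eq[of x] vec.span_base[of "f x" "{f x}"] by simp
    then obtain c where "f x = c *s g x" by (auto simp: mem_line)
    then show ?thesis by (simp add: scale_left mult.commute)
  qed
  have scale: "((\<lambda>x. u x *s p x) \<longlongrightarrow> c *s q) F" if "(u \<longlongrightarrow> c) F" "(p \<longlongrightarrow> q) F"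
    for u :: "_ \<Rightarrow> complex" and c and p :: "_ \<Rightarrow> 'n cvec" and q
    using that by (intro vec_tendstoI) (auto intro!: tendsto_mult tendsto_vec_nth)
  have "((\<lambda>x. h (g x) (g x) *s f x) \<longlongrightarrow> h b b *s a) F"
    by (intro scale form.tendsto lim)
  moreover have "((\<lambda>x. h (f x) (g x) *s g x) \<longlongrightarrow> h a b *s b) F"
    by (intro scale form.tendsto lim)
  ultimately have eq: "h b b *s a = h a b *s b"
    using lim(3) tendsto_unique unfolding id by blast
  have "h b b \<noteq> 0" using ne(2) by (simp add: self_eq_0_iff)
  then have "h a b \<noteq> 0" using eq ne by (metis vector_mul_eq_0)
  with eq \<open>h b b \<noteq> 0\<close> show ?thesis by (metis line_scale)
qed

section \<open>The gradient map on a closed orbit\<close>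

locale gradient_orbit = compatible_group h G K \<pp>
  for h :: "'n::finite cvec \<Rightarrow> 'n cvec \<Rightarrow> complex" and G K \<pp> +
  fixes ip :: "'n cmat \<Rightarrow> 'n cmat \<Rightarrow> real" and \<mu> :: "'n cvec set \<Rightarrow> 'n cmat"
    and Orb :: "'n cvec set set"
  assumes irreducible: "irreducible_subrep G UNIV"
    and scalar_product: "Ad_invariant_scalar_product K \<pp> ip"
    and gradient: "gradient_map h \<pp> ip \<mu>"
    and Orb_orbit: "\<exists>L\<in>proj UNIV. Orb = orbit G L"
    and Orb_closed: "closedin proj_topology Orb"
begin

lemma G_mult_eq_0: "g \<in> G \<Longrightarrow> g *v v = 0 \<longleftrightarrow> v = 0"
  by (rule mult_eq_0_invertible[OF G_invertible])

lemma ip_lin: "X \<in> \<pp> \<Longrightarrow> Y \<in> \<pp> \<Longrightarrow> Z \<in> \<pp> \<Longrightarrow> ip (a *\<^sub>R X + Y) Z = a * ip X Z + ip Y Z"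
  and ip_sym: "X \<in> \<pp> \<Longrightarrow> Y \<in> \<pp> \<Longrightarrow> ip X Y = ip Y X"
  and ip_pos: "X \<in> \<pp> \<Longrightarrow> X \<noteq> 0 \<Longrightarrow> ip X X > 0"
  and ip_Ad: "k \<in> K \<Longrightarrow> X \<in> \<pp> \<Longrightarrow> Y \<in> \<pp> \<Longrightarrow>
    ip (k ** X ** matrix_inv k) (k ** Y ** matrix_inv k) = ip X Y"
  using scalar_product unfolding Ad_invariant_scalar_product_def by blast+

text \<open>
  The form \<open>ip\<close> is expressed through the ambient Euclidean inner product by an isomorphism of
  \<open>\<pp>\<close>; continuity and duality statements then come from the Euclidean space of all matrices.
\<close>
lemma ip_representation:
  obtains R where "linear R"
    "\<And>X Y. X \<in> \<pp> \<Longrightarrow> Y \<in> \<pp> \<Longrightarrow> ip X Y = X \<bullet> R Y"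
    "\<And>a. \<exists>\<gamma>\<in>\<pp>. \<forall>X\<in>\<pp>. ip X \<gamma> = X \<bullet> a"
proof -
  obtain B where B: "B \<subseteq> \<pp>" "pairwise orthogonal B" "\<And>x. x \<in> B \<Longrightarrow> norm x = 1"
    "independent B" "card B = dim \<pp>" "span B = \<pp>"
    using orthonormal_basis_subspace[OF subspace_p] by blast
  have finB: "finite B" using B(4) by (rule independent_imp_finite)
  define pr where "pr = (\<lambda>X. \<Sum>e\<in>B. (X \<bullet> e) *\<^sub>R e)"
  have pr_mem: "pr X \<in> \<pp>" for X
    unfolding pr_def using B(1) by (intro subspace_sum subspace_scale subspace_p) auto
  have pr_id: "pr X = X" if "X \<in> \<pp>" for X
    unfolding pr_def using that B by (intro orthonormal_basis_expand) (auto simp: finB)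
  have pr_lin: "linear pr"
    unfolding pr_def by (rule linearI)
      (simp_all add: inner_add_left scaleR_add_left sum.distrib scaleR_sum_right)
  have ip_0: "ip 0 Z = 0" if "Z \<in> \<pp>" for Z
    using ip_lin[of 0 0 Z 1] subspace_0[OF subspace_p] that by simp
  have ip_sum: "ip (\<Sum>e\<in>I. c e *\<^sub>R e) Z = (\<Sum>e\<in>I. c e * ip e Z)" if "I \<subseteq> B" "Z \<in> \<pp>" for I c Z
    using finite_subset[OF that(1) finB] that(1)
  proof (induction I rule: finite_induct)
    case (insert e I)
    have "(\<Sum>e\<in>I. c e *\<^sub>R e) \<in> \<pp>"
      using insert.prems B(1) by (intro subspace_sum subspace_scale subspace_p) auto
    then show ?case using insert that(2) B(1) by (simp add: ip_lin subset_iff)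
  qed (simp add: ip_0 that)
  define R where "R = (\<lambda>Y. \<Sum>e\<in>B. ip e (pr Y) *\<^sub>R e)"
  have R: "ip X Y = X \<bullet> R Y" if "X \<in> \<pp>" "Y \<in> \<pp>" for X Y
  proof -
    have "ip X Y = ip (pr X) Y" by (simp add: pr_id that)
    also have "\<dots> = (\<Sum>e\<in>B. (X \<bullet> e) * ip e Y)"
      unfolding pr_def using that by (intro ip_sum) auto
    also have "\<dots> = X \<bullet> R Y"
      using that by (simp add: R_def pr_id inner_sum_right mult.commute)
    finally show ?thesis .
  qed
  have ip_add_right: "ip e (Y + Z) = ip e Y + ip e Z" and ip_scale_right: "ip e (r *\<^sub>R Y) = r * ip e Y"
    if "e \<in> \<pp>" "Y \<in> \<pp>" "Z \<in> \<pp>" for e Y Z r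
    using ip_lin[of Y Z e 1] ip_lin[of Y 0 e r] ip_0[of e] ip_sym that subspace_p
    by (simp_all add: subspace_add subspace_scale subspace_0)
  have R_lin: "linear R"
  proof (rule linearI)
    fix X Y r
    show "R (X + Y) = R X + R Y"
      unfolding R_def linear_add[OF pr_lin] sum.distrib[symmetric] scaleR_add_left[symmetric]
      using B(1) pr_mem by (intro sum.cong refl arg_cong2[of _ _ _ _ scaleR] ip_add_right) auto
    show "R (r *\<^sub>R X) = r *\<^sub>R R X"
      unfolding R_def linear_scale[OF pr_lin] scaleR_sum_right scaleR_scaleR
      using B(1) pr_mem by (intro sum.cong refl arg_cong2[of _ _ _ _ scaleR] ip_scale_right) auto
  qed
  have R_mem: "R Y \<in> \<pp>" for Y
    unfolding R_def using B(1) by (intro subspace_sum subspace_scale subspace_p) auto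
  have inj: "inj_on R \<pp>"
  proof (rule inj_onI)
    fix X Y assume XY: "X \<in> \<pp>" "Y \<in> \<pp>" "R X = R Y"
    then have d: "X - Y \<in> \<pp>" by (simp add: subspace_diff subspace_p)
    have "ip (X - Y) (X - Y) = 0"
      unfolding R[OF d d] using XY(3) by (simp add: linear_diff[OF R_lin])
    then show "X = Y" using ip_pos[OF d] by fastforce
  qed
  have "\<exists>\<gamma>\<in>\<pp>. \<forall>X\<in>\<pp>. ip X \<gamma> = X \<bullet> a" for a
  proof -
    have "dim (R ` \<pp>) = dim \<pp>"
      using dim_image_eq[OF R_lin, of \<pp>] inj span_eq_iff[THEN iffD2, OF subspace_p] by simp
    then have "R ` \<pp> = \<pp>"
      using R_mem by (intro subspace_dim_equal linear_subspace_image R_lin subspace_p) auto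
    then obtain \<gamma> where \<gamma>: "\<gamma> \<in> \<pp>" "R \<gamma> = pr a" using pr_mem by (metis imageE)
    have "ip X \<gamma> = X \<bullet> a" if "X \<in> \<pp>" for X
    proof -
      have "ip X \<gamma> = X \<bullet> pr a" by (simp add: R that \<gamma>)
      also have "\<dots> = pr X \<bullet> a"
        by (simp add: pr_def inner_sum_left inner_sum_right inner_commute mult.commute)
      finally show ?thesis by (simp add: pr_id that)
    qed
    then show ?thesis using \<gamma>(1) by blast
  qed
  then show ?thesis using that[OF R_lin] R by blast
qed

lemma ip_square_diff:
  assumes "X \<in> \<pp>" "Y \<in> \<pp>" shows "ip (X - Y) (X - Y) = ip X X - 2 * ip X Y + ip Y Y"
proof -
  obtain R where R: "linear R" "\<And>X Y. X \<in> \<pp> \<Longrightarrow> Y \<in> \<pp> \<Longrightarrow> ip X Y = X \<bullet> R Y"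
    using ip_representation by metis
  have "X - Y \<in> \<pp>" using assms by (simp add: subspace_diff subspace_p)
  then show ?thesis
    using assms ip_sym[OF assms]
    by (simp add: R(2) linear_diff[OF R(1)] inner_diff_left inner_diff_right)
qed

lemma ip_nonneg: "X \<in> \<pp> \<Longrightarrow> 0 \<le> ip X X" and ip_eq_0: "X \<in> \<pp> \<Longrightarrow> ip X X \<le> 0 \<Longrightarrow> X = 0"
proof -
  show "0 \<le> ip X X" if "X \<in> \<pp>"
  proof (cases "X = 0")
    case True
    then show ?thesis using ip_lin[of 0 0 0 1] that by simp
  qed (use ip_pos that in force)
  show "X = 0" if "X \<in> \<pp>" "ip X X \<le> 0" using ip_pos that by fastforce
qed

lemma mu_mem: "v \<noteq> 0 \<Longrightarrow> \<mu> (line v) \<in> \<pp>"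
  using gradient by (simp add: gradient_map_def)

lemma ip_mu:
  assumes "v \<noteq> 0" "\<gamma> \<in> \<pp>"
  shows "ip (\<mu> (line v)) \<gamma> = Re (h (\<gamma> *v v) v) / Re (h v v)"
proof -
  have "complex_of_real (ip (\<mu> (line v)) \<gamma>) = h (\<gamma> *v v) v / complex_of_real (Re (h v v))"
    using gradient assms self_real[of v] by (metis gradient_map_def)
  from arg_cong[OF this, of Re] show ?thesis by (simp add: Re_divide_of_real)
qed

lemma continuous_mu: "continuous_on (- {0}) (\<lambda>v. \<mu> (line v))"
proof -
  have "\<exists>\<gamma>\<in>\<pp>. \<forall>X\<in>\<pp>. ip X \<gamma> = X \<bullet> a" for a
    using ip_representation by metis
  then obtain \<gamma> where \<gamma>: "\<And>e. \<gamma> e \<in> \<pp>" "\<And>e X. X \<in> \<pp> \<Longrightarrow> ip X (\<gamma> e) = X \<bullet> e" by metis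
  have "\<mu> (line v) = (\<Sum>e\<in>Basis. (Re (h (\<gamma> e *v v) v) / Re (h v v)) *\<^sub>R e)" if "v \<noteq> 0" for v
  proof -
    have "\<mu> (line v) = (\<Sum>e\<in>Basis. (\<mu> (line v) \<bullet> e) *\<^sub>R e)" by (rule euclidean_representation[symmetric])
    then show ?thesis using that by (simp add: ip_mu \<gamma> mu_mem flip: \<gamma>(2))
  qed
  moreover have "continuous_on (- {0}) (\<lambda>v. \<Sum>e\<in>Basis. (Re (h (\<gamma> e *v v) v) / Re (h v v)) *\<^sub>R e)"
    by (intro continuous_intros form.continuous_on matrix_vector.continuous_on)
      (auto simp: self_Re_eq_0_iff)
  ultimately show ?thesis by (metis (no_types, lifting) ComplD continuous_on_cong singletonI)
qed

lemma Orb_line: assumes "L \<in> Orb" obtains v where "v \<noteq> 0" "L = line v"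
proof -
  obtain v g where "v \<noteq> 0" "L = act g (line v)" "g \<in> G"
    using Orb_orbit assms by (auto simp: orbit_def proj_def)
  then show ?thesis using that[of "g *v v"] by (simp add: act_line mult_eq_0_invertible G_invertible)
qed

lemma Orb_transitive: assumes "line v \<in> Orb" "line w \<in> Orb" shows "\<exists>g\<in>G. line w = line (g *v v)"
proof -
  obtain u a b where u: "a \<in> G" "b \<in> G" "line v = line (a *v u)" "line w = line (b *v u)"
    using Orb_orbit assms by (auto simp: orbit_def proj_def act_line)
  have "line (b ** matrix_inv a *v v) = line (b ** matrix_inv a *v (a *v u))"
    by (rule line_mult_cong[OF u(3)])
  also have "b ** matrix_inv a *v (a *v u) = b *v ((matrix_inv a ** a) *v u)"
    by (simp add: matrix_vector_mul_assoc matrix_mul_assoc)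
  finally have "line w = line (b ** matrix_inv a *v v)"
    using u G_invertible by (simp add: matrix_inv_left)
  then show ?thesis using u G_mult G_inv by blast
qed

lemma Orb_invariant: assumes "line v \<in> Orb" "g \<in> G" shows "line (g *v v) \<in> Orb"
proof -
  obtain u a where u: "a \<in> G" "Orb = orbit G (line u)" "line v = line (a *v u)"
    using Orb_orbit assms by (auto simp: orbit_def proj_def act_line)
  have "line (g *v v) = act (g ** a) (line u)"
    using line_mult_cong[OF u(3), of g] by (simp add: act_line matrix_vector_mul_assoc)
  then show ?thesis using u assms(2) G_mult by (auto simp: orbit_def)
qed

lemma Orb_nonempty: "\<exists>v. v \<noteq> 0 \<and> line v \<in> Orb"
proof -
  obtain v where "v \<noteq> 0" "Orb = orbit G (line v)" using Orb_orbit by (auto simp: proj_def)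
  then show ?thesis using G_1 by (auto simp: orbit_def act_line intro!: exI[of _ v] exI[of _ "mat 1"])
qed

text \<open>The span is invariant under the irreducible group.\<close>
lemma Orb_spans: "vec.span {v. v \<noteq> 0 \<and> line v \<in> Orb} = UNIV"
proof -
  let ?S = "{v. v \<noteq> 0 \<and> line v \<in> Orb}"
  have "g *v u \<in> vec.span ?S" if "g \<in> G" "u \<in> vec.span ?S" for g u
    using that(2)
  proof (induction u rule: vec.span_induct_alt)
    case (step c x y)
    have "g *v x \<in> vec.span ?S"
      using step(1) that(1) Orb_invariant by (intro vec.span_base) (auto simp: G_mult_eq_0)
    then show ?case using step(2) by (simp add: vec.add vec.scale vec.span_add vec.span_scale)
  qed (simp add: vec.span_zero)
  then have "vec.span ?S = {0} \<or> vec.span ?S = UNIV"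
    using irreducible by (auto simp: irreducible_subrep_def)
  moreover obtain v where "v \<in> ?S" using Orb_nonempty by blast
  then have "v \<in> vec.span ?S" "v \<noteq> 0" by (auto intro: vec.span_base)
  ultimately show ?thesis by blast
qed

definition unit_vectors :: "'n cvec set" where
  "unit_vectors = {v. norm v = 1 \<and> line v \<in> Orb}"

lemma compact_unit_vectors: "compact unit_vectors"
proof -
  have "closed unit_vectors"
    unfolding closed_sequential_limits
  proof (intro allI impI, elim conjE)
    fix f v assume f: "\<forall>n. f n \<in> unit_vectors" "f \<longlonglongrightarrow> v"
    have "(\<lambda>n. norm (f n)) \<longlonglongrightarrow> norm v" by (rule tendsto_norm[OF f(2)])
    then have "norm v = 1" using f(1) by (simp add: unit_vectors_def LIMSEQ_const_iff)
    moreover have "line v \<in> Orb"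
      using f \<open>norm v = 1\<close> by (intro closedin_proj_limit[OF Orb_closed f(2)]) (auto simp: unit_vectors_def)
    ultimately show "v \<in> unit_vectors" by (simp add: unit_vectors_def)
  qed
  moreover have "bounded unit_vectors" by (rule boundedI[of _ 1]) (simp add: unit_vectors_def)
  ultimately show ?thesis by (simp add: compact_eq_bounded_closed)
qed

lemma Orb_eq_unit_vectors: "Orb = line ` unit_vectors"
proof
  show "Orb \<subseteq> line ` unit_vectors"
  proof
    fix L assume L: "L \<in> Orb"
    then obtain v where v: "v \<noteq> 0" "L = line v" by (rule Orb_line)
    have "L = line (v /\<^sub>R norm v)" using v by (simp add: line_scaleR)
    then show "L \<in> line ` unit_vectors" using v L by (auto simp: unit_vectors_def)
  qed
qed (auto simp: unit_vectors_def)

lemma unit_vectors_nonzero: "unit_vectors \<subseteq> - {0}"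
  by (auto simp: unit_vectors_def)

lemma mu_Orb_compact: "compact (\<mu> ` Orb)"
proof -
  have "compact ((\<lambda>v. \<mu> (line v)) ` unit_vectors)"
    by (intro compact_continuous_image compact_unit_vectors
        continuous_on_subset[OF continuous_mu unit_vectors_nonzero])
  moreover have "\<mu> ` Orb = (\<lambda>v. \<mu> (line v)) ` unit_vectors"
    using arg_cong[OF Orb_eq_unit_vectors, of "image \<mu>"] by (simp only: image_image)
  ultimately show ?thesis by simp
qed

lemma mu_Orb_subset: "\<mu> ` Orb \<subseteq> \<pp>"
proof (rule image_subsetI)
  fix L assume "L \<in> Orb"
  then obtain v where "v \<noteq> 0" "L = line v" by (rule Orb_line)
  then show "\<mu> L \<in> \<pp>" by (simp add: mu_mem)
qed

end

locale gradient_orbit_element =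
  gradient_orbit h G K \<pp> ip \<mu> Orb + compatible_group_element h G K \<pp> A S P
  for h :: "'n::finite cvec \<Rightarrow> 'n cvec \<Rightarrow> complex" and G K \<pp> ip \<mu> Orb A S P
begin

text \<open>As \<open>t\<close> grows, \<open>exp (t A)\<close> moves \<open>[v]\<close> to its component in the top eigenspace.\<close>
lemma line_P_top_mem:
  assumes "line v \<in> Orb" "P top_eigenvalue *v v \<noteq> 0"
  shows "line (P top_eigenvalue *v v) \<in> Orb"
proof (rule closedin_proj_limit[OF Orb_closed tendsto_exp_top _ assms(2)])
  show "\<forall>\<^sub>F t in at_top. line (exp (- t * top_eigenvalue) *\<^sub>R (mat_exp (t *\<^sub>R A) *v v)) \<in> Orb"
    using Orb_invariant[OF assms(1) exp_A_mem] by (simp add: line_scaleR)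
qed simp

lemma Orb_meets_top_eigenspace: "\<exists>v. v \<noteq> 0 \<and> line v \<in> Orb \<and> v \<in> top_eigenspace"
proof (rule ccontr)
  assume contra: "\<not> ?thesis"
  have "P top_eigenvalue *v v = 0" if "v \<noteq> 0" "line v \<in> Orb" for v
    using line_P_top_mem[OF that(2)] P_top_mem contra by blast
  then have "P top_eigenvalue *v v = 0" if "v \<in> vec.span {v. v \<noteq> 0 \<and> line v \<in> Orb}" for v
    using vec.eq_0_on_span[OF _ that, of "P top_eigenvalue"] by blast
  then have "P top_eigenvalue = 0" by (simp add: Orb_spans matrix_eq)
  then show False using P_nonzero[OF top_in_S] by simp
qed

lemma ip_mu_le_top: "v \<noteq> 0 \<Longrightarrow> ip (\<mu> (line v)) A \<le> top_eigenvalue"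
  using rayleigh_le[of v] self_pos[of v] by (simp add: ip_mu A_mem divide_le_eq)

lemma ip_mu_eq_top_iff: "v \<noteq> 0 \<Longrightarrow> ip (\<mu> (line v)) A = top_eigenvalue \<longleftrightarrow> v \<in> top_eigenspace"
  using rayleigh_eq_iff[of v] self_pos[of v] by (simp add: ip_mu A_mem divide_eq_eq)

end

context gradient_orbit
begin

lemma resolve_element:
  assumes "\<gamma> \<in> \<pp>"
  obtains S P where "gradient_orbit_element h G K \<pp> ip \<mu> Orb \<gamma> S P"
proof -
  obtain S P where "spectral_resolution \<gamma> S P" using spectral_theorem p_self_adjoint assms by blast
  then have "gradient_orbit_element h G K \<pp> ip \<mu> Orb \<gamma> S P"
    using assms by unfold_locales
  then show ?thesis by (rule that)
qed

text \<open>
  A point outside the compact convex set would be separated from it by some \<open>\<gamma>\<close> in \<open>\<pp>\<close>; but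
  the orbit reaches the top eigenvalue of \<open>\<gamma>\<close>, which bounds the gradient map everywhere.
\<close>
lemma mu_in_convex_hull:
  assumes "v \<noteq> 0" shows "\<mu> (line v) \<in> convex hull (\<mu> ` Orb)"
proof (rule ccontr)
  assume "\<mu> (line v) \<notin> convex hull (\<mu> ` Orb)"
  moreover have "closed (convex hull (\<mu> ` Orb))"
    by (intro compact_imp_closed compact_convex_hull mu_Orb_compact)
  ultimately obtain a b where ab: "a \<bullet> \<mu> (line v) < b" "\<forall>x\<in>convex hull (\<mu> ` Orb). b < a \<bullet> x"
    using separating_hyperplane_closed_point convex_convex_hull by metis
  obtain \<gamma> where \<gamma>: "\<gamma> \<in> \<pp>" "\<forall>X\<in>\<pp>. ip X \<gamma> = X \<bullet> (- a)"
    using ip_representation by metis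
  obtain S P where "gradient_orbit_element h G K \<pp> ip \<mu> Orb \<gamma> S P"
    using resolve_element[OF \<gamma>(1)] .
  then interpret E: gradient_orbit_element h G K \<pp> ip \<mu> Orb \<gamma> S P .
  obtain w where w: "w \<noteq> 0" "line w \<in> Orb" "w \<in> E.top_eigenspace"
    using E.Orb_meets_top_eigenspace by blast
  have "b < a \<bullet> \<mu> (line w)" using ab(2) w(2) by (simp add: hull_inc)
  moreover have "ip (\<mu> (line v)) \<gamma> \<le> ip (\<mu> (line w)) \<gamma>"
    using E.ip_mu_le_top[OF assms] E.ip_mu_eq_top_iff[OF w(1)] w(3) by simp
  then have "a \<bullet> \<mu> (line w) \<le> a \<bullet> \<mu> (line v)"
    using \<gamma>(2) mu_mem assms w(1) by (simp add: inner_commute)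
  ultimately show False using ab(1) by simp
qed

lemma obtain_norm_maximizer:
  obtains v where "v \<noteq> 0" "line v \<in> Orb"
    "\<And>w. w \<noteq> 0 \<Longrightarrow> line w \<in> Orb \<Longrightarrow> ip (\<mu> (line w)) (\<mu> (line w)) \<le> ip (\<mu> (line v)) (\<mu> (line v))"
proof -
  obtain R where R: "linear R" "\<And>X Y. X \<in> \<pp> \<Longrightarrow> Y \<in> \<pp> \<Longrightarrow> ip X Y = X \<bullet> R Y"
    using ip_representation by metis
  have "continuous_on (\<mu> ` Orb) (\<lambda>X. X \<bullet> R X)"
    by (intro continuous_on_inner continuous_on_id linear_continuous_on
        linear_conv_bounded_linear[THEN iffD1] R)
  then obtain X where X: "X \<in> \<mu> ` Orb" "\<And>Y. Y \<in> \<mu> ` Orb \<Longrightarrow> Y \<bullet> R Y \<le> X \<bullet> R X"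
    using continuous_attains_sup[OF mu_Orb_compact] Orb_nonempty by blast
  then obtain v where v: "v \<noteq> 0" "line v \<in> Orb" "X = \<mu> (line v)" using Orb_line by blast
  show ?thesis
  proof (rule that[OF v(1,2)])
    fix w assume "w \<noteq> 0" "line w \<in> Orb"
    then show "ip (\<mu> (line w)) (\<mu> (line w)) \<le> ip (\<mu> (line v)) (\<mu> (line v))"
      using X(2)[of "\<mu> (line w)"] v by (simp add: R(2) mu_mem)
  qed
qed

text \<open>
  Let \<open>\<alpha>\<close> be the value of \<open>\<mu>\<close> at \<open>[v]\<close>. By maximality of its norm and the Cauchy-Schwarz inequality,
  \<open>\<langle>\<mu>[w], \<alpha>\<rangle>\<close> is at most \<open>\<langle>\<alpha>, \<alpha>\<rangle>\<close> on the orbit, with equality only if \<open>\<mu>[w] = \<alpha>\<close>. As the orbit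
  meets the top eigenspace of \<open>\<alpha>\<close>, the bound is the top eigenvalue; so \<open>v\<close> is in the top eigenspace
  and \<open>\<mu>\<close> is constantly \<open>\<alpha>\<close> on the part of the orbit in that eigenspace. If \<open>Y\<close> is in the parabolic
  algebra of \<open>\<alpha>\<close> with self-adjoint Levi component \<open>Z\<close>, then \<open>exp (t Y) v = exp (t Z) v\<close> stays
  in this part, the Rayleigh quotient of \<open>Z\<close> along this curve is constant, and \<open>v\<close> must be an
  eigenvector of \<open>Z\<close>.
  Together with \<open>lie_G_iwasawa\<close> this shows that group elements near the identity move \<open>[v]\<close> inside
  its \<open>K\<close>-orbit, and \<open>G\<close> is connected.
\<close>
lemma K_orbit_of_maximizer:
  assumes v: "v \<noteq> 0" "line v \<in> Orb"
    and max: "\<And>w. w \<noteq> 0 \<Longrightarrow> line w \<in> Orb \<Longrightarrow> ip (\<mu> (line w)) (\<mu> (line w)) \<le> ip (\<mu> (line v)) (\<mu> (line v))"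
    and g: "g \<in> G"
  shows "\<exists>k\<in>K. line (g *v v) = line (k *v v)"
proof -
  define \<alpha> where "\<alpha> = \<mu> (line v)"
  have \<alpha>: "\<alpha> \<in> \<pp>" unfolding \<alpha>_def by (rule mu_mem[OF v(1)])
  obtain S P where "gradient_orbit_element h G K \<pp> ip \<mu> Orb \<alpha> S P"
    using resolve_element[OF \<alpha>] .
  then interpret E: gradient_orbit_element h G K \<pp> ip \<mu> Orb \<alpha> S P .
  \<comment> \<open>The Cauchy-Schwarz inequality together with its defect.\<close>
  have le: "2 * ip (\<mu> (line w)) \<alpha> + ip (\<mu> (line w) - \<alpha>) (\<mu> (line w) - \<alpha>) \<le> 2 * ip \<alpha> \<alpha>"
    if "w \<noteq> 0" "line w \<in> Orb" for w
    using max[OF that] ip_square_diff[OF mu_mem[OF that(1)] \<alpha>] by (simp add: \<alpha>_def)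
  obtain u where u: "u \<noteq> 0" "line u \<in> Orb" "u \<in> E.top_eigenspace"
    using E.Orb_meets_top_eigenspace by blast
  have "ip (\<mu> (line u)) \<alpha> = E.top_eigenvalue" using E.ip_mu_eq_top_iff u by blast
  moreover have "ip (\<mu> (line u)) \<alpha> \<le> ip \<alpha> \<alpha>"
    using le[OF u(1,2)] ip_nonneg[of "\<mu> (line u) - \<alpha>"] mu_mem[OF u(1)] \<alpha>
    by (simp add: subspace_diff subspace_p)
  moreover have "ip \<alpha> \<alpha> \<le> E.top_eigenvalue"
    using E.ip_mu_le_top[OF v(1)] by (simp add: \<alpha>_def)
  ultimately have top: "ip \<alpha> \<alpha> = E.top_eigenvalue" by simp
  then have v_top: "v \<in> E.top_eigenspace"
    using E.ip_mu_eq_top_iff[OF v(1)] by (simp add: \<alpha>_def)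
  have mu_const: "\<mu> (line w) = \<alpha>" if "w \<noteq> 0" "line w \<in> Orb" "w \<in> E.top_eigenspace" for w
  proof -
    have "ip (\<mu> (line w)) \<alpha> = ip \<alpha> \<alpha>" using E.ip_mu_eq_top_iff that top by simp
    then have "ip (\<mu> (line w) - \<alpha>) (\<mu> (line w) - \<alpha>) \<le> 0" using le[OF that(1,2)] by simp
    moreover have "\<mu> (line w) - \<alpha> \<in> \<pp>" using mu_mem[OF that(1)] \<alpha> by (simp add: subspace_diff subspace_p)
    ultimately show ?thesis using ip_eq_0 by fastforce
  qed
  have fix_line: "line (mat_exp Y *v v) = line v" if Y: "Y \<in> E.lie_parabolic_self_adjoint" for Y
  proof -
    define Z where "Z = E.component 0 Y"
    have Yp: "Y \<in> E.lie_parabolic" using Y by (simp add: E.lie_parabolic_self_adjoint_def)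
    have "self_adjoint Z" using Y by (simp add: E.lie_parabolic_self_adjoint_def Z_def)
    moreover have "Z \<in> lie_algebra G"
      using Yp E.component_lie by (simp add: Z_def E.lie_parabolic_def)
    ultimately have Zp: "Z \<in> \<pp>" using self_adjoint_in_p by blast
    have tY: "t *\<^sub>R Y \<in> E.lie_parabolic" for t
      using Yp E.subspace_lie_parabolic by (rule subspace_scale[rotated])
    have eq: "mat_exp (t *\<^sub>R Y) *v v = mat_exp (t *\<^sub>R Z) *v v" for t
      using E.exp_lie_parabolic(2)[OF tY v_top] by (simp add: Z_def E.component_linear)
    have const: "Re (h (Z *v (mat_exp (t *\<^sub>R Z) *v v)) (mat_exp (t *\<^sub>R Z) *v v)) =
        ip \<alpha> Z * Re (h (mat_exp (t *\<^sub>R Z) *v v) (mat_exp (t *\<^sub>R Z) *v v))" for t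
    proof -
      let ?w = "mat_exp (t *\<^sub>R Z) *v v"
      have q: "mat_exp (t *\<^sub>R Y) \<in> parabolic G \<alpha>" by (rule E.exp_lie_parabolic(1)[OF tY])
      then have "mat_exp (t *\<^sub>R Y) \<in> G" "E.nonneg_weights (mat_exp (t *\<^sub>R Y))"
        by (simp_all add: E.parabolic_iff)
      then have w: "?w \<noteq> 0" "line ?w \<in> Orb" "?w \<in> E.top_eigenspace"
        using Orb_invariant[OF v(2)] E.component_0_on_top(2)[OF _ v_top] v(1)
        by (simp_all add: G_mult_eq_0 flip: eq)
      have "ip \<alpha> Z = Re (h (Z *v ?w) ?w) / Re (h ?w ?w)"
        using ip_mu[OF w(1) Zp] mu_const[OF w] by simp
      then show ?thesis using self_pos[OF w(1)] by simp
    qed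
    obtain S' P' where "spectral_resolution Z S' P'"
      using spectral_theorem p_self_adjoint[OF Zp] by blast
    then interpret Z: resolved_operator h Z S' P' by unfold_locales
    have "Z *v v = ip \<alpha> Z *\<^sub>R v" by (rule Z.eigenvector_if_constant_rayleigh[OF const])
    then have "mat_exp Z *v v = exp (ip \<alpha> Z) *\<^sub>R v" by (rule mat_exp_eigenvector)
    then show ?thesis using eq[of 1] by (simp add: line_scaleR)
  qed
  obtain U where U: "open U" "mat 1 \<in> U"
    "\<And>g. g \<in> G \<Longrightarrow> g \<in> U \<Longrightarrow> \<exists>X\<in>lie_algebra K. \<exists>Y\<in>E.lie_parabolic_self_adjoint. g = mat_exp X ** mat_exp Y"
    using local_product_decomposition[OF G_group G_closed subspace_k
        E.subspace_lie_parabolic_self_adjoint E.lie_G_iwasawa] by blast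
  have near: "\<exists>k\<in>K. line (g *v v) = line (k *v v)" if "g \<in> G" "g \<in> U" for g
  proof -
    obtain X Y where XY: "X \<in> lie_algebra K" "Y \<in> E.lie_parabolic_self_adjoint"
      "g = mat_exp X ** mat_exp Y" using U(3)[OF \<open>g \<in> G\<close> \<open>g \<in> U\<close>] by blast
    have "line (g *v v) = line (mat_exp X *v v)"
      using line_mult_cong[OF fix_line[OF XY(2)], of "mat_exp X"]
      by (simp add: XY(3) matrix_vector_mul_assoc)
    then show ?thesis using mat_exp_mem_1[OF XY(1)] by blast
  qed
  define H where "H = {g \<in> G. \<exists>k\<in>K. line (g *v v) = line (k *v v)}"
  have "openin (top_of_set G) H"
    unfolding openin_subopen[of _ H]
  proof
    fix a assume a: "a \<in> H"
    then obtain k where k: "a \<in> G" "k \<in> K" "line (a *v v) = line (k *v v)" by (auto simp: H_def)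
    \<comment> \<open>The map \<open>?f\<close> moves \<open>a\<close> to the identity, where the local product is available.\<close>
    let ?f = "\<lambda>g. matrix_inv k ** g ** matrix_inv a ** k"
    have inv: "k ** matrix_inv k = mat 1" "matrix_inv k ** k = mat 1"
      "a ** matrix_inv a = mat 1" "matrix_inv a ** a = mat 1"
      using K_invertible[OF k(2)] G_invertible[OF k(1)] by (simp_all add: matrix_inv_left matrix_inv_right)
    have "continuous_on UNIV ?f"
      by (intro matrix_mult.continuous_on continuous_on_const continuous_on_id)
    then have "open (?f -` U)" using U(1) by (simp add: open_vimage)
    then have "openin (top_of_set G) (G \<inter> ?f -` U)" by (rule openin_open_Int)
    moreover have "a \<in> G \<inter> ?f -` U"
    proof -
      have "?f a = matrix_inv k ** (a ** matrix_inv a) ** k" by (simp only: matrix_mul_assoc)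
      then show ?thesis using k(1) U(2) by (simp add: inv)
    qed
    moreover have "G \<inter> ?f -` U \<subseteq> H"
    proof
      fix g assume g: "g \<in> G \<inter> ?f -` U"
      have "?f g \<in> G" using g k K_subset by (intro G_mult G_inv) auto
      with g obtain k' where k': "k' \<in> K" "line (?f g *v v) = line (k' *v v)" using near by auto
      have "line (matrix_inv a *v (k *v v)) = line (matrix_inv a *v (a *v v))"
        by (rule line_mult_cong[OF k(3)[symmetric]])
      then have "line (matrix_inv a ** k *v v) = line v" by (simp add: matrix_vector_mul_assoc inv)
      from line_mult_cong[OF this, of g]
      have "line (g *v v) = line (g *v (matrix_inv a ** k *v v))" by simp
      also have "g *v (matrix_inv a ** k *v v) = k *v (?f g *v v)"
      proof -
        have "k ** ?f g = (k ** matrix_inv k) ** g ** matrix_inv a ** k" by (simp only: matrix_mul_assoc)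
        then show ?thesis by (simp add: inv matrix_vector_mul_assoc matrix_mul_assoc)
      qed
      also have "line (k *v (?f g *v v)) = line (k *v (k' *v v))" by (rule line_mult_cong[OF k'(2)])
      finally have "line (g *v v) = line (k ** k' *v v)" by (simp add: matrix_vector_mul_assoc)
      then show "g \<in> H" using g k(2) k'(1) K_mult by (auto simp: H_def)
    qed
    ultimately show "\<exists>T. openin (top_of_set G) T \<and> a \<in> T \<and> T \<subseteq> H" by blast
  qed
  moreover have "closedin (top_of_set G) H"
  proof -
    have "closed H"
      unfolding closed_sequential_limits
    proof (intro allI impI, elim conjE)
      fix f a assume f: "\<forall>n. f n \<in> H" "f \<longlonglongrightarrow> a"
      then obtain k where k: "\<And>n. k n \<in> K" "\<And>n. line (f n *v v) = line (k n *v v)"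
        unfolding H_def mem_Collect_eq by metis
      have "a \<in> G" using f by (intro closed_sequentially[OF G_closed _ f(2)]) (auto simp: H_def)
      obtain l r where l: "l \<in> K" "strict_mono (r :: nat \<Rightarrow> nat)" "(k \<circ> r) \<longlonglongrightarrow> l"
        using K_compact k(1) unfolding compact_def by metis
      have "line (a *v v) = line (l *v v)"
      proof (rule line_limit)
        show "(\<lambda>n. f (r n) *v v) \<longlonglongrightarrow> a *v v"
          using LIMSEQ_subseq_LIMSEQ[OF f(2) l(2)]
          by (intro matrix_vector.tendsto tendsto_const) (simp add: o_def)
        show "(\<lambda>n. k (r n) *v v) \<longlonglongrightarrow> l *v v"
          using l(3) by (intro matrix_vector.tendsto tendsto_const) (simp add: o_def)
      qed (use k v \<open>a \<in> G\<close> l(1) K_subset in \<open>auto simp: G_mult_eq_0\<close>)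
      then show "a \<in> H" using \<open>a \<in> G\<close> l(1) by (auto simp: H_def)
    qed
    moreover have "H \<subseteq> G" by (auto simp: H_def)
    ultimately show ?thesis by (simp add: closed_subset)
  qed
  moreover have "mat 1 \<in> H" using G_1 K_1 unfolding H_def by blast
  ultimately have "H = G" using G_connected unfolding connected_clopen by blast
  then show ?thesis using g by (auto simp: H_def)
qed

lemma K_transitive:
  assumes "line v \<in> Orb" "line w \<in> Orb" shows "\<exists>k\<in>K. line w = line (k *v v)"
proof -
  obtain x where x: "x \<noteq> 0" "line x \<in> Orb"
    "\<And>w. w \<noteq> 0 \<Longrightarrow> line w \<in> Orb \<Longrightarrow> ip (\<mu> (line w)) (\<mu> (line w)) \<le> ip (\<mu> (line x)) (\<mu> (line x))"
    by (rule obtain_norm_maximizer) blast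
  have "\<exists>k\<in>K. line y = line (k *v x)" if y: "line y \<in> Orb" for y
  proof -
    obtain g where "g \<in> G" "line y = line (g *v x)" using Orb_transitive[OF x(2) y] by blast
    then show ?thesis using K_orbit_of_maximizer[OF x] by metis
  qed
  then obtain a b where ab: "a \<in> K" "b \<in> K" "line v = line (a *v x)" "line w = line (b *v x)"
    using assms by meson
  have "line (b ** matrix_inv a *v v) = line (b ** matrix_inv a *v (a *v x))"
    by (rule line_mult_cong[OF ab(3)])
  also have "b ** matrix_inv a *v (a *v x) = b *v ((matrix_inv a ** a) *v x)"
    by (simp add: matrix_vector_mul_assoc matrix_mul_assoc)
  finally have "line w = line (b ** matrix_inv a *v v)"
    using ab K_invertible by (simp add: matrix_inv_left)
  then show ?thesis using ab K_mult K_inv by blast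
qed

text \<open>
  For \<open>w = k v\<close> the element \<open>b = Ad k (\<mu>[v])\<close> has the norm of \<open>\<mu>[v]\<close>, and \<open>\<langle>\<mu>[w], b\<rangle>\<close> is the square
  of this norm by the invariance of \<open>h\<close>; so \<open>\<mu>[w]\<close> is at least as long as \<open>\<mu>[v]\<close>, and conversely.
\<close>
lemma mu_norm_constant:
  assumes "v \<noteq> 0" "line v \<in> Orb" "w \<noteq> 0" "line w \<in> Orb"
  shows "ip (\<mu> (line v)) (\<mu> (line v)) = ip (\<mu> (line w)) (\<mu> (line w))"
proof -
  have le: "ip (\<mu> (line v)) (\<mu> (line v)) \<le> ip (\<mu> (line w)) (\<mu> (line w))"
    if vw: "v \<noteq> 0" "line v \<in> Orb" "w \<noteq> 0" "line w \<in> Orb" for v w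
  proof -
    obtain k where k: "k \<in> K" "line w = line (k *v v)" using K_transitive vw by blast
    let ?\<alpha> = "\<mu> (line v)" let ?b = "k ** ?\<alpha> ** matrix_inv k"
    have \<alpha>: "?\<alpha> \<in> \<pp>" and w: "\<mu> (line w) \<in> \<pp>" using mu_mem vw by auto
    have b: "?b \<in> \<pp>" by (rule Ad_K_p[OF k(1) \<alpha>])
    have kv: "k *v v \<noteq> 0" using vw(1) k(1) K_subset by (auto simp: G_mult_eq_0)
    have "?b *v (k *v v) = k *v (?\<alpha> *v ((matrix_inv k ** k) *v v))"
      by (simp add: matrix_vector_mul_assoc matrix_mul_assoc)
    then have "?b *v (k *v v) = k *v (?\<alpha> *v v)" using K_invertible[OF k(1)] by (simp add: matrix_inv_left)
    then have "ip (\<mu> (line w)) ?b = ip ?\<alpha> ?\<alpha>"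
      using ip_mu[OF kv b] ip_mu[OF vw(1) \<alpha>] by (simp add: k(2) K_isometry k(1))
    moreover have "ip ?b ?b = ip ?\<alpha> ?\<alpha>" using ip_Ad k(1) \<alpha> by blast
    moreover have "0 \<le> ip (\<mu> (line w) - ?b) (\<mu> (line w) - ?b)"
      using w b by (intro ip_nonneg subspace_diff subspace_p)
    ultimately show ?thesis using ip_square_diff[OF w b] by simp
  qed
  show ?thesis using le assms by (meson order_antisym)
qed

end



section \<open>Irreducible subspaces\<close>

lemma exists_irreducible_subrep:
  assumes "vec.subspace U" "U \<noteq> {0}" "\<forall>g\<in>H. \<forall>u\<in>U. g *v u \<in> U"
  shows "\<exists>W\<subseteq>U. irreducible_subrep H W"
  using assms
proof (induction "vec.dim U" arbitrary: U rule: less_induct)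
  case less
  show ?case
  proof (cases "irreducible_subrep H U")
    case False
    then obtain U' where U': "vec.subspace U'" "U' \<subseteq> U" "\<forall>g\<in>H. \<forall>u\<in>U'. g *v u \<in> U'"
      "U' \<noteq> {0}" "U' \<noteq> U"
      using less.prems unfolding irreducible_subrep_def by blast
    then have "vec.dim U' < vec.dim U"
      using less.prems(1) by (metis psubsetI vec.dim_psubset vec.span_eq_iff)
    from less.hyps[OF this U'(1,4,3)] show ?thesis using U'(2) by blast
  qed blast
qed

text \<open>The eigenvector expansion for the identity matrix is an orthogonal projection.\<close>
lemma (in hermitian_space) orthogonal_decomposition:
  assumes "vec.subspace W" obtains w where "w \<in> W" "\<And>u. u \<in> W \<Longrightarrow> h (v - w) u = 0"
proof -
  obtain B where B: "finite B" "B \<subseteq> W" "\<And>x. x \<in> W \<Longrightarrow> x = (\<Sum>b\<in>B. h x b *s b)"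
    using eigenvector_expansion_exists[OF adjoint_pair_1 assms] by auto
  let ?w = "\<Sum>b\<in>B. h v b *s b"
  show ?thesis
  proof (rule that)
    show "?w \<in> W" using B(2) by (intro vec.subspace_sum vec.subspace_scale assms) auto
    fix u assume "u \<in> W"
    have "h v u = (\<Sum>b\<in>B. cnj (h u b) * h v b)"
      by (subst B(3)[OF \<open>u \<in> W\<close>]) (simp add: form.sum_right scale_right)
    also have "\<dots> = h ?w u"
      unfolding form.sum_left scale_left
    proof (rule sum.cong[OF refl])
      fix b
      show "cnj (h u b) * h v b = h v b * h b u" using conj_sym[of u b] by simp
    qed
    finally show "h (v - ?w) u = 0" by (simp add: form.diff_left)
  qed
qed

section \<open>The top eigenspace and the parabolic subgroup\<close>

context compatible_group_element
begin

lemma parabolic_preserves_top: "g \<in> parabolic G A \<Longrightarrow> v \<in> top_eigenspace \<Longrightarrow> g *v v \<in> top_eigenspace"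
  using component_0_on_top(2) by (simp add: parabolic_iff)

text \<open>
  On the top eigenspace the parabolic group acts through its Levi part, which is stable under
  adjoints; the orthogonal complement of \<open>W\<close> in the top eigenspace is therefore invariant.
\<close>
lemma unique_irreducible_subrep_eq_top:
  assumes W: "unique_irreducible_subrep (parabolic G A) W" shows "W = top_eigenspace"
proof -
  let ?Q = "parabolic G A"
  have irr: "irreducible_subrep ?Q W" and uniq: "\<And>W'. irreducible_subrep ?Q W' \<Longrightarrow> W' = W"
    using W by (auto simp: unique_irreducible_subrep_def)
  have subW: "vec.subspace W" and W0: "W \<noteq> {0}" and invW: "\<And>g w. g \<in> ?Q \<Longrightarrow> w \<in> W \<Longrightarrow> g *v w \<in> W"
    using irr by (auto simp: irreducible_subrep_def)
  have contains: "W \<subseteq> U" if "vec.subspace U" "U \<noteq> {0}" "\<forall>g\<in>?Q. \<forall>u\<in>U. g *v u \<in> U" for U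
    using exists_irreducible_subrep[OF that] uniq by blast
  have W_top: "W \<subseteq> top_eigenspace"
    using top_eigenspace_nonzero parabolic_preserves_top
    by (intro contains subspace_top_eigenspace) auto
  define C where "C = {v \<in> top_eigenspace. \<forall>w\<in>W. h v w = 0}"
  have subC: "vec.subspace C"
    using subspace_top_eigenspace unfolding vec.subspace_def C_def
    by (auto simp: form.add_left scale_left)
  have "g *v v \<in> C" if g: "g \<in> ?Q" and v: "v \<in> C" for g v
  proof -
    have nn: "g \<in> G" "nonneg_weights g" using g by (auto simp: parabolic_iff)
    have v_top: "v \<in> top_eigenspace" using v by (simp add: C_def)
    define l where "l = component 0 g"
    have "l \<in> G" unfolding l_def by (rule component_0_mem[OF nn])
    then obtain l' where l': "l' \<in> G" "adjoint_pair l l'" by (rule G_adjoint)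
    have "component \<nu> l' = 0" if "\<nu> < 0" for \<nu>
    proof -
      have "adjoint_pair 0 (component \<nu> l')"
        using adjoint_component[OF l'(2), of "- \<nu>"] that by (simp add: l_def component_component)
      from adjoint_pair_unique[OF adjoint_pair_0 this] show ?thesis by simp
    qed
    then have "l' \<in> ?Q" using l'(1) by (simp add: parabolic_iff nonneg_weights_def)
    then have "h (g *v v) w = 0" if "w \<in> W" for w
      using v invW[OF _ that] l'(2) component_0_on_top(1)[OF nn(2) v_top]
      by (simp add: C_def adjoint_pair_def l_def)
    then show ?thesis using parabolic_preserves_top[OF g v_top] by (simp add: C_def)
  qed
  then have "W \<subseteq> C" if "C \<noteq> {0}" using contains[OF subC that] by blast
  moreover have "\<not> W \<subseteq> C"
  proof
    assume "W \<subseteq> C"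
    then have "h w w = 0" if "w \<in> W" for w using that by (auto simp: C_def)
    then have "w = 0" if "w \<in> W" for w using that by (simp add: self_eq_0_iff)
    then show False using W0 vec.subspace_0[OF subW] by blast
  qed
  ultimately have C0: "C = {0}" by blast
  have "v \<in> W" if "v \<in> top_eigenspace" for v
  proof -
    obtain w where w: "w \<in> W" "\<And>u. u \<in> W \<Longrightarrow> h (v - w) u = 0"
      using orthogonal_decomposition[OF subW] by blast
    have "v - w \<in> top_eigenspace"
      using w(1) W_top that by (intro vec.subspace_diff subspace_top_eigenspace) auto
    then have "v - w \<in> C" using w(2) by (simp add: C_def)
    then show ?thesis using C0 w(1) by simp
  qed
  with W_top show ?thesis by blast
qed

lemma orth_compl_top: "orth_compl h top_eigenspace = {v. P top_eigenvalue *v v = 0}"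
proof -
  let ?P = "P top_eigenvalue"
  have sa: "h (?P *v x) y = h x (?P *v y)" for x y
    using P_self_adjoint[OF top_in_S] by (simp add: adjoint_pair_def)
  have "(\<forall>w\<in>top_eigenspace. h v w = 0) \<longleftrightarrow> ?P *v v = 0" for v
  proof
    assume "\<forall>w\<in>top_eigenspace. h v w = 0"
    then have "h v (?P *v (?P *v v)) = 0" using P_top_mem by blast
    then have "h (?P *v v) (?P *v v) = 0" by (simp only: sa)
    then show "?P *v v = 0" by (simp add: self_eq_0_iff)
  next
    assume 0: "?P *v v = 0"
    show "\<forall>w\<in>top_eigenspace. h v w = 0"
      using sa[of v] 0 by (auto simp: mem_top_eigenspace) (metis zero_left)
  qed
  then show ?thesis by (simp add: orth_compl_def)
qed

lemma orth_proj_top: "orth_proj h top_eigenspace v = P top_eigenvalue *v v"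
  unfolding orth_proj_def orth_compl_top
proof (rule the_equality)
  show "P top_eigenvalue *v v \<in> top_eigenspace \<and> v - P top_eigenvalue *v v \<in> {v. P top_eigenvalue *v v = 0}"
    using P_top_mem P_idem[OF top_in_S]
    by (simp add: matrix_vector.diff_right matrix_vector_mul_assoc)
  show "w = P top_eigenvalue *v v"
    if "w \<in> top_eigenspace \<and> v - w \<in> {v. P top_eigenvalue *v v = 0}" for w
    using that by (simp add: matrix_vector.diff_right mem_top_eigenspace)
qed

lemma proj_onto_top: "proj_onto h top_eigenspace (line v) = line (P top_eigenvalue *v v)"
  unfolding proj_onto_def orth_proj_top using act_line[of "P top_eigenvalue" v] by (simp add: act_def)

end

section \<open>The face of the convex hull defined by an element\<close>

context gradient_orbit_element
begin

lemma lie_parabolic_minus: "X \<in> lie_parabolic \<Longrightarrow> - X \<in> lie_parabolic"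
  using subspace_lie_parabolic by (rule subspace_neg)

text \<open>
  Nearby points of the orbit are reached by a factor from the opposite unipotent group and a
  parabolic one. The flow of \<open>A\<close> fixes points of the top eigenspace up to scaling and contracts
  the first factor to the identity, which must therefore act trivially.
\<close>
lemma parabolic_orbit_neighbourhood:
  assumes v: "v \<noteq> 0" "v \<in> top_eigenspace" "line v \<in> Orb"
    and f: "f \<longlonglongrightarrow> v" "\<And>n. f n \<in> top_eigenspace" "\<And>n. line (f n) \<in> Orb"
  shows "\<exists>n. \<exists>Y\<in>lie_parabolic. line (f n) = line (mat_exp Y *v v)"
proof -
  have "\<forall>n. \<exists>k\<in>K. line (f n) = line (k *v v)" using K_transitive[OF v(3) f(3)] by blast
  then obtain k where k: "\<And>n. k n \<in> K" "\<And>n. line (f n) = line (k n *v v)" by metis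
  obtain l r where l: "l \<in> K" "strict_mono (r :: nat \<Rightarrow> nat)" "(k \<circ> r) \<longlonglongrightarrow> l"
    using K_compact k(1) unfolding compact_def by metis
  have l_inv: "l ** matrix_inv l = mat 1" "matrix_inv l ** l = mat 1"
    using K_invertible[OF l(1)] by (simp_all add: matrix_inv_left matrix_inv_right)
  have line_l: "line v = line (l *v v)"
  proof (rule line_limit)
    show "(\<lambda>n. f (r n)) \<longlonglongrightarrow> v" using LIMSEQ_subseq_LIMSEQ[OF f(1) l(2)] by (simp add: o_def)
    show "(\<lambda>n. k (r n) *v v) \<longlonglongrightarrow> l *v v"
      using l(3) by (intro matrix_vector.tendsto tendsto_const) (simp add: o_def)
  qed (use v k l K_subset in \<open>auto simp: G_mult_eq_0\<close>)
  have "line (matrix_inv l *v v) = line (matrix_inv l *v (l *v v))" by (rule line_mult_cong[OF line_l])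
  then have line_inv: "line (matrix_inv l *v v) = line v" by (simp add: matrix_vector_mul_assoc l_inv)
  obtain U where U: "open U" "mat 1 \<in> U"
    "\<And>g. g \<in> G \<Longrightarrow> g \<in> U \<Longrightarrow> \<exists>X\<in>lie_opposite_nilradical. \<exists>Y\<in>lie_parabolic. g = mat_exp X ** mat_exp Y"
    using local_product_decomposition[OF G_group G_closed subspace_lie_opposite_nilradical
        subspace_lie_parabolic lie_G_opposite_parabolic] by blast
  have "(\<lambda>n. k (r n) ** matrix_inv l) \<longlonglongrightarrow> l ** matrix_inv l"
    using l(3) by (intro matrix_mult.tendsto tendsto_const) (simp add: o_def)
  then have "(\<lambda>n. k (r n) ** matrix_inv l) \<longlonglongrightarrow> mat 1" by (simp add: l_inv)
  from topological_tendstoD[OF this U(1,2)] obtain n where n: "k (r n) ** matrix_inv l \<in> U"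
    by (auto simp: eventually_sequentially)
  let ?g = "k (r n) ** matrix_inv l"
  have "?g \<in> G" using k(1) l(1) K_subset by (intro G_mult G_inv) auto
  then obtain X Y where XY: "X \<in> lie_opposite_nilradical" "Y \<in> lie_parabolic"
    "?g = mat_exp X ** mat_exp Y" using U(3) n by blast
  have "line (f (r n)) = line (k (r n) *v v)" by (rule k(2))
  also have "\<dots> = line (k (r n) *v (matrix_inv l *v v))"
    by (rule line_mult_cong[OF line_inv[symmetric]])
  also have "k (r n) *v (matrix_inv l *v v) = ?g *v v" by (simp add: matrix_vector_mul_assoc)
  also have "\<dots> = mat_exp X *v (mat_exp Y *v v)" by (simp add: XY(3) matrix_vector_mul_assoc)
  finally have line_f: "line (f (r n)) = line (mat_exp X *v (mat_exp Y *v v))" .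
  define w where "w = mat_exp Y *v v"
  define u where "u = mat_exp X *v w"
  have w: "w \<in> top_eigenspace"
    unfolding w_def by (rule parabolic_preserves_top[OF exp_lie_parabolic(1)[OF XY(2)] v(2)])
  have u: "u \<in> top_eigenspace"
    unfolding u_def w_def
    by (rule mem_subspace_line_cong[OF subspace_top_eigenspace line_f[symmetric] f(2)])
  have exp_top: "mat_exp (t *\<^sub>R A) *v x = exp (t * top_eigenvalue) *\<^sub>R x" if "x \<in> top_eigenspace" for t x
    using that by (intro mat_exp_eigenvector) (simp add: top_eigenspace_def matrix_vector.scaleR_left)
  have "flow t (mat_exp X) *v w = u" for t
  proof -
    have "flow t (mat_exp X) *v w = mat_exp (t *\<^sub>R A) *v (mat_exp X *v (mat_exp ((- t) *\<^sub>R A) *v w))"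
      by (simp add: flow_def matrix_vector_mul_assoc matrix_mul_assoc)
    also have "\<dots> = exp ((- t) * top_eigenvalue) *\<^sub>R (mat_exp (t *\<^sub>R A) *v u)"
      by (simp only: exp_top[OF w] matrix_vector.scaleR_right u_def)
    also have "\<dots> = u"
      by (simp only: exp_top[OF u] scaleR_scaleR exp_add[symmetric]) simp
    finally show ?thesis .
  qed
  moreover have "((\<lambda>t. flow t (mat_exp X) *v w) \<longlongrightarrow> mat_exp 0 *v w) at_top"
    unfolding flow_mat_exp using XY(1)
    by (intro matrix_vector.tendsto tendsto_const tendsto_mat_exp tendsto_flow_at_top_0)
      (auto simp: lie_opposite_nilradical_def)
  ultimately have "u = w" by (simp add: tendsto_const_iff)
  then have "line (f (r n)) = line (mat_exp Y *v v)" using line_f by (simp add: u_def w_def)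
  then show ?thesis using XY(2) by blast
qed

text \<open>
  A limit \<open>[u]\<close> of points of the \<open>Q\<close>-orbit of \<open>[v]\<close> is again in the orbit and in the top eigenspace,
  so points near it are in its own \<open>Q\<close>-orbit, which therefore meets that of \<open>[v]\<close>.
\<close>
lemma parabolic_orbit_closed:
  assumes v: "v \<noteq> 0" "v \<in> top_eigenspace" "line v \<in> Orb"
  shows "closed_orbit_in (parabolic G A) Orb (orbit (parabolic G A) (line v))"
proof -
  let ?Q = "parabolic G A"
  have QG: "q \<in> G" if "q \<in> ?Q" for q using that by (simp add: parabolic_iff)
  have sub: "orbit ?Q (line v) \<subseteq> Orb"
    using Orb_invariant[OF v(3)] QG by (auto simp: orbit_def act_line)
  have "closedin proj_topology (orbit ?Q (line v))"
  proof (rule closedin_projI)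
    show "orbit ?Q (line v) \<subseteq> proj UNIV"
      using v(1) QG by (auto simp: orbit_def act_line G_mult_eq_0 intro!: line_mem_proj_UNIV)
    fix f u assume f: "f \<longlonglongrightarrow> u" "\<And>n. f n \<noteq> 0 \<and> line (f n) \<in> orbit ?Q (line v)" and u: "u \<noteq> 0"
    have "\<forall>n. \<exists>q\<in>?Q. line (f n) = line (q *v v)" using f(2) by (auto simp: orbit_def act_line)
    then obtain q where q: "\<And>n. q n \<in> ?Q" "\<And>n. line (f n) = line (q n *v v)" by metis
    have f_top: "f n \<in> top_eigenspace" for n
      using mem_subspace_line_cong[OF subspace_top_eigenspace q(2)]
        parabolic_preserves_top[OF q(1) v(2)] by blast
    have f_Orb: "line (f n) \<in> Orb" for n using f(2) sub by blast
    have "(\<lambda>n. A *v f n) \<longlonglongrightarrow> A *v u" by (intro matrix_vector.tendsto tendsto_const f(1))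
    moreover have "(\<lambda>n. A *v f n) \<longlonglongrightarrow> top_eigenvalue *\<^sub>R u"
      using tendsto_scaleR[OF tendsto_const f(1), of top_eigenvalue] f_top
      by (simp add: top_eigenspace_def)
    ultimately have u_top: "u \<in> top_eigenspace"
      using LIMSEQ_unique by (auto simp: top_eigenspace_def)
    have u_Orb: "line u \<in> Orb"
      by (rule closedin_proj_limit[OF Orb_closed f(1) _ u]) (simp_all add: f_Orb)
    obtain n Y where Y: "Y \<in> lie_parabolic" "line (f n) = line (mat_exp Y *v u)"
      using parabolic_orbit_neighbourhood[OF u u_top u_Orb f(1) f_top f_Orb] by blast
    have "line u = line (mat_exp (- Y) *v (mat_exp Y *v u))"
      by (simp add: matrix_vector_mul_assoc mat_exp_minus)
    also have "\<dots> = line (mat_exp (- Y) *v (q n *v v))"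
      using Y(2) q(2)[of n] by (intro line_mult_cong) simp
    also have "\<dots> = act (mat_exp (- Y) ** q n) (line v)"
      by (simp add: act_line matrix_vector_mul_assoc)
    finally show "line u \<in> orbit ?Q (line v)"
      using parabolic_mult[OF exp_lie_parabolic(1)[OF lie_parabolic_minus[OF Y(1)]] q(1)[of n]]
      by (auto simp: orbit_def)
  qed
  then show ?thesis
    using sub v(1) line_mem_proj_UNIV by (auto simp: closed_orbit_in_def)
qed

lemma one_mem_parabolic: "mat 1 \<in> parabolic G A"
  using exp_lie_parabolic(1)[OF subspace_0[OF subspace_lie_parabolic]] by simp

text \<open>
  Every point of the left-hand side lies on a closed orbit of the parabolic group, and there is
  only one such orbit in \<open>Orb\<close>.
\<close>
theorem top_points_of_orbit:
  assumes OrbQ: "unique_closed_orbit_in (parabolic G A) Orb OrbQ"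
  shows "proj top_eigenspace \<inter> Orb = OrbQ"
proof -
  let ?Q = "parabolic G A"
  have eq: "orbit ?Q (line v) = OrbQ" if "v \<noteq> 0" "v \<in> top_eigenspace" "line v \<in> Orb" for v
    using parabolic_orbit_closed[OF that] OrbQ by (simp add: unique_closed_orbit_in_def)
  show ?thesis
  proof
    show "proj top_eigenspace \<inter> Orb \<subseteq> OrbQ"
    proof
      fix L assume "L \<in> proj top_eigenspace \<inter> Orb"
      then obtain v where v: "L = line v" "v \<noteq> 0" "v \<in> top_eigenspace" "line v \<in> Orb"
        by (auto simp: proj_def)
      have "L = act (mat 1) (line v)" by (simp add: act_line v(1))
      then show "L \<in> OrbQ" using eq[OF v(2-4)] one_mem_parabolic by (auto simp: orbit_def)
    qed
    obtain v where v: "v \<noteq> 0" "line v \<in> Orb" "v \<in> top_eigenspace"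
      using Orb_meets_top_eigenspace by blast
    show "OrbQ \<subseteq> proj top_eigenspace \<inter> Orb"
    proof
      fix L assume "L \<in> OrbQ"
      then obtain g where g: "g \<in> ?Q" "L = line (g *v v)"
        using eq[OF v(1,3,2)] by (auto simp: orbit_def act_line)
      have "g \<in> G" using g(1) by (simp add: parabolic_iff)
      then show "L \<in> proj top_eigenspace \<inter> Orb"
        using g parabolic_preserves_top[OF g(1) v(3)] Orb_invariant[OF v(2)] v(1)
        by (auto simp: proj_def G_mult_eq_0)
    qed
  qed
qed

lemma projection_of_orbit:
  "proj_onto h top_eigenspace ` (Orb - proj (orth_compl h top_eigenspace)) = proj top_eigenspace \<inter> Orb"
proof -
  let ?P = "P top_eigenvalue"
  have sub: "vec.subspace (orth_compl h top_eigenspace)"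
    unfolding orth_compl_top by (auto simp: vec.subspace_def matrix_vector.add_right vec.scale)
  have not_mem: "line v \<notin> proj (orth_compl h top_eigenspace) \<longleftrightarrow> ?P *v v \<noteq> 0" if "v \<noteq> 0" for v
    using line_mem_proj_iff[OF sub that] by (simp add: orth_compl_top)
  show ?thesis
  proof
    show "proj_onto h top_eigenspace ` (Orb - proj (orth_compl h top_eigenspace)) \<subseteq> proj top_eigenspace \<inter> Orb"
    proof (rule image_subsetI)
      fix L assume L: "L \<in> Orb - proj (orth_compl h top_eigenspace)"
      then obtain v where v: "v \<noteq> 0" "L = line v" using Orb_line by blast
      have "?P *v v \<noteq> 0" using L not_mem[OF v(1)] by (simp add: v(2))
      then show "proj_onto h top_eigenspace L \<in> proj top_eigenspace \<inter> Orb"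
        using L v line_P_top_mem[of v] P_top_mem by (auto simp: proj_onto_top proj_def)
    qed
    show "proj top_eigenspace \<inter> Orb \<subseteq> proj_onto h top_eigenspace ` (Orb - proj (orth_compl h top_eigenspace))"
    proof
      fix L assume "L \<in> proj top_eigenspace \<inter> Orb"
      then obtain v where v: "L = line v" "v \<noteq> 0" "v \<in> top_eigenspace" "L \<in> Orb"
        by (auto simp: proj_def)
      have P: "?P *v v = v" using v(3) by (simp add: mem_top_eigenspace)
      then have "L \<in> Orb - proj (orth_compl h top_eigenspace)" using v not_mem[OF v(2)] by simp
      moreover have "L = proj_onto h top_eigenspace L" by (simp add: v(1) proj_onto_top P)
      ultimately show "L \<in> proj_onto h top_eigenspace ` (Orb - proj (orth_compl h top_eigenspace))" by blast
    qed
  qed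
qed

abbreviation gradient_body :: "'n cmat set" where "gradient_body \<equiv> convex hull (\<mu> ` Orb)"

lemma gradient_body_subset: "gradient_body \<subseteq> \<pp>"
  by (intro hull_minimal mu_Orb_subset subspace_imp_convex subspace_p)

lemma exposed_face_eq:
  obtains b where "exposed_face ip A gradient_body = gradient_body \<inter> {x. b \<bullet> x = top_eigenvalue}"
    "\<And>x. x \<in> gradient_body \<Longrightarrow> ip x A = b \<bullet> x" "\<And>x. x \<in> gradient_body \<Longrightarrow> b \<bullet> x \<le> top_eigenvalue"
proof -
  obtain R where R: "\<And>X Y. X \<in> \<pp> \<Longrightarrow> Y \<in> \<pp> \<Longrightarrow> ip X Y = X \<bullet> R Y"
    using ip_representation by metis
  define b where "b = R A"
  have ip_b: "ip x A = b \<bullet> x" if "x \<in> \<pp>" for x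
    using R[OF that A_mem] by (simp add: b_def inner_commute)
  have "\<mu> ` Orb \<subseteq> {x. b \<bullet> x \<le> top_eigenvalue}"
  proof (rule image_subsetI)
    fix L assume "L \<in> Orb"
    then obtain v where "v \<noteq> 0" "L = line v" by (rule Orb_line)
    then show "\<mu> L \<in> {x. b \<bullet> x \<le> top_eigenvalue}"
      using ip_mu_le_top[of v] by (simp add: mu_mem flip: ip_b)
  qed
  then have le: "gradient_body \<subseteq> {x. b \<bullet> x \<le> top_eigenvalue}"
    by (intro hull_minimal convex_halfspace_le)
  obtain v where v: "v \<noteq> 0" "line v \<in> Orb" "v \<in> top_eigenspace"
    using Orb_meets_top_eigenspace by blast
  have max: "\<mu> (line v) \<in> gradient_body" "b \<bullet> \<mu> (line v) = top_eigenvalue"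
    using v ip_mu_eq_top_iff[OF v(1)] mu_mem[OF v(1)] by (simp_all add: hull_inc flip: ip_b)
  have "exposed_face ip A gradient_body = {x \<in> gradient_body. \<forall>y\<in>gradient_body. b \<bullet> y \<le> b \<bullet> x}"
    unfolding exposed_face_def using ip_b gradient_body_subset by (auto simp: subset_iff)
  also have "\<dots> = gradient_body \<inter> {x. b \<bullet> x = top_eigenvalue}"
  proof (rule set_eqI)
    fix x
    have "b \<bullet> x = top_eigenvalue"
      if "x \<in> gradient_body" "\<forall>y\<in>gradient_body. b \<bullet> y \<le> b \<bullet> x"
      using that(2)[rule_format, OF max(1)] max(2) le that(1) by (auto intro: antisym)
    then show "x \<in> {x \<in> gradient_body. \<forall>y\<in>gradient_body. b \<bullet> y \<le> b \<bullet> x} \<longleftrightarrow>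
        x \<in> gradient_body \<inter> {x. b \<bullet> x = top_eigenvalue}"
      using le by auto
  qed
  finally show ?thesis using that ip_b gradient_body_subset le by blast
qed

theorem mu_mem_face_iff:
  assumes "v \<noteq> 0" shows "\<mu> (line v) \<in> exposed_face ip A gradient_body \<longleftrightarrow> v \<in> top_eigenspace"
proof -
  obtain b where b: "exposed_face ip A gradient_body = gradient_body \<inter> {x. b \<bullet> x = top_eigenvalue}"
    "\<And>x. x \<in> gradient_body \<Longrightarrow> ip x A = b \<bullet> x" using exposed_face_eq by metis
  show ?thesis
    using mu_in_convex_hull[OF assms] ip_mu_eq_top_iff[OF assms] by (simp add: b flip: b(2))
qed

text \<open>
  All points of \<open>\<mu> ` Orb\<close> have the same norm, and a point of a sphere is not inside a segment of
  the ball.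
\<close>
lemma mu_Orb_extreme:
  assumes "x \<in> \<mu> ` Orb" shows "x extreme_point_of gradient_body"
proof -
  obtain R where R: "linear R" "\<And>X Y. X \<in> \<pp> \<Longrightarrow> Y \<in> \<pp> \<Longrightarrow> ip X Y = X \<bullet> R Y"
    using ip_representation by metis
  have comb: "ip ((1 - u) *\<^sub>R a + u *\<^sub>R b) ((1 - u) *\<^sub>R a + u *\<^sub>R b)
      = (1 - u) * ip a a + u * ip b b - u * (1 - u) * ip (a - b) (a - b)"
    if "a \<in> \<pp>" "b \<in> \<pp>" for a b u
  proof -
    have m: "(1 - u) *\<^sub>R a + u *\<^sub>R b \<in> \<pp>" "a - b \<in> \<pp>"
      using that subspace_p by (simp_all add: subspace_add subspace_scale subspace_diff)
    show ?thesis
      unfolding R(2)[OF m(1) m(1)] R(2)[OF m(2) m(2)] R(2)[OF that(1) that(1)] R(2)[OF that(2) that(2)]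
      by (simp add: linear_add[OF R(1)] linear_diff[OF R(1)] linear_scale[OF R(1)] inner_add_left
          inner_add_right inner_diff_left inner_diff_right algebra_simps)
  qed
  define r where "r = ip x x"
  have norm_r: "ip y y = r" if y: "y \<in> \<mu> ` Orb" for y
  proof -
    obtain L M where LM: "L \<in> Orb" "x = \<mu> L" "M \<in> Orb" "y = \<mu> M" using assms y by blast
    obtain v w where "v \<noteq> 0" "L = line v" "w \<noteq> 0" "M = line w"
      using Orb_line[OF LM(1)] Orb_line[OF LM(3)] by metis
    then show ?thesis using mu_norm_constant[of w v] LM by (simp add: r_def)
  qed
  have "convex {y \<in> \<pp>. ip y y \<le> r}"
    unfolding convex_alt
  proof (intro ballI allI impI, elim CollectE conjE)
    fix a b and u :: real assume a: "a \<in> \<pp>" "ip a a \<le> r" and b: "b \<in> \<pp>" "ip b b \<le> r" and u: "0 \<le> u" "u \<le> 1"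
    have "(1 - u) * ip a a + u * ip b b \<le> (1 - u) * r + u * r"
      using u a b by (intro add_mono mult_left_mono) auto
    moreover have "0 \<le> u * (1 - u) * ip (a - b) (a - b)"
      using u a b by (intro mult_nonneg_nonneg ip_nonneg subspace_diff subspace_p) auto
    ultimately have "ip ((1 - u) *\<^sub>R a + u *\<^sub>R b) ((1 - u) *\<^sub>R a + u *\<^sub>R b) \<le> r"
      unfolding comb[OF a(1) b(1)] by (simp add: algebra_simps)
    moreover have "(1 - u) *\<^sub>R a + u *\<^sub>R b \<in> \<pp>"
      using a b subspace_p by (simp add: subspace_add subspace_scale)
    ultimately show "(1 - u) *\<^sub>R a + u *\<^sub>R b \<in> {y \<in> \<pp>. ip y y \<le> r}" by simp
  qed
  then have hull_r: "gradient_body \<subseteq> {y \<in> \<pp>. ip y y \<le> r}"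
    using norm_r mu_Orb_subset by (intro hull_minimal) auto
  have "x \<notin> open_segment a b" if ab: "a \<in> gradient_body" "b \<in> gradient_body" for a b
  proof
    assume "x \<in> open_segment a b"
    then obtain u where u: "0 < u" "u < 1" "x = (1 - u) *\<^sub>R a + u *\<^sub>R b" "a \<noteq> b"
      by (auto simp: in_segment)
    have a: "a \<in> \<pp>" "ip a a \<le> r" and b: "b \<in> \<pp>" "ip b b \<le> r" using ab hull_r by auto
    have "(1 - u) * ip a a + u * ip b b \<le> (1 - u) * r + u * r"
      using u a b by (intro add_mono mult_left_mono) auto
    moreover have "r = (1 - u) * ip a a + u * ip b b - u * (1 - u) * ip (a - b) (a - b)"
      using comb[OF a(1) b(1), of u] by (simp add: r_def u(3))
    moreover have "0 < u * (1 - u) * ip (a - b) (a - b)"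
      using u a b by (intro mult_pos_pos ip_pos subspace_diff subspace_p) auto
    ultimately show False by (simp add: algebra_simps)
  qed
  then show ?thesis using assms by (simp add: extreme_point_of_def hull_inc)
qed

theorem extreme_points_of_face:
  "{x. x extreme_point_of exposed_face ip A gradient_body} = \<mu> ` (proj top_eigenspace \<inter> Orb)"
proof -
  obtain b where b: "exposed_face ip A gradient_body = gradient_body \<inter> {x. b \<bullet> x = top_eigenvalue}"
    "\<And>x. x \<in> gradient_body \<Longrightarrow> b \<bullet> x \<le> top_eigenvalue" using exposed_face_eq by metis
  have face: "exposed_face ip A gradient_body face_of gradient_body"
    unfolding b(1) by (rule face_of_Int_supporting_hyperplane_le[OF convex_convex_hull b(2)])
  have "x extreme_point_of gradient_body \<longleftrightarrow> x \<in> \<mu> ` Orb" for x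
    using mu_Orb_extreme extreme_point_of_convex_hull by blast
  then have "{x. x extreme_point_of exposed_face ip A gradient_body} = \<mu> ` Orb \<inter> exposed_face ip A gradient_body"
    using extreme_point_of_face[OF face] by auto
  also have "\<dots> = \<mu> ` (proj top_eigenspace \<inter> Orb)"
  proof -
    have "\<mu> L \<in> exposed_face ip A gradient_body \<longleftrightarrow> L \<in> proj top_eigenspace" if L: "L \<in> Orb" for L
    proof -
      obtain v where v: "v \<noteq> 0" "L = line v" using Orb_line[OF L] .
      show ?thesis
        unfolding v(2) mu_mem_face_iff[OF v(1)] line_mem_proj_iff[OF subspace_top_eigenspace v(1)] ..
    qed
    then show ?thesis by auto
  qed
  finally show ?thesis .
qed

end

section \<open>Faces of the convex hull and parabolic subgroups\<close>

theorem theorem55: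
  fixes h :: "'n::finite cvec \<Rightarrow> 'n cvec \<Rightarrow> complex"
    and G K Q \<pp> E :: "'n cmat set"
    and ip :: "'n cmat \<Rightarrow> 'n cmat \<Rightarrow> real"
    and \<mu> :: "'n cvec set \<Rightarrow> 'n cmat"
    and \<beta> :: "'n cmat"
    and Orb' Orb OrbQ :: "'n cvec set set"
    and W :: "'n cvec set"
  assumes "hermitian_product h"
    and "lie_subgroup_SL G" and "connected G" and "\<not> compact G"
    and "semisimple_lie_algebra (lie_algebra G)"
    and "finite (group_center G)"
    and "maximal_compact_subgroup G K"
    and "cartan_decomposition (lie_algebra G) (lie_algebra K) \<pp>"
    and "irreducible_subrep G UNIV"
    and "compatible h G K \<pp>"
    and "Ad_invariant_scalar_product K \<pp> ip"
    and "gradient_map h \<pp> ip \<mu>"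
    and "unique_closed_orbit_in (zariski_closure_SL G) (proj UNIV) Orb'"
    and "unique_closed_orbit_in G Orb' Orb"
    and "E = convex hull (\<mu> ` Orb)"
    and "\<beta> \<in> \<pp>"
    and "Q = parabolic G \<beta>"
    and "unique_irreducible_subrep Q W"
    and "unique_closed_orbit_in Q Orb OrbQ"
  shows "\<mu> ` OrbQ = {x. x extreme_point_of exposed_face ip \<beta> E} \<and>
    {L \<in> proj UNIV. \<mu> L \<in> exposed_face ip \<beta> E} = proj W \<and>
    proj W \<inter> Orb = OrbQ \<and>
    proj_onto h W ` (Orb - proj (orth_compl h W)) = OrbQ"
proof -
  have "closed_orbit_in G Orb' Orb"
    using assms(14) by (simp add: unique_closed_orbit_in_def)
  then interpret gradient_orbit h G K \<pp> ip \<mu> Orb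
    using assms by unfold_locales (auto simp: closed_orbit_in_def)
  obtain S P where "gradient_orbit_element h G K \<pp> ip \<mu> Orb \<beta> S P"
    using resolve_element[OF \<open>\<beta> \<in> \<pp>\<close>] .
  then interpret gradient_orbit_element h G K \<pp> ip \<mu> Orb \<beta> S P .
  have W: "W = top_eigenspace"
    using unique_irreducible_subrep_eq_top assms(17,18) by simp
  have 3: "proj W \<inter> Orb = OrbQ"
    using top_points_of_orbit assms(17,19) by (simp add: W)
  have 4: "proj_onto h W ` (Orb - proj (orth_compl h W)) = OrbQ"
    using projection_of_orbit 3 by (simp add: W)
  have 1: "\<mu> ` OrbQ = {x. x extreme_point_of exposed_face ip \<beta> E}"
    using extreme_points_of_face 3 by (simp add: W assms(15))
  have 2: "{L \<in> proj UNIV. \<mu> L \<in> exposed_face ip \<beta> E} = proj W"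
    unfolding W assms(15) using mu_mem_face_iff by (auto simp: proj_def)
  from 1 2 3 4 show ?thesis by blast
qed

end
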